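(* Let $\iota: R\to A$ be a Frobenius extension, let $T$ be a Wakamatsu tilting left $R$-module, and put $U=A\otimes_R T$. Assume that ${}^{\perp_R}T\subseteq {}^{\perp_R}U$, where $U$ is regarded as an $R$-module by restriction along $\iota$; that is, every $R$-module $X$ with $\operatorname{Ext}_R^i(X,T)=0$ for all $i>0$ satisfies $\operatorname{Ext}_R^i(X,U)=0$ for all $i>0$. Then $U=A\otimes_R T$ is a Wakamatsu tilting $A$-module.
   Context: All rings are associative with unit; modules are left modules unless otherwise specified. A ring extension $\iota:R\to A$ is a unital ring homomorphism, and $A$-modules are viewed as $R$-modules by restriction along $\iota$. It is a Frobenius extension if $A$ is finitely generated projective as a left $R$-module and $A\cong\operatorname{Hom}_R(A,R)$ as $A$-$R$-bimodules, where $(af)(x)=f(xa)$ and $(fr)(x)=f(x)r$. For an $R$-module $M$, $\operatorname{add}_R(M)$ is the class of direct summands of finite direct sums of copies of $M$, and ${}^{\perp_R}M=\{X\mid \operatorname{Ext}_R^i(X,M)=0 \text{ for all } i>0\}$. An $R$-module $T$ is Wakamatsu tilting if: (1) $T$ has a projective resolution by finitely generated projective $R$-modules; (2) $\operatorname{Ext}_R^i(T,T)=0$ for all $i>0$; (3) there is an exact sequence $0\to R\to T_0\to T_1\to T_2\to\cdots$ with each $T_j\in\operatorname{add}_R(T)$ which remains exact after applying $\operatorname{Hom}_R(-,T)$. *)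

theory Defs
  imports "HOL-Algebra.Module" "HOL-Algebra.AbelCoset" "HOL-Algebra.Free_Abelian_Groups"
begin

section \<open>Left modules over arbitrary rings\<close>

text \<open>
  Modules use the record type of \<^theory>\<open>HOL-Algebra.Module\<close>. The library locale
  \<^locale>\<open>module\<close> requires a commutative ring, whereas here the ring is an arbitrary associative
  ring with unit (possibly zero). The fields \<open>mult\<close> and \<open>one\<close> inherited from the ring record
  carry no information.
\<close>

locale left_module = R?: ring R + M?: abelian_group M
  for R :: "('r, 'k) ring_scheme" (structure) and M :: "('r, 'm, 'l) module_scheme" (structure) +
  assumes smult_closed [simp, intro]:
      "\<lbrakk>a \<in> carrier R; x \<in> carrier M\<rbrakk> \<Longrightarrow> a \<odot>\<^bsub>M\<^esub> x \<in> carrier M"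
    and smult_l_distr:
      "\<lbrakk>a \<in> carrier R; b \<in> carrier R; x \<in> carrier M\<rbrakk> \<Longrightarrow>
        (a \<oplus> b) \<odot>\<^bsub>M\<^esub> x = a \<odot>\<^bsub>M\<^esub> x \<oplus>\<^bsub>M\<^esub> b \<odot>\<^bsub>M\<^esub> x"
    and smult_r_distr:
      "\<lbrakk>a \<in> carrier R; x \<in> carrier M; y \<in> carrier M\<rbrakk> \<Longrightarrow>
        a \<odot>\<^bsub>M\<^esub> (x \<oplus>\<^bsub>M\<^esub> y) = a \<odot>\<^bsub>M\<^esub> x \<oplus>\<^bsub>M\<^esub> a \<odot>\<^bsub>M\<^esub> y"
    and smult_assoc1:
      "\<lbrakk>a \<in> carrier R; b \<in> carrier R; x \<in> carrier M\<rbrakk> \<Longrightarrow>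
        (a \<otimes> b) \<odot>\<^bsub>M\<^esub> x = a \<odot>\<^bsub>M\<^esub> (b \<odot>\<^bsub>M\<^esub> x)"
    and smult_one [simp]: "x \<in> carrier M \<Longrightarrow> \<one> \<odot>\<^bsub>M\<^esub> x = x"

definition mk_module ::
    "'m set \<Rightarrow> 'm \<Rightarrow> ('m \<Rightarrow> 'm \<Rightarrow> 'm) \<Rightarrow> ('r \<Rightarrow> 'm \<Rightarrow> 'm) \<Rightarrow> ('r, 'm) module" where
  "mk_module C z p s =
     \<lparr>carrier = C, mult = (\<lambda>_ _. undefined), one = undefined, ring.zero = z, add = p, smult = s\<rparr>"

definition regular_module :: "('r, 'k) ring_scheme \<Rightarrow> ('r, 'r) module" where
  "regular_module R = mk_module (carrier R) \<zero>\<^bsub>R\<^esub> (\<lambda>x y. x \<oplus>\<^bsub>R\<^esub> y) (\<lambda>r x. r \<otimes>\<^bsub>R\<^esub> x)"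

definition restrict_scalars :: "('r \<Rightarrow> 'a) \<Rightarrow> ('a, 'm) module \<Rightarrow> ('r, 'm) module" where
  "restrict_scalars \<iota> M =
     mk_module (carrier M) \<zero>\<^bsub>M\<^esub> (\<lambda>x y. x \<oplus>\<^bsub>M\<^esub> y) (\<lambda>r x. \<iota> r \<odot>\<^bsub>M\<^esub> x)"

text \<open>The direct sum of copies of \<open>M\<close> indexed by \<open>I\<close>: finitely supported functions on \<open>I\<close>.\<close>

definition copower :: "'i set \<Rightarrow> ('r, 'm) module \<Rightarrow> ('r, 'i \<Rightarrow> 'm) module" where
  "copower I M =
     mk_module {f \<in> I \<rightarrow>\<^sub>E carrier M. finite {i \<in> I. f i \<noteq> \<zero>\<^bsub>M\<^esub>}}
       (\<lambda>i\<in>I. \<zero>\<^bsub>M\<^esub>) (\<lambda>f g. \<lambda>i\<in>I. f i \<oplus>\<^bsub>M\<^esub> g i) (\<lambda>r f. \<lambda>i\<in>I. r \<odot>\<^bsub>M\<^esub> f i)"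

section \<open>Homomorphisms and direct summands\<close>

text \<open>Homomorphisms are extensional functions, so that they form a group.\<close>

definition mod_hom ::
    "('r, 'k) ring_scheme \<Rightarrow> ('r, 'm) module \<Rightarrow> ('r, 'n) module \<Rightarrow> ('m \<Rightarrow> 'n) set" where
  "mod_hom R M N =
     {f \<in> carrier M \<rightarrow>\<^sub>E carrier N.
        (\<forall>x\<in>carrier M. \<forall>y\<in>carrier M. f (x \<oplus>\<^bsub>M\<^esub> y) = f x \<oplus>\<^bsub>N\<^esub> f y) \<and>
        (\<forall>r\<in>carrier R. \<forall>x\<in>carrier M. f (r \<odot>\<^bsub>M\<^esub> x) = r \<odot>\<^bsub>N\<^esub> f x)}"

definition mod_isomorphic ::
    "('r, 'k) ring_scheme \<Rightarrow> ('r, 'm) module \<Rightarrow> ('r, 'n) module \<Rightarrow> bool" where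
  "mod_isomorphic R M N \<longleftrightarrow> (\<exists>f\<in>mod_hom R M N. bij_betw f (carrier M) (carrier N))"

definition direct_summand ::
    "('r, 'k) ring_scheme \<Rightarrow> ('r, 'm) module \<Rightarrow> ('r, 'n) module \<Rightarrow> bool" where
  "direct_summand R N L \<longleftrightarrow>
     (\<exists>K K'. submodule K R L \<and> submodule K' R L \<and>
        K \<inter> K' = {\<zero>\<^bsub>L\<^esub>} \<and> K <+>\<^bsub>L\<^esub> K' = carrier L \<and>
        mod_isomorphic R N (L\<lparr>carrier := K\<rparr>))"

definition add_class :: "('r, 'k) ring_scheme \<Rightarrow> ('r, 'm) module \<Rightarrow> ('r, 'n) module set" where
  "add_class R M =
     {N. left_module R N \<and> (\<exists>n::nat. direct_summand R N (copower {..<n} M))}"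

definition fin_gen :: "('r, 'k) ring_scheme \<Rightarrow> ('r, 'm) module \<Rightarrow> bool" where
  "fin_gen R M \<longleftrightarrow>
     (\<exists>S. finite S \<and> S \<subseteq> carrier M \<and> (\<forall>K. submodule K R M \<and> S \<subseteq> K \<longrightarrow> K = carrier M))"

text \<open>
  A module is projective if it is a direct summand of a free module. An index set of
  generators can always be found inside the carrier, so index sets of type \<open>'m set\<close> suffice.
\<close>

definition projective :: "('r, 'k) ring_scheme \<Rightarrow> ('r, 'm) module \<Rightarrow> bool" where
  "projective R M \<longleftrightarrow>
     left_module R M \<and> (\<exists>I::'m set. direct_summand R M (copower I (regular_module R)))"

definition hom_group ::
    "('r, 'k) ring_scheme \<Rightarrow> ('r, 'm) module \<Rightarrow> ('r, 'n) module \<Rightarrow> ('m \<Rightarrow> 'n) monoid" where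
  "hom_group R M N =
     \<lparr>carrier = mod_hom R M N,
      mult = (\<lambda>f g. \<lambda>x\<in>carrier M. f x \<oplus>\<^bsub>N\<^esub> g x),
      one = (\<lambda>x\<in>carrier M. \<zero>\<^bsub>N\<^esub>)\<rparr>"

text \<open>For \<open>f : M \<rightarrow> L\<close>, the induced map \<open>Hom(L, N) \<rightarrow> Hom(M, N)\<close>, \<open>g \<mapsto> g \<circ> f\<close>.\<close>

definition pullback :: "('r, 'm) module \<Rightarrow> ('m \<Rightarrow> 'l) \<Rightarrow> ('l \<Rightarrow> 'n) \<Rightarrow> ('m \<Rightarrow> 'n)" where
  "pullback M f = (\<lambda>g. compose (carrier M) g f)"

text \<open>Exactness of \<open>G \<rightarrow> H \<rightarrow> K\<close> at \<open>H\<close>; for modules this is applied to the additive groups.\<close>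

definition exact_at ::
    "('g, 'u) monoid_scheme \<Rightarrow> ('g \<Rightarrow> 'h) \<Rightarrow> ('h, 'v) monoid_scheme \<Rightarrow> ('h \<Rightarrow> 'k) \<Rightarrow>
     ('k, 'w) monoid_scheme \<Rightarrow> bool" where
  "exact_at G f H g K \<longleftrightarrow> f ` carrier G = kernel H K g"

section \<open>Ext\<close>

text \<open>\<open>\<dots> \<rightarrow> P 2 \<rightarrow> P 1 \<rightarrow> P 0 \<rightarrow> X \<rightarrow> 0\<close> with \<open>d i : P (i + 1) \<rightarrow> P i\<close> and \<open>e : P 0 \<rightarrow> X\<close>.\<close>

definition projective_resolution ::
    "('r, 'k) ring_scheme \<Rightarrow> ('r, 'x) module \<Rightarrow>
     (nat \<Rightarrow> ('r, 'p) module) \<Rightarrow> (nat \<Rightarrow> 'p \<Rightarrow> 'p) \<Rightarrow> ('p \<Rightarrow> 'x) \<Rightarrow> bool" where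
  "projective_resolution R X P d e \<longleftrightarrow>
     (\<forall>i. projective R (P i)) \<and>
     (\<forall>i. d i \<in> mod_hom R (P (Suc i)) (P i)) \<and>
     e \<in> mod_hom R (P 0) X \<and>
     e ` carrier (P 0) = carrier X \<and>
     exact_at (add_monoid (P 1)) (d 0) (add_monoid (P 0)) e (add_monoid X) \<and>
     (\<forall>i. exact_at (add_monoid (P (Suc (Suc i)))) (d (Suc i))
            (add_monoid (P (Suc i))) (d i) (add_monoid (P i)))"

text \<open>
  \<open>Ext\<^sup>i(X, M)\<close> is the cohomology of \<open>Hom(P, M)\<close> for a projective resolution \<open>P\<close> of \<open>X\<close>, which does
  not depend on \<open>P\<close> up to isomorphism. To name one resolution its terms need a common type:
  \<open>('r + 'x) list \<Rightarrow> 'r\<close> contains the free module on the basis \<open>('r + 'x) list\<close>, whose cardinality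
  does not exceed that of the basis, so that \<open>X\<close> and all syzygies are quotients of it.
\<close>

type_synonym ('r, 'x) res_carrier = "('r + 'x) list \<Rightarrow> 'r"

lemma mk_module_sel [simp]:
  "carrier (mk_module C z p s) = C" "\<zero>\<^bsub>mk_module C z p s\<^esub> = z"
  "x \<oplus>\<^bsub>mk_module C z p s\<^esub> y = p x y" "r \<odot>\<^bsub>mk_module C z p s\<^esub> x = s r x"
  by (simp_all add: mk_module_def)

lemma (in left_module) smult_r_zero [simp]: "a \<in> carrier R \<Longrightarrow> a \<odot>\<^bsub>M\<^esub> \<zero>\<^bsub>M\<^esub> = \<zero>\<^bsub>M\<^esub>"
  using smult_r_distr[of a "\<zero>\<^bsub>M\<^esub>" "\<zero>\<^bsub>M\<^esub>"] M.add.r_cancel_one'[of "a \<odot>\<^bsub>M\<^esub> \<zero>\<^bsub>M\<^esub>" "a \<odot>\<^bsub>M\<^esub> \<zero>\<^bsub>M\<^esub>"]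
  by simp

lemma (in left_module) smult_l_zero [simp]: "x \<in> carrier M \<Longrightarrow> \<zero> \<odot>\<^bsub>M\<^esub> x = \<zero>\<^bsub>M\<^esub>"
  using smult_l_distr[of \<zero> \<zero> x] M.add.r_cancel_one'[of "\<zero> \<odot>\<^bsub>M\<^esub> x" "\<zero> \<odot>\<^bsub>M\<^esub> x"]
  by simp

lemma regular_left_module: assumes "ring R" shows "left_module R (regular_module R)"
proof -
  interpret ring R by fact
  have "abelian_group (regular_module R)"
    by (rule abelian_groupI)
       (auto simp: regular_module_def a_ac intro: l_neg)
  then show ?thesis
    unfolding left_module_def left_module_axioms_def
    by (auto simp: assms l_distr r_distr m_assoc regular_module_def)
qed

lemma copower_left_module: assumes "left_module R M" shows "left_module R (copower I M)"
proof -
  interpret left_module R M by fact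
  have fin2: "finite {i \<in> I. f i \<oplus>\<^bsub>M\<^esub> g i \<noteq> \<zero>\<^bsub>M\<^esub>}"
    if "finite {i \<in> I. f i \<noteq> \<zero>\<^bsub>M\<^esub>}" "finite {i \<in> I. g i \<noteq> \<zero>\<^bsub>M\<^esub>}" for f g
    by (rule finite_subset[OF _ finite_UnI[OF that]]) auto
  have fin1: "finite {i \<in> I. r \<odot>\<^bsub>M\<^esub> f i \<noteq> \<zero>\<^bsub>M\<^esub>}"
    if "finite {i \<in> I. f i \<noteq> \<zero>\<^bsub>M\<^esub>}" "r \<in> carrier R" for f r
    by (rule finite_subset[OF _ that(1)]) (use that in auto)
  have "abelian_group (copower I M)"
  proof (rule abelian_groupI)
    fix f assume f: "f \<in> carrier (copower I M)"
    define g where "g = (\<lambda>i\<in>I. \<ominus>\<^bsub>M\<^esub> f i)"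
    have fin: "finite {i \<in> I. \<ominus>\<^bsub>M\<^esub> f i \<noteq> \<zero>\<^bsub>M\<^esub>}"
      by (rule finite_subset[of _ "{i \<in> I. f i \<noteq> \<zero>\<^bsub>M\<^esub>}"]) (use f in \<open>auto simp: copower_def\<close>)
    have "g \<in> carrier (copower I M)" "g \<oplus>\<^bsub>copower I M\<^esub> f = \<zero>\<^bsub>copower I M\<^esub>"
      using f fin by (auto simp: copower_def g_def PiE_iff M.l_neg cong: conj_cong restrict_cong)
    then show "\<exists>g\<in>carrier (copower I M). g \<oplus>\<^bsub>copower I M\<^esub> f = \<zero>\<^bsub>copower I M\<^esub>" by blast
  qed (auto simp: copower_def PiE_iff fin2 M.a_assoc extensional_def fun_eq_iff intro: M.a_comm cong: conj_cong)
  then show ?thesis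
    unfolding left_module_def left_module_axioms_def
    by (auto simp: copower_def PiE_iff fin1 smult_l_distr smult_r_distr smult_assoc1
          extensional_def fun_eq_iff R.ring_axioms cong: conj_cong)
qed

lemma mod_isomorphic_reindex:
  fixes M :: "('r, 'c) module" and I :: "'i set" and J :: "'j set"
  assumes M: "left_module R M" and g: "bij_betw g I J"
  shows "mod_isomorphic R (copower I M) (copower J M)"
proof -
  define h where "h = inv_into I g"
  have h: "bij_betw h J I" using g by (simp add: h_def bij_betw_inv_into)
  have gh: "g (h j) = j" if "j \<in> J" for j using g that by (simp add: h_def bij_betw_inv_into_right)
  have hg: "h (g i) = i" if "i \<in> I" for i using g that by (simp add: h_def bij_betw_inv_into_left)
  have hI: "h j \<in> I" if "j \<in> J" for j using h that by (auto simp: bij_betw_def)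
  have gJ: "g i \<in> J" if "i \<in> I" for i using g that by (auto simp: bij_betw_def)
  have fin: "finite {j \<in> J. f (h j) \<noteq> z}" if "finite {i \<in> I. f i \<noteq> z}" for f and z :: 'c
    by (rule finite_subset[OF _ finite_imageI[OF that, of g]]) (use gh hI in force)
  have fin': "finite {i \<in> I. f (g i) \<noteq> z}" if "finite {j \<in> J. f j \<noteq> z}" for f and z :: 'c
    by (rule finite_subset[OF _ finite_imageI[OF that, of h]]) (use hg gJ in force)
  define \<phi> where "\<phi> = (\<lambda>f\<in>carrier (copower I M). \<lambda>j\<in>J. f (h j))"
  define \<psi> where "\<psi> = (\<lambda>f::'j \<Rightarrow> 'c. \<lambda>i\<in>I. f (g i))"
  have cl: "(\<lambda>j\<in>J. f (h j)) \<in> carrier (copower J M)" if "f \<in> carrier (copower I M)" for f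
    using that fin[of f] by (auto simp: copower_def hI PiE_iff cong: conj_cong)
  have cl': "\<psi> f \<in> carrier (copower I M)" if "f \<in> carrier (copower J M)" for f
    using that fin'[of f] by (auto simp: copower_def gJ PiE_iff \<psi>_def cong: conj_cong)
  have "bij_betw \<phi> (carrier (copower I M)) (carrier (copower J M))"
  proof (rule bij_betw_byWitness[where f' = \<psi>])
    show "\<forall>f\<in>carrier (copower I M). \<psi> (\<phi> f) = f"
      by (auto simp: \<phi>_def \<psi>_def gJ hg fun_eq_iff) (auto simp: copower_def PiE_iff extensional_def)
    show "\<forall>f\<in>carrier (copower J M). \<phi> (\<psi> f) = f"
    proof
      fix f assume f: "f \<in> carrier (copower J M)"
      then have "\<phi> (\<psi> f) = (\<lambda>j\<in>J. \<psi> f (h j))"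
        using cl'[OF f] by (auto simp: \<phi>_def)
      also have "\<dots> = f"
        using f by (auto simp: \<psi>_def hI gh fun_eq_iff copower_def PiE_iff extensional_def)
      finally show "\<phi> (\<psi> f) = f" .
    qed
  qed (use cl cl' in \<open>auto simp: \<phi>_def\<close>)
  moreover have "\<phi> \<in> mod_hom R (copower I M) (copower J M)"
  proof -
    interpret L: left_module R "copower I M" by (rule copower_left_module[OF M])
    have "\<phi> (f \<oplus>\<^bsub>copower I M\<^esub> f') = \<phi> f \<oplus>\<^bsub>copower J M\<^esub> \<phi> f'"
      if f: "f \<in> carrier (copower I M)" "f' \<in> carrier (copower I M)" for f f'
    proof -
      have "\<phi> (f \<oplus>\<^bsub>copower I M\<^esub> f') = (\<lambda>j\<in>J. (f \<oplus>\<^bsub>copower I M\<^esub> f') (h j))"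
        using L.M.a_closed[OF f] by (simp add: \<phi>_def)
      then show ?thesis using f by (simp add: \<phi>_def) (simp add: copower_def hI cong: restrict_cong)
    qed
    moreover have "\<phi> (r \<odot>\<^bsub>copower I M\<^esub> f) = r \<odot>\<^bsub>copower J M\<^esub> \<phi> f"
      if f: "f \<in> carrier (copower I M)" "r \<in> carrier R" for f r
    proof -
      have "\<phi> (r \<odot>\<^bsub>copower I M\<^esub> f) = (\<lambda>j\<in>J. (r \<odot>\<^bsub>copower I M\<^esub> f) (h j))"
        using L.smult_closed[OF f(2,1)] by (simp add: \<phi>_def)
      then show ?thesis using f by (simp add: \<phi>_def) (simp add: copower_def hI cong: restrict_cong)
    qed
    ultimately show ?thesis using cl by (auto simp: mod_hom_def \<phi>_def)
  qed
  ultimately show ?thesis unfolding mod_isomorphic_def by blast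
qed

lemma direct_summandI:
  assumes "left_module R L" "mod_isomorphic R N L"
  shows "direct_summand R N L"
proof -
  interpret left_module R L by fact
  have "submodule (carrier L) R L" "submodule {\<zero>\<^bsub>L\<^esub>} R L"
    using M.add.subgroup_self M.add.triv_subgroup
    by (simp_all add: submodule_def submodule_axioms_def)
  moreover have "carrier L <+>\<^bsub>L\<^esub> {\<zero>\<^bsub>L\<^esub>} = carrier L"
    unfolding set_add_def set_mult_def by (simp add: M.r_zero)
  ultimately show ?thesis
    unfolding direct_summand_def using assms(2)
    by (intro exI[of _ "carrier L"] exI[of _ "{\<zero>\<^bsub>L\<^esub>}"]) simp
qed

lemma free_projective:
  assumes "ring R" shows "projective R (copower (UNIV::'b set) (regular_module R) :: ('r, 'b \<Rightarrow> 'r) module)"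
proof -
  have reg: "left_module R (regular_module R)" by (rule regular_left_module[OF assms])
  have "\<exists>J :: ('b \<Rightarrow> 'r) set. mod_isomorphic R (copower (UNIV::'b set) (regular_module R)) (copower J (regular_module R))"
  proof (cases "\<exists>u v :: 'r. u \<noteq> v")
    case True
    then obtain u v :: 'r where uv: "u \<noteq> v" by blast
    have "inj (\<lambda>b c :: 'b. if c = b then u else v)"
      by (rule injI) (metis uv)
    then have "bij_betw (\<lambda>b c :: 'b. if c = b then u else v) UNIV (range (\<lambda>b c :: 'b. if c = b then u else v))"
      by (rule inj_on_imp_bij_betw)
    from mod_isomorphic_reindex[OF reg this] show ?thesis by blast
  next
    case False
    then have triv: "x = y" for x y :: 'r by blast
    define \<phi> :: "('b \<Rightarrow> 'r) \<Rightarrow> (('b \<Rightarrow> 'r) \<Rightarrow> 'r)" where "\<phi> = (\<lambda>_ _. undefined)"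
    have triv2: "f = g" for f g :: "('b \<Rightarrow> 'r) \<Rightarrow> 'r" by (rule ext) (rule triv)
    have c1: "carrier (copower {} (regular_module R) :: ('r, ('b\<Rightarrow>'r) \<Rightarrow> 'r) module) = {\<phi> undefined}"
      by (auto simp: copower_def \<phi>_def)
    have c2: "carrier (copower (UNIV::'b set) (regular_module R) :: ('r, 'b \<Rightarrow> 'r) module) = {undefined}"
    proof -
      interpret L: left_module R "copower (UNIV::'b set) (regular_module R)"
        by (rule copower_left_module[OF reg])
      have u: "x = undefined" for x :: "'b \<Rightarrow> 'r" by (rule ext) (rule triv)
      have "undefined \<in> carrier (copower (UNIV::'b set) (regular_module R))"
        using L.M.zero_closed unfolding u[of "\<zero>\<^bsub>copower UNIV (regular_module R)\<^esub>"] .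
      then have "x \<in> carrier (copower (UNIV::'b set) (regular_module R))" for x
        by (subst u[of x])
      then show ?thesis by (intro equalityI subsetI singletonI) (simp_all only: singleton_iff, rule u)
    qed
    have "\<phi> \<in> mod_hom R (copower UNIV (regular_module R)) (copower {} (regular_module R))"
    proof -
      have "\<phi> \<in> {undefined} \<rightarrow>\<^sub>E {\<phi> undefined}"
        by (rule PiE_I) (simp, rule triv2)
      then show ?thesis unfolding mod_hom_def c1 c2
        by (intro CollectI conjI ballI) (assumption | rule triv2)+
    qed
    moreover have "bij_betw \<phi> {undefined} {\<phi> undefined}" by (simp add: bij_betw_def)
    ultimately show ?thesis unfolding mod_isomorphic_def
      by (intro exI[of _ "{}"] bexI[of _ \<phi>]) (simp_all only: c1 c2)
  qed
  then show ?thesis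
    unfolding projective_def 
    by (elim exE) (intro conjI exI copower_left_module[OF reg] direct_summandI[OF copower_left_module[OF reg]])
qed

lemma eval_free_hom:
  fixes s :: "'b \<Rightarrow> 'm" and M :: "('r, 'm) module" and R :: "('r, 'k) ring_scheme"
  assumes M: "left_module R M" and H: "submodule H R M" and s: "range s = H"
  defines "F \<equiv> copower (UNIV :: 'b set) (regular_module R)"
  shows "\<exists>f\<in>mod_hom R F M. f ` carrier F = H"
proof -
  interpret left_module R M by fact
  interpret H: submodule H R M by fact
  have HM: "H \<subseteq> carrier M" using H.subset by simp
  have sM [simp, intro]: "s b \<in> carrier M" "s b \<in> H" for b using s HM by auto
  have F: "left_module R F" unfolding F_def by (intro copower_left_module regular_left_module R.ring_axioms)
  interpret F: left_module R F by (rule F)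
  define supp where "supp f = {b. f b \<noteq> \<zero>\<^bsub>R\<^esub>}" for f :: "'b \<Rightarrow> 'r"
  have carF: "f \<in> carrier F \<longleftrightarrow> (\<forall>b. f b \<in> carrier R) \<and> finite (supp f)" for f
    by (auto simp: F_def copower_def regular_module_def supp_def PiE_iff)
  have addF: "f \<oplus>\<^bsub>F\<^esub> g = (\<lambda>b. f b \<oplus>\<^bsub>R\<^esub> g b)" for f g by (simp add: F_def copower_def regular_module_def restrict_def)
  have smF: "r \<odot>\<^bsub>F\<^esub> f = (\<lambda>b. r \<otimes>\<^bsub>R\<^esub> f b)" for f r by (simp add: F_def copower_def regular_module_def restrict_def)
  define ev where "ev f = (\<Oplus>\<^bsub>M\<^esub>b\<in>supp f. f b \<odot>\<^bsub>M\<^esub> s b)" for f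
  have ev: "ev f = (\<Oplus>\<^bsub>M\<^esub>b\<in>S. f b \<odot>\<^bsub>M\<^esub> s b)" if "finite S" "supp f \<subseteq> S" "f \<in> carrier F" for S f
    unfolding ev_def by (rule M.add.finprod_mono_neutral_cong_left) (use that in \<open>auto simp: supp_def carF\<close>)
  have evH: "ev f \<in> H" if f: "f \<in> carrier F" for f
  proof -
    have "finite S \<Longrightarrow> (\<Oplus>\<^bsub>M\<^esub>b\<in>S. f b \<odot>\<^bsub>M\<^esub> s b) \<in> H" for S
    proof (induction S rule: finite_induct)
      case empty then show ?case using H.one_closed by simp
    next
      case (insert x S)
      then show ?case using f H.m_closed[of "f x \<odot>\<^bsub>M\<^esub> s x"] by (simp add: carF Pi_def)
    qed
    then show ?thesis using f by (simp add: ev_def carF)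
  qed
  have add: "ev (f \<oplus>\<^bsub>F\<^esub> g) = ev f \<oplus>\<^bsub>M\<^esub> ev g" if f: "f \<in> carrier F" and g: "g \<in> carrier F" for f g
  proof -
    let ?S = "supp f \<union> supp g"
    have S: "finite ?S" using f g by (simp add: carF)
    have "ev (f \<oplus>\<^bsub>F\<^esub> g) = (\<Oplus>\<^bsub>M\<^esub>b\<in>?S. (f \<oplus>\<^bsub>F\<^esub> g) b \<odot>\<^bsub>M\<^esub> s b)"
      by (rule ev[OF S]) (use f g F.M.a_closed in \<open>auto simp: supp_def addF\<close>)
    also have "\<dots> = (\<Oplus>\<^bsub>M\<^esub>b\<in>?S. f b \<odot>\<^bsub>M\<^esub> s b \<oplus>\<^bsub>M\<^esub> g b \<odot>\<^bsub>M\<^esub> s b)"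
      by (rule M.add.finprod_cong') (use f g in \<open>auto simp: carF addF smult_l_distr\<close>)
    also have "\<dots> = ev f \<oplus>\<^bsub>M\<^esub> ev g"
      using ev[OF S _ f] ev[OF S _ g] f g by (subst M.finsum_addf) (auto simp: carF)
    finally show ?thesis .
  qed
  have sm: "ev (r \<odot>\<^bsub>F\<^esub> f) = r \<odot>\<^bsub>M\<^esub> ev f" if f: "f \<in> carrier F" and r: "r \<in> carrier R" for f r
  proof -
    have "ev (r \<odot>\<^bsub>F\<^esub> f) = (\<Oplus>\<^bsub>M\<^esub>b\<in>supp f. (r \<odot>\<^bsub>F\<^esub> f) b \<odot>\<^bsub>M\<^esub> s b)"
      by (rule ev) (use f r F.smult_closed in \<open>auto simp: supp_def smF carF\<close>)
    also have "\<dots> = (\<Oplus>\<^bsub>M\<^esub>b\<in>supp f. r \<odot>\<^bsub>M\<^esub> (f b \<odot>\<^bsub>M\<^esub> s b))"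
      by (rule M.add.finprod_cong') (use f r in \<open>auto simp: carF smF smult_assoc1\<close>)
    also have "\<dots> = r \<odot>\<^bsub>M\<^esub> ev f"
    proof -
      have "finite S \<Longrightarrow> (\<Oplus>\<^bsub>M\<^esub>b\<in>S. r \<odot>\<^bsub>M\<^esub> (f b \<odot>\<^bsub>M\<^esub> s b)) = r \<odot>\<^bsub>M\<^esub> (\<Oplus>\<^bsub>M\<^esub>b\<in>S. f b \<odot>\<^bsub>M\<^esub> s b)" for S
        by (induction S rule: finite_induct) (use f r in \<open>auto simp: carF smult_r_distr Pi_def\<close>)
      then show ?thesis using f by (simp add: ev_def carF)
    qed
    finally show ?thesis .
  qed
  have "restrict ev (carrier F) \<in> mod_hom R F M"
    using evH HM F.M.a_closed F.smult_closed by (auto simp: mod_hom_def add sm)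
  moreover have "restrict ev (carrier F) ` carrier F = H"
  proof -
    have "s b \<in> ev ` carrier F" for b
    proof -
      define f where "f = (\<lambda>c. if c = b then \<one>\<^bsub>R\<^esub> else \<zero>\<^bsub>R\<^esub>)"
      have sub: "supp f \<subseteq> {b}" by (auto simp: supp_def f_def)
      have f: "f \<in> carrier F" using finite_subset[OF sub] by (auto simp: carF f_def)
      have "ev f = s b" using ev[OF _ sub f] by (simp add: f_def)
      then show ?thesis using f by force
    qed
    then show ?thesis using evH s by auto
  qed
  ultimately show ?thesis by (intro bexI[of _ "restrict ev (carrier F)"])
qed

lemma card_free:
  fixes R :: "('r, 'k) ring_scheme"
  assumes "infinite (UNIV::'b set)" "|UNIV::'r set| \<le>o |UNIV::'b set|"
  shows "|carrier (copower (UNIV::'b set) (regular_module R))| \<le>o |UNIV::'b set|"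
proof -
  let ?z = "\<zero>\<^bsub>R\<^esub>"
  define l where "l f = (SOME xs. set xs = {(b, f b) | b. f b \<noteq> ?z})" for f :: "'b \<Rightarrow> 'r"
  have l: "set (l f) = {(b, f b) | b. f b \<noteq> ?z}" if "finite {b. f b \<noteq> ?z}" for f
    unfolding l_def
  proof (rule someI_ex)
    show "\<exists>xs. set xs = {(b, f b) | b. f b \<noteq> ?z}"
      by (rule finite_list) (use that in simp)
  qed
  have "inj_on l {f. finite {b. f b \<noteq> ?z}}"
  proof (rule inj_onI)
    fix f g assume f: "f \<in> {f. finite {b. f b \<noteq> ?z}}" and g: "g \<in> {f. finite {b. f b \<noteq> ?z}}" and eq: "l f = l g"
    from f g eq have *: "{(b, f b) | b. f b \<noteq> ?z} = {(b, g b) | b. g b \<noteq> ?z}" 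
      using l[of f] l[of g] by simp
    show "f = g"
    proof
      fix b
      have "(b, f b) \<in> {(b, f b) | b. f b \<noteq> ?z} \<longleftrightarrow> (b, f b) \<in> {(b, g b) | b. g b \<noteq> ?z}"
        "(b, g b) \<in> {(b, f b) | b. f b \<noteq> ?z} \<longleftrightarrow> (b, g b) \<in> {(b, g b) | b. g b \<noteq> ?z}"
        by (simp_all only: *)
      then show "f b = g b" by auto
    qed
  qed
  then have "inj_on l (carrier (copower (UNIV::'b set) (regular_module R)))"
    by (rule inj_on_subset) (auto simp: copower_def regular_module_def)
  then have "|carrier (copower (UNIV::'b set) (regular_module R))| \<le>o |UNIV :: ('b \<times> 'r) list set|"
    by (intro card_of_ordLeqI[of l]) auto
  also have "|UNIV :: ('b \<times> 'r) list set| =o |UNIV :: ('b \<times> 'r) set|"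
  proof -
    have "infinite (UNIV :: ('b \<times> 'r) set)"
      using assms(1) finite_imageI[of "UNIV :: ('b \<times> 'r) set" fst] by auto
    from card_of_lists_infinite[OF this] show ?thesis by (simp only: lists_UNIV)
  qed
  also have "|UNIV :: ('b \<times> 'r) set| =o |(UNIV :: 'b set) \<times> (UNIV::'r set)|"
    by (simp only: UNIV_Times_UNIV card_of_refl)
  also have "|(UNIV :: 'b set) \<times> (UNIV::'r set)| \<le>o |(UNIV::'b set) \<times> (UNIV::'b set)|"
    by (rule card_of_Times_mono2[OF assms(2)])
  also have "|(UNIV::'b set) \<times> (UNIV::'b set)| =o |UNIV::'b set|"
    by (rule card_of_Times_same_infinite[OF assms(1)])
  finally show ?thesis .
qed

lemma kernel_submodule:
  assumes "left_module R M" "left_module R N" "f \<in> mod_hom R M N"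
  shows "submodule (kernel (add_monoid M) (add_monoid N) f) R M"
proof -
  interpret M: left_module R M by fact
  interpret N: left_module R N by fact
  have hom: "f \<in> hom (add_monoid M) (add_monoid N)" using assms(3) by (auto simp: mod_hom_def hom_def)
  interpret group_hom "add_monoid M" "add_monoid N" f
    by (intro group_hom.intro group_hom_axioms.intro hom M.M.a_group N.M.a_group)
  show ?thesis
    by (intro submodule.intro submodule_axioms.intro subgroup_kernel)
       (use assms(3) in \<open>auto simp: kernel_def mod_hom_def\<close>)
qed

theorem projective_resolution_exists:
  fixes R :: "('r, 'k) ring_scheme" and X :: "('r, 'x) module"
  assumes X: "left_module R X"
  shows "\<exists>(P :: nat \<Rightarrow> ('r, ('r, 'x) res_carrier) module) d e. projective_resolution R X P d e"
proof -
  interpret X: left_module R X by (rule X)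
  have ring: "ring R" by (rule X.R.ring_axioms)
  define F where "F = (copower UNIV (regular_module R) :: ('r, ('r, 'x) res_carrier) module)"
  have F: "left_module R F" unfolding F_def by (intro copower_left_module regular_left_module ring)
  have inf: "infinite (UNIV :: ('r + 'x) list set)" by (rule infinite_UNIV_listI)
  have r: "|UNIV :: 'r set| \<le>o |UNIV :: ('r + 'x) list set|"
    by (rule card_of_ordLeqI[of "\<lambda>r. [Inl r]"]) (auto simp: inj_on_def)
  have x: "|UNIV :: 'x set| \<le>o |UNIV :: ('r + 'x) list set|"
    by (rule card_of_ordLeqI[of "\<lambda>r. [Inr r]"]) (auto simp: inj_on_def)
  have cover: "\<exists>f\<in>mod_hom R F M. f ` carrier F = H"
    if M: "left_module R M" and H: "submodule H R M" and c: "|H| \<le>o |UNIV :: ('r + 'x) list set|"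
    for M :: "('r, 'm) module" and H
  proof -
    have "H \<noteq> {}" using subgroup.one_closed[OF submodule.axioms(1)[OF H]] by auto
    then obtain s :: "('r + 'x) list \<Rightarrow> 'm" where "range s = H" using c card_of_ordLeq2 by metis
    from eval_free_hom[OF M H this] show ?thesis by (simp add: F_def)
  qed
  have subX: "submodule (carrier X) R X"
    by (intro submodule.intro submodule_axioms.intro) (use X.M.add.subgroup_self in auto)
  obtain e where e: "e \<in> mod_hom R F X" "e ` carrier F = carrier X"
    using cover[OF X subX] x ordLeq_transitive[OF card_of_mono1[OF subset_UNIV]] by blast
  have step: "\<exists>d\<in>mod_hom R F F. d ` carrier F = kernel (add_monoid F) (add_monoid N) h"
    if N: "left_module R N" and h: "h \<in> mod_hom R F N" for N :: "('r, 'n) module" and h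
  proof (rule cover[OF F kernel_submodule[OF F N h]])
    show "|kernel (add_monoid F) (add_monoid N) h| \<le>o |UNIV :: ('r + 'x) list set|"
      by (rule ordLeq_transitive[OF card_of_mono1 card_free[OF inf r, of R]]) (auto simp: kernel_def F_def)
  qed
  obtain d0 where d0: "d0 \<in> mod_hom R F F" "d0 ` carrier F = kernel (add_monoid F) (add_monoid X) e"
    using step[OF X e(1)] by blast
  have "\<exists>d. \<forall>n. (d n \<in> mod_hom R F F \<and> (n = 0 \<longrightarrow> d n = d0)) \<and>
          d (Suc n) ` carrier F = kernel (add_monoid F) (add_monoid F) (d n)"
    by (rule dependent_nat_choice) (use d0 step[OF F] in blast)+
  then obtain d where d: "\<And>n. d n \<in> mod_hom R F F" "d 0 = d0"
      "\<And>n. d (Suc n) ` carrier F = kernel (add_monoid F) (add_monoid F) (d n)" by blast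
  have "projective_resolution R X (\<lambda>_. F) d e"
    using d d0 e free_projective[OF ring, where 'b = "('r + 'x) list"]
    by (simp add: projective_resolution_def exact_at_def F_def[symmetric])
  then show ?thesis by blast
qed

definition hom_cocycles ::
    "('r, 'k) ring_scheme \<Rightarrow> (nat \<Rightarrow> ('r, 'p) module) \<Rightarrow> (nat \<Rightarrow> 'p \<Rightarrow> 'p) \<Rightarrow>
     ('r, 'm) module \<Rightarrow> nat \<Rightarrow> ('p \<Rightarrow> 'm) set" where
  "hom_cocycles R P d M i =
     kernel (hom_group R (P i) M) (hom_group R (P (Suc i)) M) (pullback (P (Suc i)) (d i))"

primrec hom_coboundaries ::
    "('r, 'k) ring_scheme \<Rightarrow> (nat \<Rightarrow> ('r, 'p) module) \<Rightarrow> (nat \<Rightarrow> 'p \<Rightarrow> 'p) \<Rightarrow>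
     ('r, 'm) module \<Rightarrow> nat \<Rightarrow> ('p \<Rightarrow> 'm) set" where
  "hom_coboundaries R P d M 0 = {\<one>\<^bsub>hom_group R (P 0) M\<^esub>}"
| "hom_coboundaries R P d M (Suc i) = pullback (P (Suc i)) (d i) ` mod_hom R (P i) M"

definition hom_cohomology ::
    "('r, 'k) ring_scheme \<Rightarrow> (nat \<Rightarrow> ('r, 'p) module) \<Rightarrow> (nat \<Rightarrow> 'p \<Rightarrow> 'p) \<Rightarrow>
     ('r, 'm) module \<Rightarrow> nat \<Rightarrow> ('p \<Rightarrow> 'm) set monoid" where
  "hom_cohomology R P d M i =
     (hom_group R (P i) M)\<lparr>carrier := hom_cocycles R P d M i\<rparr> Mod hom_coboundaries R P d M i"

definition some_resolution ::
    "('r, 'k) ring_scheme \<Rightarrow> ('r, 'x) module \<Rightarrow>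
     (nat \<Rightarrow> ('r, ('r, 'x) res_carrier) module) \<times>
     (nat \<Rightarrow> ('r, 'x) res_carrier \<Rightarrow> ('r, 'x) res_carrier) \<times> (('r, 'x) res_carrier \<Rightarrow> 'x)" where
  "some_resolution R X = (SOME (P, d, e). projective_resolution R X P d e)"

definition Ext ::
    "('r, 'k) ring_scheme \<Rightarrow> nat \<Rightarrow> ('r, 'x) module \<Rightarrow> ('r, 'm) module \<Rightarrow>
     (('r, 'x) res_carrier \<Rightarrow> 'm) set monoid" where
  "Ext R i X M = (case some_resolution R X of (P, d, e) \<Rightarrow> hom_cohomology R P d M i)"

text \<open>
  Types cannot be quantified inside a formula, so the class of all modules \<open>X\<close> is rendered as that
  of all modules with carrier in a type \<open>'x\<close>, which acts as the universe and has to be chosen large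
  enough where the class is used. A type into which \<open>nat \<Rightarrow> 't\<close> embeds contains a copy of every
  submodule of every finite power of a module on \<open>'t\<close>.
\<close>

definition left_perp :: "('r, 'k) ring_scheme \<Rightarrow> ('r, 'm) module \<Rightarrow> ('r, 'x) module set" where
  "left_perp R M = {X. left_module R X \<and> (\<forall>i>0. trivial_group (Ext R i X M))}"

section \<open>Wakamatsu tilting modules\<close>

text \<open>
  \<open>0 \<rightarrow> R \<rightarrow> T\<^sub>0 \<rightarrow> T\<^sub>1 \<rightarrow> \<dots>\<close> is given by \<open>h : R \<rightarrow> T\<^sub>0\<close> and \<open>d j : T\<^sub>j \<rightarrow> T\<^sub>j\<^sub>+\<^sub>1\<close>; the last three
  conjuncts express exactness of \<open>\<dots> \<rightarrow> Hom(T\<^sub>1, T) \<rightarrow> Hom(T\<^sub>0, T) \<rightarrow> Hom(R, T) \<rightarrow> 0\<close>.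
\<close>

definition add_coresolution ::
    "('r, 'k) ring_scheme \<Rightarrow> ('r, 't) module \<Rightarrow>
     (nat \<Rightarrow> ('r, 'p) module) \<Rightarrow> (nat \<Rightarrow> 'p \<Rightarrow> 'p) \<Rightarrow> ('r \<Rightarrow> 'p) \<Rightarrow> bool" where
  "add_coresolution R T Ts d h \<longleftrightarrow>
     (\<forall>j. Ts j \<in> add_class R T) \<and>
     h \<in> mod_hom R (regular_module R) (Ts 0) \<and>
     (\<forall>j. d j \<in> mod_hom R (Ts j) (Ts (Suc j))) \<and>
     inj_on h (carrier R) \<and>
     exact_at (add_monoid (regular_module R)) h (add_monoid (Ts 0)) (d 0) (add_monoid (Ts 1)) \<and>
     (\<forall>j. exact_at (add_monoid (Ts j)) (d j)
            (add_monoid (Ts (Suc j))) (d (Suc j)) (add_monoid (Ts (Suc (Suc j))))) \<and>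
     pullback (regular_module R) h ` mod_hom R (Ts 0) T = mod_hom R (regular_module R) T \<and>
     exact_at (hom_group R (Ts 1) T) (pullback (Ts 0) (d 0))
       (hom_group R (Ts 0) T) (pullback (regular_module R) h)
       (hom_group R (regular_module R) T) \<and>
     (\<forall>j. exact_at (hom_group R (Ts (Suc (Suc j))) T) (pullback (Ts (Suc j)) (d (Suc j)))
            (hom_group R (Ts (Suc j)) T) (pullback (Ts j) (d j)) (hom_group R (Ts j) T))"

text \<open>
  Up to isomorphism, every finitely generated projective module is a submodule of some \<open>R\<^sup>n\<close> and
  every module in \<open>add T\<close> a submodule of some \<open>T\<^sup>n\<close>. Hence the carrier types \<open>nat \<Rightarrow> 'r\<close> and
  \<open>nat \<Rightarrow> 't\<close> for the terms of the two sequences lose no generality.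
\<close>

definition wakamatsu_tilting :: "('r, 'k) ring_scheme \<Rightarrow> ('r, 't) module \<Rightarrow> bool" where
  "wakamatsu_tilting R T \<longleftrightarrow>
     left_module R T \<and>
     (\<exists>(P :: nat \<Rightarrow> ('r, nat \<Rightarrow> 'r) module) d e.
        projective_resolution R T P d e \<and> (\<forall>i. fin_gen R (P i))) \<and>
     (\<forall>i>0. trivial_group (Ext R i T T)) \<and>
     (\<exists>(Ts :: nat \<Rightarrow> ('r, nat \<Rightarrow> 't) module) d h. add_coresolution R T Ts d h)"

section \<open>Frobenius extensions and extension of scalars\<close>

definition ring_extension ::
    "('r, 'k) ring_scheme \<Rightarrow> ('a, 'l) ring_scheme \<Rightarrow> ('r \<Rightarrow> 'a) \<Rightarrow> bool" where
  "ring_extension R A \<iota> \<longleftrightarrow> ring R \<and> ring A \<and> \<iota> \<in> ring_hom R A"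

definition frobenius_extension ::
    "('r, 'k) ring_scheme \<Rightarrow> ('a, 'l) ring_scheme \<Rightarrow> ('r \<Rightarrow> 'a) \<Rightarrow> bool" where
  "frobenius_extension R A \<iota> \<longleftrightarrow>
     ring_extension R A \<iota> \<and>
     (let A\<^sub>R = restrict_scalars \<iota> (regular_module A) in
        fin_gen R A\<^sub>R \<and> projective R A\<^sub>R \<and>
        (\<exists>\<phi> \<in> iso (add_monoid A) (hom_group R A\<^sub>R (regular_module R)).
           (\<forall>a\<in>carrier A. \<forall>b\<in>carrier A.
              \<phi> (a \<otimes>\<^bsub>A\<^esub> b) = (\<lambda>x\<in>carrier A. \<phi> b (x \<otimes>\<^bsub>A\<^esub> a))) \<and>
           (\<forall>b\<in>carrier A. \<forall>r\<in>carrier R.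
              \<phi> (b \<otimes>\<^bsub>A\<^esub> \<iota> r) = (\<lambda>x\<in>carrier A. \<phi> b x \<otimes>\<^bsub>R\<^esub> r))))"

text \<open>
  \<open>A \<otimes>\<^sub>R T\<close> is the quotient of the free abelian group on \<open>A \<times> T\<close> by the usual relations. The
  scalar \<open>a\<close> acts by \<open>b \<otimes> t \<mapsto> ab \<otimes> t\<close>; on cosets it is given by the union of the cosets of all
  images of representatives, which all coincide.
\<close>

definition tensor_relations ::
    "('r, 'k) ring_scheme \<Rightarrow> ('a, 'l) ring_scheme \<Rightarrow> ('r \<Rightarrow> 'a) \<Rightarrow> ('r, 't) module \<Rightarrow>
     ('a \<times> 't \<Rightarrow>\<^sub>0 int) set" where
  "tensor_relations R A \<iota> T =
     {frag_of (a \<oplus>\<^bsub>A\<^esub> b, t) - frag_of (a, t) - frag_of (b, t) | a b t.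
        a \<in> carrier A \<and> b \<in> carrier A \<and> t \<in> carrier T} \<union>
     {frag_of (a, s \<oplus>\<^bsub>T\<^esub> t) - frag_of (a, s) - frag_of (a, t) | a s t.
        a \<in> carrier A \<and> s \<in> carrier T \<and> t \<in> carrier T} \<union>
     {frag_of (a \<otimes>\<^bsub>A\<^esub> \<iota> r, t) - frag_of (a, r \<odot>\<^bsub>T\<^esub> t) | a r t.
        a \<in> carrier A \<and> r \<in> carrier R \<and> t \<in> carrier T}"

definition extend_scalars ::
    "('r, 'k) ring_scheme \<Rightarrow> ('a, 'l) ring_scheme \<Rightarrow> ('r \<Rightarrow> 'a) \<Rightarrow> ('r, 't) module \<Rightarrow>
     ('a, ('a \<times> 't \<Rightarrow>\<^sub>0 int) set) module" where
  "extend_scalars R A \<iota> T =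
     (let F = free_Abelian_group (carrier A \<times> carrier T);
          N = generate F (tensor_relations R A \<iota> T)
      in mk_module (carrier (F Mod N)) \<one>\<^bsub>F Mod N\<^esub> (\<lambda>C D. C \<otimes>\<^bsub>F Mod N\<^esub> D)
           (\<lambda>a C. \<Union>x\<in>C. N #>\<^bsub>F\<^esub> frag_extend (\<lambda>(b, t). frag_of (a \<otimes>\<^bsub>A\<^esub> b, t)) x))"

end

theory Submission
  imports Defs
begin

text \<open>
  A Frobenius extension has a Frobenius system \<open>(E, b, y)\<close>, which makes \<open>A \<otimes>\<^sub>R -\<close> exact and presents
  \<open>A \<otimes>\<^sub>R M\<close> through the maps \<open>m \<mapsto> 1 \<otimes> m\<close> and \<open>a \<otimes> m \<mapsto> E a m\<close>. Inducing up a resolution of \<open>T\<close> and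
  the coresolution \<open>T\<^sub>j\<close> of \<open>R\<close> gives a resolution of \<open>U\<close> and a coresolution of \<open>A\<close> by modules in
  \<open>add U\<close>. By adjunction, what is left to show is that \<open>Ext\<^sub>R(T, U) = 0\<close>, which is the hypothesis
  applied to \<open>T\<close>, and that \<open>Hom\<^sub>R(-, U)\<close> preserves the exactness of \<open>0 \<rightarrow> R \<rightarrow> T\<^sub>0 \<rightarrow> T\<^sub>1 \<rightarrow> \<dots>\<close>. Since
  \<open>Hom\<^sub>R(-, T)\<close> does so, dimension shifting puts all cosyzygies of this sequence into the left
  perpendicular class of \<open>T\<close>. By hypothesis they lie in that of \<open>U\<close>, and the vanishing of
  \<open>Ext\<^sup>1\<^sub>R(-, U)\<close> on the cosyzygies is the required exactness.
\<close>

section \<open>Module homomorphisms and retracts\<close>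

text \<open>Exactness of \<open>A \<otimes>\<^sub>R -\<close> concerns \<open>A\<close> as a right
  \<open>R\<close>-module, whereas projectivity is given on the left. The isomorphism of
  \<open>A\<close> with \<open>Hom\<^sub>R(A, R)\<close> turns a left dual basis into a right one:
  hence the \<open>y i\<close> and the \<open>b i\<close>, with \<open>E\<close> as the image of 1.

  Exactness under \<open>Hom\<^sub>R(-, T)\<close> gives no direct information about
  \<open>Hom\<^sub>R(-, U)\<close>, since \<open>U\<close> over \<open>R\<close> need not lie in the
  add-class of \<open>T\<close>. Vanishing of Ext is the form of this exactness that the hypothesis
  can carry from \<open>T\<close> to \<open>U\<close>, after which it is read back as exactness.

  The prescribed carrier types shape the rest. The terms of resolutions and coresolutions live in
  fixed types, and the hypothesis speaks about one type of modules. Therefore direct summands are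
  handled as retracts, \<open>A \<otimes>\<^sub>R M\<close> is a relation between modules instead of
  a single construction, vanishing of Ext is shown to be independent of the resolution and of its
  carrier type, and modules are copied along injections into the type of the hypothesis.\<close>

definition module_map ::
    "('r, 'k) ring_scheme \<Rightarrow> ('r, 'm) module \<Rightarrow> ('r, 'n) module \<Rightarrow> ('m \<Rightarrow> 'n) \<Rightarrow> bool" where
  "module_map R M N f \<longleftrightarrow>
     (\<forall>x\<in>carrier M. f x \<in> carrier N) \<and>
     (\<forall>x\<in>carrier M. \<forall>y\<in>carrier M. f (x \<oplus>\<^bsub>M\<^esub> y) = f x \<oplus>\<^bsub>N\<^esub> f y) \<and>
     (\<forall>r\<in>carrier R. \<forall>x\<in>carrier M. f (r \<odot>\<^bsub>M\<^esub> x) = r \<odot>\<^bsub>N\<^esub> f x)"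

lemma module_mapI:
  assumes "\<And>x. x \<in> carrier M \<Longrightarrow> f x \<in> carrier N"
    and "\<And>x y. x \<in> carrier M \<Longrightarrow> y \<in> carrier M \<Longrightarrow> f (x \<oplus>\<^bsub>M\<^esub> y) = f x \<oplus>\<^bsub>N\<^esub> f y"
    and "\<And>r x. r \<in> carrier R \<Longrightarrow> x \<in> carrier M \<Longrightarrow> f (r \<odot>\<^bsub>M\<^esub> x) = r \<odot>\<^bsub>N\<^esub> f x"
  shows "module_map R M N f"
  using assms by (simp add: module_map_def)

lemma module_map_closed: "module_map R M N f \<Longrightarrow> x \<in> carrier M \<Longrightarrow> f x \<in> carrier N"
  and module_map_add: "module_map R M N f \<Longrightarrow> x \<in> carrier M \<Longrightarrow> y \<in> carrier M \<Longrightarrow>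
    f (x \<oplus>\<^bsub>M\<^esub> y) = f x \<oplus>\<^bsub>N\<^esub> f y"
  and module_map_smult: "module_map R M N f \<Longrightarrow> r \<in> carrier R \<Longrightarrow> x \<in> carrier M \<Longrightarrow>
    f (r \<odot>\<^bsub>M\<^esub> x) = r \<odot>\<^bsub>N\<^esub> f x"
  by (simp_all add: module_map_def)

text \<open>Members of \<open>mod_hom\<close> are extensional. \<open>module_map\<close> drops this,
  so that composites and pointwise sums are plain functions; they are restricted only where a member
  of \<open>mod_hom\<close> is called for.\<close>

lemma mod_hom_iff: "f \<in> mod_hom R M N \<longleftrightarrow> module_map R M N f \<and> f \<in> extensional (carrier M)"
  by (auto simp: mod_hom_def module_map_def PiE_iff)

lemma module_map_cong:
  assumes "left_module R M" "\<And>x. x \<in> carrier M \<Longrightarrow> f x = g x"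
  shows "module_map R M N f \<longleftrightarrow> module_map R M N g"
proof -
  interpret left_module R M by fact
  show ?thesis using assms(2) by (simp add: module_map_def)
qed

lemma restrict_mod_hom:
  assumes "left_module R M" "module_map R M N f"
  shows "restrict f (carrier M) \<in> mod_hom R M N"
  using assms module_map_cong[OF assms(1), of "restrict f (carrier M)" f N]
  by (simp add: mod_hom_iff)

lemma module_map_id: "module_map R M M (\<lambda>x. x)"
  by (simp add: module_map_def)

lemma module_map_comp:
  "module_map R M N f \<Longrightarrow> module_map R N L g \<Longrightarrow> module_map R M L (\<lambda>x. g (f x))"
  by (simp add: module_map_def)

lemma module_map_zero:
  assumes "left_module R M" "left_module R N" "module_map R M N f"
  shows "f \<zero>\<^bsub>M\<^esub> = \<zero>\<^bsub>N\<^esub>"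
proof -
  interpret M: left_module R M by fact
  interpret N: left_module R N by fact
  have "f \<zero>\<^bsub>M\<^esub> = f (\<zero>\<^bsub>R\<^esub> \<odot>\<^bsub>M\<^esub> \<zero>\<^bsub>M\<^esub>)" by simp
  also have "\<dots> = \<zero>\<^bsub>R\<^esub> \<odot>\<^bsub>N\<^esub> f \<zero>\<^bsub>M\<^esub>" by (rule module_map_smult[OF assms(3)]) simp_all
  also have "\<dots> = \<zero>\<^bsub>N\<^esub>" using module_map_closed[OF assms(3)] by simp
  finally show ?thesis .
qed

lemma module_map_neg:
  assumes "left_module R M" "left_module R N" "module_map R M N f" "x \<in> carrier M"
  shows "f (\<ominus>\<^bsub>M\<^esub> x) = \<ominus>\<^bsub>N\<^esub> f x"
proof -
  interpret M: left_module R M by fact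
  interpret N: left_module R N by fact
  have "f (\<ominus>\<^bsub>M\<^esub> x) \<oplus>\<^bsub>N\<^esub> f x = \<zero>\<^bsub>N\<^esub>"
    using assms(4) by (simp add: module_map_add[OF assms(3), symmetric] module_map_zero[OF assms(1-3)] M.M.l_neg)
  then show ?thesis
    by (rule N.M.minus_equality[symmetric]) (simp_all add: module_map_closed[OF assms(3)] assms(4))
qed

lemma module_map_diff:
  assumes "left_module R M" "left_module R N" "module_map R M N f" "x \<in> carrier M" "y \<in> carrier M"
  shows "f (x \<ominus>\<^bsub>M\<^esub> y) = f x \<ominus>\<^bsub>N\<^esub> f y"
proof -
  interpret M: left_module R M by fact
  show ?thesis
    using assms by (simp add: a_minus_def module_map_add[OF assms(3)] module_map_neg[OF assms(1-3)])
qed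

lemma module_map_plus:
  assumes "left_module R M" "left_module R N" "module_map R M N f" "module_map R M N g"
  shows "module_map R M N (\<lambda>x. f x \<oplus>\<^bsub>N\<^esub> g x)"
proof -
  interpret M: left_module R M by fact
  interpret N: left_module R N by fact
  show ?thesis
    using assms(3,4) by (auto simp: module_map_def N.smult_r_distr N.M.a_ac)
qed

lemma (in left_module) smult_neg:
  assumes "r \<in> carrier R" "x \<in> carrier M"
  shows "r \<odot>\<^bsub>M\<^esub> (\<ominus>\<^bsub>M\<^esub> x) = \<ominus>\<^bsub>M\<^esub> (r \<odot>\<^bsub>M\<^esub> x)"
  using M.minus_equality[of "r \<odot>\<^bsub>M\<^esub> (\<ominus>\<^bsub>M\<^esub> x)" "r \<odot>\<^bsub>M\<^esub> x"] assms
  by (simp add: smult_r_distr[symmetric] M.l_neg)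

lemma module_map_uminus:
  assumes "left_module R M" "left_module R N" "module_map R M N f"
  shows "module_map R M N (\<lambda>x. \<ominus>\<^bsub>N\<^esub> f x)"
proof -
  interpret M: left_module R M by fact
  interpret N: left_module R N by fact
  show ?thesis
    using assms(3) by (auto simp: module_map_def N.smult_neg N.M.minus_add)
qed

lemma module_map_minus:
  assumes "left_module R M" "left_module R N" "module_map R M N f" "module_map R M N g"
  shows "module_map R M N (\<lambda>x. f x \<ominus>\<^bsub>N\<^esub> g x)"
  unfolding a_minus_def using assms by (intro module_map_plus module_map_uminus)

lemma module_map_const_zero:
  assumes "left_module R N"
  shows "module_map R M N (\<lambda>x. \<zero>\<^bsub>N\<^esub>)"
proof -
  interpret N: left_module R N by fact
  show ?thesis by (simp add: module_map_def)
qed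

text \<open>Only additivity is assumed, because this is applied to maps between structures over
  different rings: scalar multiplication as a function of the scalar, the maps \<open>\<eta>\<close>
  and \<open>\<epsilon>\<close> of an induced module, a pure tensor as a function of its first
  factor.\<close>

lemma additive_finsum:
  assumes M: "abelian_group M" and N: "abelian_group N"
    and cl: "\<And>x. x \<in> carrier M \<Longrightarrow> h x \<in> carrier N"
    and add: "\<And>x y. x \<in> carrier M \<Longrightarrow> y \<in> carrier M \<Longrightarrow> h (x \<oplus>\<^bsub>M\<^esub> y) = h x \<oplus>\<^bsub>N\<^esub> h y"
    and f: "\<And>i. i \<in> S \<Longrightarrow> f i \<in> carrier M"
  shows "h (finsum M f S) = finsum N (\<lambda>i. h (f i)) S"
proof -
  interpret M: abelian_group M by fact
  interpret N: abelian_group N by fact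
  have z: "h \<zero>\<^bsub>M\<^esub> = \<zero>\<^bsub>N\<^esub>"
    using add[of "\<zero>\<^bsub>M\<^esub>" "\<zero>\<^bsub>M\<^esub>"] cl[of "\<zero>\<^bsub>M\<^esub>"] N.add.r_cancel_one'[of "h \<zero>\<^bsub>M\<^esub>" "h \<zero>\<^bsub>M\<^esub>"] by simp
  show ?thesis using f
  proof (induction S rule: infinite_finite_induct)
    \<comment> \<open>\<open>finsum\<close> over an infinite set is zero by convention, and
      \<open>h\<close> preserves zero; so \<open>S\<close> may be arbitrary.\<close>
    case (infinite S) then show ?case using z by (simp add: M.finsum_infinite N.finsum_infinite)
  next
    case empty then show ?case using z by simp
  next
    case (insert a S)
    then have "f a \<in> carrier M" "f \<in> S \<rightarrow> carrier M" "(\<lambda>i. h (f i)) \<in> S \<rightarrow> carrier N" "h (f a) \<in> carrier N"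
      using cl by auto
    then show ?case using insert by (simp add: add)
  qed
qed

lemma module_map_finsum:
  assumes "left_module R M" "left_module R N" "module_map R M N h" "\<And>i. i \<in> S \<Longrightarrow> f i \<in> carrier M"
  shows "h (finsum M f S) = finsum N (\<lambda>i. h (f i)) S"
  by (rule additive_finsum)
     (use assms in \<open>auto simp: left_module_def module_map_closed module_map_add\<close>)

lemma module_map_sum:
  assumes M: "left_module R M" and N: "left_module R N" and f: "\<And>i. i \<in> S \<Longrightarrow> module_map R M N (f i)"
  shows "module_map R M N (\<lambda>x. finsum N (\<lambda>i. f i x) S)"
proof -
  interpret N: left_module R N by fact
  show ?thesis using f
  proof (induction S rule: infinite_finite_induct)
    case (infinite S) then show ?case by (simp add: N.M.finsum_infinite module_map_const_zero[OF N])
  next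
    case empty then show ?case by (simp add: module_map_const_zero[OF N])
  next
    case (insert a S)
    then have "module_map R M N (\<lambda>x. f a x \<oplus>\<^bsub>N\<^esub> finsum N (\<lambda>i. f i x) S)"
      by (intro module_map_plus M N) auto
    moreover have "finsum N (\<lambda>i. f i x) (insert a S) = f a x \<oplus>\<^bsub>N\<^esub> finsum N (\<lambda>i. f i x) S"
      if "x \<in> carrier M" for x
      using insert.hyps insert.prems that by (intro N.M.finsum_insert) (auto intro: module_map_closed)
    ultimately show ?case by (subst module_map_cong[OF M]) assumption+
  qed
qed

lemma (in left_module) finsum_smult_ldistr:
  assumes "r \<in> carrier R" "\<And>i. i \<in> S \<Longrightarrow> f i \<in> carrier M"
  shows "r \<odot>\<^bsub>M\<^esub> finsum M f S = finsum M (\<lambda>i. r \<odot>\<^bsub>M\<^esub> f i) S"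
  by (rule additive_finsum) (use assms in \<open>auto simp: smult_r_distr M.abelian_group_axioms\<close>)

lemma (in left_module) finsum_smult_rdistr:
  assumes "x \<in> carrier M" "\<And>i. i \<in> S \<Longrightarrow> f i \<in> carrier R"
  shows "finsum R f S \<odot>\<^bsub>M\<^esub> x = finsum M (\<lambda>i. f i \<odot>\<^bsub>M\<^esub> x) S"
  by (rule additive_finsum[where h = "\<lambda>r. r \<odot>\<^bsub>M\<^esub> x"])
     (use assms in \<open>auto simp: smult_l_distr M.abelian_group_axioms R.abelian_group_axioms\<close>)

lemma (in abelian_group) finsum_swap:
  assumes "finite S" "finite U" "\<And>i j. i \<in> S \<Longrightarrow> j \<in> U \<Longrightarrow> f i j \<in> carrier G"
  shows "finsum G (\<lambda>i. finsum G (f i) U) S = finsum G (\<lambda>j. finsum G (\<lambda>i. f i j) S) U"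
  using assms(1,3)
proof (induction S rule: finite_induct)
  case empty then show ?case by simp
next
  case (insert a S)
  have "finsum G (\<lambda>j. finsum G (\<lambda>i. f i j) (insert a S)) U
      = finsum G (\<lambda>j. f a j \<oplus> finsum G (\<lambda>i. f i j) S) U"
    by (rule finsum_cong') (use insert in auto)
  also have "\<dots> = finsum G (f a) U \<oplus> finsum G (\<lambda>j. finsum G (\<lambda>i. f i j) S) U"
    by (rule finsum_addf) (use insert in auto)
  finally show ?case using insert by (simp add: Pi_def)
qed

section \<open>Submodules, images and kernels\<close>

lemma left_module_submodule:
  assumes "left_module R M" "submodule K R M"
  shows "left_module R (M\<lparr>carrier := K\<rparr>)"
proof -
  interpret left_module R M by fact
  interpret K: submodule K R M by fact
  have KM: "K \<subseteq> carrier M" using K.subset by simp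
  have *: "x \<in> K \<Longrightarrow> \<ominus>\<^bsub>M\<^esub> x \<in> K" for x using K.m_inv_closed[of x] by (simp add: a_inv_def)
  have "abelian_group (M\<lparr>carrier := K\<rparr>)"
  proof (rule abelian_groupI)
    fix x assume "x \<in> carrier (M\<lparr>carrier := K\<rparr>)"
    then have "\<ominus>\<^bsub>M\<^esub> x \<in> K" "\<ominus>\<^bsub>M\<^esub> x \<oplus>\<^bsub>M\<^esub> x = \<zero>\<^bsub>M\<^esub>" using * KM M.l_neg by auto
    then show "\<exists>y\<in>carrier (M\<lparr>carrier := K\<rparr>). y \<oplus>\<^bsub>M\<lparr>carrier := K\<rparr>\<^esub> x = \<zero>\<^bsub>M\<lparr>carrier := K\<rparr>\<^esub>"
      by auto
  qed (use KM K.m_closed K.one_closed in \<open>auto simp: M.a_assoc subset_iff intro: M.a_comm\<close>)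
  then show ?thesis
    unfolding left_module_def left_module_axioms_def
    using KM K.smult_closed
    by (auto simp: R.ring_axioms smult_l_distr smult_r_distr smult_assoc1 subset_iff)
qed

lemma submodule_finsum_closed:
  assumes M: "left_module R M" and K: "submodule K R M" and f: "\<And>i. i \<in> S \<Longrightarrow> f i \<in> K"
  shows "finsum M f S \<in> K"
proof -
  interpret left_module R M by fact
  interpret K: submodule K R M by fact
  have KM: "K \<subseteq> carrier M" using K.subset by simp
  show ?thesis using f
  proof (induction S rule: infinite_finite_induct)
    case (infinite S) then show ?case using K.one_closed by (simp add: M.finsum_infinite)
  next
    case empty then show ?case using K.one_closed by simp
  next
    case (insert a S)
    then have "f a \<in> carrier M" "f \<in> S \<rightarrow> carrier M" using KM by auto
    then show ?case using insert K.m_closed[of "f a"] by simp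
  qed
qed

lemma module_map_image_submodule:
  assumes "left_module R M" "left_module R N" "module_map R M N f"
  shows "submodule (f ` carrier M) R N"
proof -
  interpret M: left_module R M by fact
  interpret N: left_module R N by fact
  note cl = module_map_closed[OF assms(3)]
  show ?thesis
  proof (intro submodule.intro subgroup.intro submodule_axioms.intro)
    show "\<one>\<^bsub>add_monoid N\<^esub> \<in> f ` carrier M"
      by (rule image_eqI[of _ _ "\<zero>\<^bsub>M\<^esub>"]) (simp_all add: module_map_zero[OF assms])
    fix x assume "x \<in> f ` carrier M"
    then obtain a where a: "a \<in> carrier M" "x = f a" by auto
    show "inv\<^bsub>add_monoid N\<^esub> x \<in> f ` carrier M"
      by (rule image_eqI[of _ _ "\<ominus>\<^bsub>M\<^esub> a"]) (use module_map_neg[OF assms a(1)] in \<open>simp_all add: a a_inv_def[symmetric]\<close>)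
    fix y assume "y \<in> f ` carrier M"
    then obtain b where b: "b \<in> carrier M" "y = f b" by auto
    show "x \<otimes>\<^bsub>add_monoid N\<^esub> y \<in> f ` carrier M"
      by (rule image_eqI[of _ _ "a \<oplus>\<^bsub>M\<^esub> b"]) (simp_all add: module_map_add[OF assms(3)] a b)
  next
    fix r x assume r: "r \<in> carrier R" and "x \<in> f ` carrier M"
    then obtain a where a: "a \<in> carrier M" "x = f a" by auto
    show "r \<odot>\<^bsub>N\<^esub> x \<in> f ` carrier M"
      by (rule image_eqI[of _ _ "r \<odot>\<^bsub>M\<^esub> a"]) (simp_all add: module_map_smult[OF assms(3)] a r)
  qed (use cl in auto)
qed

lemma module_map_kernel_submodule:
  assumes "left_module R M" "left_module R N" "module_map R M N f"
  shows "submodule {x \<in> carrier M. f x = \<zero>\<^bsub>N\<^esub>} R M"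
proof -
  have "{x \<in> carrier M. f x = \<zero>\<^bsub>N\<^esub>} =
      kernel (add_monoid M) (add_monoid N) (restrict f (carrier M))"
    by (auto simp: kernel_def)
  then show ?thesis using kernel_submodule[OF assms(1,2) restrict_mod_hom[OF assms(1,3)]] by simp
qed

section \<open>Direct summands as retracts\<close>

definition retract ::
    "('r, 'k) ring_scheme \<Rightarrow> ('r, 'm) module \<Rightarrow> ('r, 'n) module \<Rightarrow> bool" where
  "retract R N L \<longleftrightarrow>
     (\<exists>s t. module_map R N L s \<and> module_map R L N t \<and> (\<forall>x\<in>carrier N. t (s x) = x))"

lemma inv_into_module_map:
  assumes M: "left_module R M" and f: "module_map R M N f" and b: "bij_betw f (carrier M) (carrier N)"
  shows "module_map R N M (inv_into (carrier M) f)"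
proof -
  interpret left_module R M by fact
  let ?g = "inv_into (carrier M) f"
  have g: "?g y \<in> carrier M" "f (?g y) = y" if "y \<in> carrier N" for y
    using b that by (auto simp: bij_betw_def inv_into_into f_inv_into_f)
  have u: "?g y = x" if "x \<in> carrier M" "f x = y" for x y
    using b that by (auto simp: bij_betw_def)
  show ?thesis
    by (intro module_mapI u)
       (use g in \<open>auto simp: module_map_add[OF f] module_map_smult[OF f]\<close>)
qed

text \<open>A pair of maps is easier to transport through functors and between carrier types than a
  decomposition into submodules. From a decomposition the retraction is the projection onto
  \<open>K\<close> along \<open>K'\<close>; conversely the image of \<open>s\<close> and the kernel
  of \<open>t\<close> are complementary.\<close>

lemma direct_summand_iff_retract:
  assumes N: "left_module R N" and L: "left_module R L"
  shows "direct_summand R N L \<longleftrightarrow> retract R N L"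
proof
  interpret N: left_module R N by fact
  interpret L: left_module R L by fact
  {
    assume "direct_summand R N L"
    then obtain K K' f where K: "submodule K R L" and K': "submodule K' R L"
      and int: "K \<inter> K' = {\<zero>\<^bsub>L\<^esub>}" and sum: "K <+>\<^bsub>L\<^esub> K' = carrier L"
      and f: "f \<in> mod_hom R N (L\<lparr>carrier := K\<rparr>)" and bij: "bij_betw f (carrier N) K"
      unfolding direct_summand_def mod_isomorphic_def by auto
    interpret K: submodule K R L by fact
    interpret K': submodule K' R L by fact
    have KL: "K \<subseteq> carrier L" "K' \<subseteq> carrier L" using K.subset K'.subset by auto
    have fm: "module_map R N (L\<lparr>carrier := K\<rparr>) f" using f by (simp add: mod_hom_iff)
    have ex: "\<exists>k\<in>K. \<exists>k'\<in>K'. x = k \<oplus>\<^bsub>L\<^esub> k'" if "x \<in> carrier L" for x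
    proof -
      have "x \<in> K <+>\<^bsub>L\<^esub> K'" by (simp only: sum that)
      then show ?thesis by (auto simp: set_add_def set_mult_def)
    qed
    \<comment> \<open>The \<open>K\<close>-components of two decompositions of one element differ by
      an element of \<open>K \<inter> K'\<close>; so the projection \<open>p\<close> below is well
      defined.\<close>
    have un: "k = l" if "k \<in> K" "k' \<in> K'" "l \<in> K" "l' \<in> K'" "k \<oplus>\<^bsub>L\<^esub> k' = l \<oplus>\<^bsub>L\<^esub> l'" for k k' l l'
    proof -
      have c: "k \<in> carrier L" "k' \<in> carrier L" "l \<in> carrier L" "l' \<in> carrier L" using that KL by auto
      have "\<ominus>\<^bsub>L\<^esub> l \<oplus>\<^bsub>L\<^esub> (k \<oplus>\<^bsub>L\<^esub> k') \<oplus>\<^bsub>L\<^esub> \<ominus>\<^bsub>L\<^esub> k' = \<ominus>\<^bsub>L\<^esub> l \<oplus>\<^bsub>L\<^esub> (l \<oplus>\<^bsub>L\<^esub> l') \<oplus>\<^bsub>L\<^esub> \<ominus>\<^bsub>L\<^esub> k'"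
        using that by simp
      then have e: "\<ominus>\<^bsub>L\<^esub> l \<oplus>\<^bsub>L\<^esub> k = l' \<oplus>\<^bsub>L\<^esub> \<ominus>\<^bsub>L\<^esub> k'"
        using c by (simp add: L.M.a_assoc L.M.r_neg L.M.r_neg1)
      have "\<ominus>\<^bsub>L\<^esub> l \<oplus>\<^bsub>L\<^esub> k \<in> K" "l' \<oplus>\<^bsub>L\<^esub> \<ominus>\<^bsub>L\<^esub> k' \<in> K'"
        using K.m_closed K.m_inv_closed K'.m_closed K'.m_inv_closed that by (auto simp: a_inv_def)
      then have "\<ominus>\<^bsub>L\<^esub> l \<oplus>\<^bsub>L\<^esub> k = \<zero>\<^bsub>L\<^esub>" using e int by auto
      then have "l \<oplus>\<^bsub>L\<^esub> (\<ominus>\<^bsub>L\<^esub> l \<oplus>\<^bsub>L\<^esub> k) = l" using c by simp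
      then show ?thesis using c by (simp add: L.M.r_neg2)
    qed
    define p where "p x = (THE k. k \<in> K \<and> (\<exists>k'\<in>K'. x = k \<oplus>\<^bsub>L\<^esub> k'))" for x
    have p: "p (k \<oplus>\<^bsub>L\<^esub> k') = k" if "k \<in> K" "k' \<in> K'" for k k'
      unfolding p_def by (rule the_equality) (use that un in blast)+
    have "module_map R L (L\<lparr>carrier := K\<rparr>) p"
    proof (rule module_mapI)
      fix x assume "x \<in> carrier L"
      then obtain k k' where x: "k \<in> K" "k' \<in> K'" "x = k \<oplus>\<^bsub>L\<^esub> k'" using ex by blast
      then show "p x \<in> carrier (L\<lparr>carrier := K\<rparr>)" using p by simp
      {
        fix y assume "y \<in> carrier L"
        then obtain l l' where y: "l \<in> K" "l' \<in> K'" "y = l \<oplus>\<^bsub>L\<^esub> l'" using ex by blast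
        have "k \<in> carrier L" "k' \<in> carrier L" "l \<in> carrier L" "l' \<in> carrier L" using x y KL by auto
        then have "x \<oplus>\<^bsub>L\<^esub> y = (k \<oplus>\<^bsub>L\<^esub> l) \<oplus>\<^bsub>L\<^esub> (k' \<oplus>\<^bsub>L\<^esub> l')" using x y by (simp add: L.M.a_ac)
        moreover have "k \<oplus>\<^bsub>L\<^esub> l \<in> K" "k' \<oplus>\<^bsub>L\<^esub> l' \<in> K'"
          using K.m_closed[of k l] K'.m_closed[of k' l'] x y by auto
        ultimately show "p (x \<oplus>\<^bsub>L\<^esub> y) = p x \<oplus>\<^bsub>L\<lparr>carrier := K\<rparr>\<^esub> p y" using x y p by simp
      }
      {
        fix r assume r: "r \<in> carrier R"
        then have "r \<odot>\<^bsub>L\<^esub> x = r \<odot>\<^bsub>L\<^esub> k \<oplus>\<^bsub>L\<^esub> r \<odot>\<^bsub>L\<^esub> k'" using x KL by (simp add: L.smult_r_distr subset_iff)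
        then show "p (r \<odot>\<^bsub>L\<^esub> x) = r \<odot>\<^bsub>L\<lparr>carrier := K\<rparr>\<^esub> p x" using x p r by simp
      }
    qed
    moreover have "module_map R (L\<lparr>carrier := K\<rparr>) N (inv_into (carrier N) f)"
      by (rule inv_into_module_map[OF N fm]) (use bij in simp)
    ultimately have "module_map R L N (\<lambda>x. inv_into (carrier N) f (p x))" by (rule module_map_comp)
    moreover have "inv_into (carrier N) f (p (f x)) = x" if "x \<in> carrier N" for x
    proof -
      have "f x \<in> K" using module_map_closed[OF fm that] by simp
      then have "p (f x) = f x" using p[of "f x" "\<zero>\<^bsub>L\<^esub>"] KL K'.one_closed by (auto simp: subset_iff)
      then show ?thesis using bij that by (simp add: bij_betw_def)
    qed
    moreover have "module_map R N L f" using fm KL by (auto simp: module_map_def)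
    ultimately show "retract R N L" unfolding retract_def by blast
  }
  {
    assume "retract R N L"
    then obtain s t where s: "module_map R N L s" and t: "module_map R L N t"
      and ts: "\<And>x. x \<in> carrier N \<Longrightarrow> t (s x) = x" unfolding retract_def by blast
    define K where "K = s ` carrier N"
    define K' where "K' = {x \<in> carrier L. t x = \<zero>\<^bsub>N\<^esub>}"
    have sub: "submodule K R L" "submodule K' R L"
      unfolding K_def K'_def using module_map_image_submodule[OF N L s] module_map_kernel_submodule[OF L N t] .
    note sc = module_map_closed[OF s] and tc = module_map_closed[OF t]
    have "K \<inter> K' = {\<zero>\<^bsub>L\<^esub>}"
    proof
      show "K \<inter> K' \<subseteq> {\<zero>\<^bsub>L\<^esub>}" using ts module_map_zero[OF N L s] by (auto simp: K_def K'_def)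
      show "{\<zero>\<^bsub>L\<^esub>} \<subseteq> K \<inter> K'"
        using subgroup.one_closed[OF submodule.axioms(1)[OF sub(1)]]
          subgroup.one_closed[OF submodule.axioms(1)[OF sub(2)]] by simp
    qed
    moreover have "K <+>\<^bsub>L\<^esub> K' = carrier L"
    proof
      show "K <+>\<^bsub>L\<^esub> K' \<subseteq> carrier L" by (auto simp: K_def K'_def set_add_def set_mult_def sc)
      show "carrier L \<subseteq> K <+>\<^bsub>L\<^esub> K'"
      proof
        fix x assume x: "x \<in> carrier L"
        have "x = s (t x) \<oplus>\<^bsub>L\<^esub> (\<ominus>\<^bsub>L\<^esub> s (t x) \<oplus>\<^bsub>L\<^esub> x)" using x sc tc by (simp add: L.M.r_neg2)
        moreover have "\<ominus>\<^bsub>L\<^esub> s (t x) \<oplus>\<^bsub>L\<^esub> x \<in> K'"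
          using x sc tc ts by (simp add: K'_def module_map_add[OF t] module_map_neg[OF L N t] N.M.l_neg)
        moreover have "s (t x) \<in> K" using x tc by (simp add: K_def)
        ultimately show "x \<in> K <+>\<^bsub>L\<^esub> K'" unfolding set_add_def set_mult_def by auto
      qed
    qed
    moreover have "mod_isomorphic R N (L\<lparr>carrier := K\<rparr>)"
    proof -
      have "module_map R N (L\<lparr>carrier := K\<rparr>) s" using s by (simp add: module_map_def K_def)
      then have "restrict s (carrier N) \<in> mod_hom R N (L\<lparr>carrier := K\<rparr>)" by (rule restrict_mod_hom[OF N])
      moreover have "bij_betw (restrict s (carrier N)) (carrier N) K"
        unfolding bij_betw_def K_def using ts by (auto intro: inj_on_inverseI[where g = t])
      ultimately show ?thesis unfolding mod_isomorphic_def by (intro bexI) simp_all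
    qed
    ultimately show "direct_summand R N L" unfolding direct_summand_def using sub by blast
  }
qed

section \<open>Free and projective modules\<close>

definition copower_in :: "'i set \<Rightarrow> ('r, 'm) module \<Rightarrow> 'i \<Rightarrow> 'm \<Rightarrow> 'i \<Rightarrow> 'm" where
  "copower_in I M i x = (\<lambda>j\<in>I. if j = i then x else \<zero>\<^bsub>M\<^esub>)"

lemma copower_carrier_iff:
  "f \<in> carrier (copower I M) \<longleftrightarrow> f \<in> I \<rightarrow>\<^sub>E carrier M \<and> finite {i \<in> I. f i \<noteq> \<zero>\<^bsub>M\<^esub>}"
  by (simp add: copower_def)

lemma copower_finite_carrier: "finite I \<Longrightarrow> carrier (copower I M) = I \<rightarrow>\<^sub>E carrier M"
  by (auto simp: copower_def)

lemma copower_eval_map: "i \<in> I \<Longrightarrow> module_map R (copower I M) M (\<lambda>f. f i)"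
  by (auto simp: module_map_def copower_def PiE_iff)

lemma copower_in_map:
  assumes "left_module R M" "i \<in> I"
  shows "module_map R M (copower I M) (copower_in I M i)"
proof -
  interpret left_module R M by fact
  have "finite {j \<in> I. (\<lambda>j\<in>I. if j = i then x else \<zero>\<^bsub>M\<^esub>) j \<noteq> \<zero>\<^bsub>M\<^esub>}" for x
    by (rule finite_subset[of _ "{i}"]) auto
  then show ?thesis
    using assms(2) by (intro module_mapI) (auto simp: copower_def copower_in_def fun_eq_iff)
qed

lemma copower_in_eval: "j \<in> I \<Longrightarrow> copower_in I M i x j = (if j = i then x else \<zero>\<^bsub>M\<^esub>)"
  by (simp add: copower_in_def)

lemma copower_ext:
  "f \<in> carrier (copower I M) \<Longrightarrow> g \<in> carrier (copower I M) \<Longrightarrow> (\<And>i. i \<in> I \<Longrightarrow> f i = g i) \<Longrightarrow> f = g"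
  unfolding copower_carrier_iff by (auto intro: PiE_ext)

text \<open>Any finite \<open>S\<close> between the support and \<open>I\<close> is allowed: the
  support itself in general, or all of \<open>I\<close> when \<open>I\<close> is finite, which gives
  sums over an index set that does not depend on \<open>f\<close>.\<close>

lemma copower_decomp:
  assumes M: "left_module R M" and f: "f \<in> carrier (copower I M)"
    and S: "finite S" "{i \<in> I. f i \<noteq> \<zero>\<^bsub>M\<^esub>} \<subseteq> S" "S \<subseteq> I"
  shows "f = finsum (copower I M) (\<lambda>i. copower_in I M i (f i)) S"
proof (rule copower_ext[OF f])
  interpret M: left_module R M by fact
  have C: "left_module R (copower I M)" by (rule copower_left_module[OF M])
  interpret C: left_module R "copower I M" by fact
  have fc: "f i \<in> carrier M" if "i \<in> I" for i using f that by (auto simp: copower_carrier_iff)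
  have cl: "copower_in I M i (f i) \<in> carrier (copower I M)" if "i \<in> S" for i
  proof -
    have "i \<in> I" using that S(3) by auto
    then show ?thesis by (intro module_map_closed[OF copower_in_map[OF M]] fc)
  qed
  then show "finsum (copower I M) (\<lambda>i. copower_in I M i (f i)) S \<in> carrier (copower I M)" by auto
  fix j assume j: "j \<in> I"
  have "finsum (copower I M) (\<lambda>i. copower_in I M i (f i)) S j = finsum M (\<lambda>i. copower_in I M i (f i) j) S"
    by (rule module_map_finsum[OF C M copower_eval_map[OF j] cl])
  also have "\<dots> = finsum M (\<lambda>i. if j = i then f i else \<zero>\<^bsub>M\<^esub>) S"
    by (rule M.M.finsum_cong') (use j fc S in \<open>auto simp: copower_in_eval\<close>)
  also have "\<dots> = f j"
  proof (cases "j \<in> S")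
    case True then show ?thesis by (intro M.M.finsum_singleton) (use S fc in auto)
  next
    case False
    then have "finsum M (\<lambda>i. if j = i then f i else \<zero>\<^bsub>M\<^esub>) S = finsum M (\<lambda>i. \<zero>\<^bsub>M\<^esub>) S"
      by (intro M.M.finsum_cong') auto
    then show ?thesis using False S j by auto
  qed
  finally show "f j = finsum (copower I M) (\<lambda>i. copower_in I M i (f i)) S j" ..
qed

lemma regular_module_simps [simp]:
  "carrier (regular_module R) = carrier R" "\<zero>\<^bsub>regular_module R\<^esub> = \<zero>\<^bsub>R\<^esub>"
  "x \<oplus>\<^bsub>regular_module R\<^esub> y = x \<oplus>\<^bsub>R\<^esub> y" "r \<odot>\<^bsub>regular_module R\<^esub> x = r \<otimes>\<^bsub>R\<^esub> x"
  by (simp_all add: regular_module_def)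

abbreviation free_module :: "'i set \<Rightarrow> ('r, 'k) ring_scheme \<Rightarrow> ('r, 'i \<Rightarrow> 'r) module" where
  "free_module I R \<equiv> copower I (regular_module R)"

definition free_basis :: "'i set \<Rightarrow> ('r, 'k) ring_scheme \<Rightarrow> 'i \<Rightarrow> 'i \<Rightarrow> 'r" where
  "free_basis I R i = copower_in I (regular_module R) i \<one>\<^bsub>R\<^esub>"

lemma free_left_module: "ring R \<Longrightarrow> left_module R (free_module I R)"
  by (intro copower_left_module regular_left_module)

lemma free_basis_closed: "ring R \<Longrightarrow> i \<in> I \<Longrightarrow> free_basis I R i \<in> carrier (free_module I R)"
  unfolding free_basis_def
  using module_map_closed[OF copower_in_map[OF regular_left_module], of R i I "\<one>\<^bsub>R\<^esub>"]
  by (simp add: ring.ring_simprules)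

lemma module_map_free_eq:
  assumes R: "ring R" and N: "left_module R N" and f: "module_map R (free_module I R) N f"
    and v: "v \<in> carrier (free_module I R)"
    and S: "finite S" "{i \<in> I. v i \<noteq> \<zero>\<^bsub>R\<^esub>} \<subseteq> S" "S \<subseteq> I"
  shows "f v = finsum N (\<lambda>i. v i \<odot>\<^bsub>N\<^esub> f (free_basis I R i)) S"
proof -
  interpret ring R by fact
  interpret N: left_module R N by fact
  note reg = regular_left_module[OF R]
  note F = free_left_module[OF R, of I]
  have vc: "v i \<in> carrier R" if "i \<in> I" for i using v that by (auto simp: copower_carrier_iff)
  have cl: "copower_in I (regular_module R) i (v i) \<in> carrier (free_module I R)" if "i \<in> S" for i
  proof -
    have "i \<in> I" using that S(3) by auto
    then show ?thesis by (intro module_map_closed[OF copower_in_map[OF reg]]) (simp_all add: vc)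
  qed
  have e: "copower_in I (regular_module R) i (v i) = v i \<odot>\<^bsub>free_module I R\<^esub> free_basis I R i" if "i \<in> S" for i
    using module_map_smult[OF copower_in_map[OF reg, of i I], of "v i" "\<one>\<^bsub>R\<^esub>"] vc that S(3)
    by (auto simp: free_basis_def)
  have "f v = f (finsum (free_module I R) (\<lambda>i. copower_in I (regular_module R) i (v i)) S)"
    using copower_decomp[OF reg v S(1) _ S(3)] S(2) by auto
  also have "\<dots> = finsum N (\<lambda>i. f (copower_in I (regular_module R) i (v i))) S"
    by (rule module_map_finsum[OF F N f cl])
  also have "\<dots> = finsum N (\<lambda>i. v i \<odot>\<^bsub>N\<^esub> f (free_basis I R i)) S"
  proof (rule N.M.finsum_cong')
    fix i assume i: "i \<in> S"
    then have "i \<in> I" using S by auto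
    then show "f (copower_in I (regular_module R) i (v i)) = v i \<odot>\<^bsub>N\<^esub> f (free_basis I R i)"
      using e[OF i] module_map_smult[OF f vc free_basis_closed[OF R]] by simp
  qed (use S vc module_map_closed[OF f free_basis_closed[OF R]] in auto)
  finally show ?thesis .
qed

lemma module_map_free_unique:
  assumes R: "ring R" and N: "left_module R N"
    and f: "module_map R (free_module I R) N f" and g: "module_map R (free_module I R) N g"
    and eq: "\<And>i. i \<in> I \<Longrightarrow> f (free_basis I R i) = g (free_basis I R i)"
    and v: "v \<in> carrier (free_module I R)"
  shows "f v = g v"
proof -
  interpret N: left_module R N by fact
  let ?S = "{i \<in> I. v i \<noteq> \<zero>\<^bsub>R\<^esub>}"
  have S: "finite ?S" using v by (simp add: copower_carrier_iff)
  have vc: "v i \<in> carrier R" if "i \<in> I" for i using v that by (auto simp: copower_carrier_iff)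
  have "f v = finsum N (\<lambda>i. v i \<odot>\<^bsub>N\<^esub> f (free_basis I R i)) ?S"
    by (rule module_map_free_eq[OF R N f v S]) auto
  also have "\<dots> = finsum N (\<lambda>i. v i \<odot>\<^bsub>N\<^esub> g (free_basis I R i)) ?S"
    by (rule N.M.finsum_cong')
       (use eq vc module_map_closed[OF g free_basis_closed[OF R]] in auto)
  also have "\<dots> = g v"
    by (rule module_map_free_eq[OF R N g v S, symmetric]) auto
  finally show ?thesis .
qed

lemma module_map_free_exists:
  assumes M: "left_module R M" and c: "\<And>i. i \<in> I \<Longrightarrow> c i \<in> carrier M"
  obtains f where "module_map R (free_module I R) M f" "\<And>i. i \<in> I \<Longrightarrow> f (free_basis I R i) = c i"
proof -
  interpret left_module R M by fact
  define supp where "supp v = {i \<in> I. v i \<noteq> \<zero>\<^bsub>R\<^esub>}" for v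
  define f where "f v = finsum M (\<lambda>i. v i \<odot>\<^bsub>M\<^esub> c i) (supp v)" for v
  have vc: "v i \<in> carrier R" if "v \<in> carrier (free_module I R)" "i \<in> I" for v i
    using that by (auto simp: copower_carrier_iff)
  have fin: "finite (supp v)" if "v \<in> carrier (free_module I R)" for v
    using that by (simp add: copower_carrier_iff supp_def)
  have fS: "f v = finsum M (\<lambda>i. v i \<odot>\<^bsub>M\<^esub> c i) S"
    if "v \<in> carrier (free_module I R)" "finite S" "supp v \<subseteq> S" "S \<subseteq> I" for v S
    unfolding f_def by (rule M.add.finprod_mono_neutral_cong_left)
      (use that vc c in \<open>auto simp: supp_def subset_iff\<close>)
  interpret F: left_module R "free_module I R" by (rule free_left_module) (rule R.ring_axioms)
  have add: "(v \<oplus>\<^bsub>free_module I R\<^esub> w) i = v i \<oplus>\<^bsub>R\<^esub> w i" if "i \<in> I" for v w i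
    using that by (simp add: copower_def)
  have sm: "(r \<odot>\<^bsub>free_module I R\<^esub> w) i = r \<otimes>\<^bsub>R\<^esub> w i" if "i \<in> I" for r w i
    using that by (simp add: copower_def)
  have "module_map R (free_module I R) M f"
  proof (rule module_mapI)
    fix v assume v: "v \<in> carrier (free_module I R)"
    show "f v \<in> carrier M" unfolding f_def
      by (rule M.finsum_closed) (use vc[OF v] c in \<open>auto simp: supp_def\<close>)
    {
      fix w assume w: "w \<in> carrier (free_module I R)"
      let ?S = "supp v \<union> supp w"
      have S: "finite ?S" "?S \<subseteq> I" using fin v w by (auto simp: supp_def)
      have i: "i \<in> I" if "i \<in> ?S" for i using that S by auto
      have "f (v \<oplus>\<^bsub>free_module I R\<^esub> w) = finsum M (\<lambda>i. (v \<oplus>\<^bsub>free_module I R\<^esub> w) i \<odot>\<^bsub>M\<^esub> c i) ?S"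
        by (rule fS) (use v w S in \<open>auto simp: supp_def add\<close>)
      also have "\<dots> = finsum M (\<lambda>i. v i \<odot>\<^bsub>M\<^esub> c i \<oplus>\<^bsub>M\<^esub> w i \<odot>\<^bsub>M\<^esub> c i) ?S"
        by (rule M.finsum_cong') (use vc[OF v i] vc[OF w i] c[OF i] i in \<open>auto simp: add smult_l_distr\<close>)
      also have "\<dots> = f v \<oplus>\<^bsub>M\<^esub> f w"
        using fS[OF v S(1) _ S(2)] fS[OF w S(1) _ S(2)]
        by (subst M.finsum_addf) (use vc[OF v i] vc[OF w i] c[OF i] in auto)
      finally show "f (v \<oplus>\<^bsub>free_module I R\<^esub> w) = f v \<oplus>\<^bsub>M\<^esub> f w" .
    }
    {
      fix r assume r: "r \<in> carrier R"
      have S: "finite (supp v)" "supp v \<subseteq> I" using fin v by (auto simp: supp_def)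
      have i: "i \<in> I" if "i \<in> supp v" for i using that S by auto
      have "f (r \<odot>\<^bsub>free_module I R\<^esub> v) = finsum M (\<lambda>i. (r \<odot>\<^bsub>free_module I R\<^esub> v) i \<odot>\<^bsub>M\<^esub> c i) (supp v)"
        by (rule fS) (use v r S in \<open>auto simp: supp_def sm\<close>)
      also have "\<dots> = finsum M (\<lambda>i. r \<odot>\<^bsub>M\<^esub> (v i \<odot>\<^bsub>M\<^esub> c i)) (supp v)"
        by (rule M.finsum_cong') (use vc[OF v i] c[OF i] i r in \<open>auto simp: sm smult_assoc1\<close>)
      also have "\<dots> = r \<odot>\<^bsub>M\<^esub> f v"
        unfolding f_def by (rule finsum_smult_ldistr[symmetric]) (use vc[OF v i] c[OF i] r in auto)
      finally show "f (r \<odot>\<^bsub>free_module I R\<^esub> v) = r \<odot>\<^bsub>M\<^esub> f v" .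
    }
  qed
  moreover have "f (free_basis I R i) = c i" if i: "i \<in> I" for i
  proof -
    have "f (free_basis I R i) = finsum M (\<lambda>j. free_basis I R i j \<odot>\<^bsub>M\<^esub> c j) {i}"
      by (rule fS) (use i free_basis_closed[OF R.ring_axioms] in
          \<open>auto simp: supp_def free_basis_def copower_in_eval split: if_splits\<close>)
    then show ?thesis using i c by (simp add: free_basis_def copower_in_eval)
  qed
  ultimately show ?thesis using that by blast
qed

section \<open>Projective and finitely generated projective modules\<close>

lemma projective_iff_retract:
  fixes P :: "('r, 'p) module"
  shows "projective R P \<longleftrightarrow> left_module R P \<and> (\<exists>I :: 'p set. retract R P (free_module I R))"
  unfolding projective_def
  using direct_summand_iff_retract free_left_module left_module.axioms(1) by blast

lemma projective_left_module: "projective R P \<Longrightarrow> left_module R P"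
  by (simp add: projective_def)

text \<open>The image condition replaces surjectivity of \<open>g\<close>, since the liftings in
  resolutions go along differentials, which reach only a kernel. Preimages are chosen on the basis
  of a free module that has \<open>P\<close> as a retract.\<close>

lemma projective_lift:
  fixes P :: "('r, 'p) module"
  assumes P: "projective R P" and M: "left_module R M" and N: "left_module R N"
    and g: "module_map R M N g" and f: "module_map R P N f"
    and im: "\<And>x. x \<in> carrier P \<Longrightarrow> f x \<in> g ` carrier M"
  obtains h where "module_map R P M h" "\<And>x. x \<in> carrier P \<Longrightarrow> g (h x) = f x"
proof -
  have R: "ring R" using M by (rule left_module.axioms(1))
  obtain I :: "'p set" and s t where s: "module_map R P (free_module I R) s"
    and t: "module_map R (free_module I R) P t" and ts: "\<And>x. x \<in> carrier P \<Longrightarrow> t (s x) = x"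
    using P unfolding projective_iff_retract retract_def by blast
  note tb = module_map_closed[OF t free_basis_closed[OF R]]
  define c where "c i = inv_into (carrier M) g (f (t (free_basis I R i)))" for i
  have c: "c i \<in> carrier M" "g (c i) = f (t (free_basis I R i))" if "i \<in> I" for i
    unfolding c_def using im[OF tb[OF that]] by (auto simp: inv_into_into f_inv_into_f)
  obtain q where q: "module_map R (free_module I R) M q" and qc: "\<And>i. i \<in> I \<Longrightarrow> q (free_basis I R i) = c i"
    using module_map_free_exists[of R M I c] M c by blast
  have "g (q v) = f (t v)" if "v \<in> carrier (free_module I R)" for v
    by (rule module_map_free_unique[OF R N module_map_comp[OF q g] module_map_comp[OF t f] _ that])
       (use qc c in auto)
  then show ?thesis
    by (intro that[of "\<lambda>x. q (s x)"] module_map_comp[OF s q])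
       (use module_map_closed[OF s] ts in auto)
qed

text \<open>\<open>projective\<close> admits only index sets inside the carrier type of
  \<open>P\<close>. For any other index type, \<open>t\<close> factors through the free module on
  the carrier of \<open>P\<close>: the basis element of \<open>j\<close> is sent to the basis
  element indexed by its value under \<open>t\<close>.\<close>

lemma projectiveI_retract:
  fixes P :: "('r, 'p) module" and J :: "'j set"
  assumes P: "left_module R P" and ret: "retract R P (free_module J R)"
  shows "projective R P"
proof -
  have R: "ring R" using P by (rule left_module.axioms(1))
  interpret R: ring R by fact
  obtain s t where s: "module_map R P (free_module J R) s"
    and t: "module_map R (free_module J R) P t" and ts: "\<And>x. x \<in> carrier P \<Longrightarrow> t (s x) = x"
    using ret unfolding retract_def by blast
  note tb = module_map_closed[OF t free_basis_closed[OF R]]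
  let ?I = "carrier P"
  obtain p where p: "module_map R (free_module J R) (free_module ?I R) p"
    and pb: "\<And>j. j \<in> J \<Longrightarrow> p (free_basis J R j) = free_basis ?I R (t (free_basis J R j))"
    using module_map_free_exists[OF free_left_module[OF R], where I = J
        and c = "\<lambda>j. free_basis ?I R (t (free_basis J R j))"] free_basis_closed[OF R tb] by blast
  obtain q where q: "module_map R (free_module ?I R) P q"
    and qb: "\<And>x. x \<in> ?I \<Longrightarrow> q (free_basis ?I R x) = x"
    using module_map_free_exists[OF P, where I = ?I and c = "\<lambda>x. x"] by blast
  have "q (p v) = t v" if "v \<in> carrier (free_module J R)" for v
    by (rule module_map_free_unique[OF R P module_map_comp[OF p q] t _ that])
       (use pb qb tb in auto)
  then have "retract R P (free_module ?I R)"
    unfolding retract_def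
    by (intro exI[of _ "\<lambda>x. p (s x)"] exI[of _ q])
       (use module_map_comp[OF s p] q module_map_closed[OF s] ts in auto)
  then show ?thesis unfolding projective_iff_retract using P by blast
qed

text \<open>A finite generating set gives a surjection from a finite free module, and lifting the
  identity of \<open>P\<close> along it gives a section.\<close>

lemma fin_gen_projective_retract:
  assumes P: "projective R P" and fg: "fin_gen R P"
  obtains n :: nat where "retract R P (free_module {..<n} R)"
proof -
  have lP: "left_module R P" using P by (rule projective_left_module)
  then have R: "ring R" by (rule left_module.axioms(1))
  obtain S where S: "finite S" "S \<subseteq> carrier P"
    and gen: "\<forall>K. submodule K R P \<and> S \<subseteq> K \<longrightarrow> K = carrier P"
    using fg unfolding fin_gen_def by (elim exE conjE)
  obtain c where c: "bij_betw c {..<card S} S"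
    using ex_bij_betw_nat_finite[OF S(1)] unfolding atLeast0LessThan by (elim exE)
  let ?F = "free_module {..<card S} R"
  have F: "left_module R ?F" by (rule free_left_module[OF R])
  have cS: "c ` {..<card S} = S" using c by (simp add: bij_betw_def)
  obtain q where q: "module_map R ?F P q" and qb: "\<And>i. i \<in> {..<card S} \<Longrightarrow> q (free_basis {..<card S} R i) = c i"
    using module_map_free_exists[OF lP, where I = "{..<card S}" and c = c] cS S(2) by blast
  have "S \<subseteq> q ` carrier ?F"
  proof
    fix x assume "x \<in> S"
    then obtain i where i: "i \<in> {..<card S}" "x = c i" using cS by auto
    then show "x \<in> q ` carrier ?F"
      by (intro image_eqI[of _ _ "free_basis {..<card S} R i"]) (simp_all add: qb free_basis_closed[OF R])
  qed
  then have im: "q ` carrier ?F = carrier P" by (intro gen[rule_format] conjI module_map_image_submodule[OF F lP q])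
  obtain s where "module_map R P ?F s" "\<And>x. x \<in> carrier P \<Longrightarrow> q (s x) = x"
    using projective_lift[OF P F lP q module_map_id] im by auto
  then have "retract R P ?F" unfolding retract_def using q by blast
  then show ?thesis by (rule that)
qed

lemma fin_genI_retract:
  assumes P: "left_module R P" and ret: "retract R P (free_module {..<n::nat} R)"
  shows "fin_gen R P"
proof -
  have R: "ring R" using P by (rule left_module.axioms(1))
  interpret P: left_module R P by fact
  let ?I = "{..<n}"
  obtain s t where s: "module_map R P (free_module ?I R) s"
    and t: "module_map R (free_module ?I R) P t" and ts: "\<And>x. x \<in> carrier P \<Longrightarrow> t (s x) = x"
    using ret unfolding retract_def by blast
  note tb = module_map_closed[OF t free_basis_closed[OF R]]
  have "K = carrier P" if K: "submodule K R P" and sub: "(\<lambda>i. t (free_basis ?I R i)) ` ?I \<subseteq> K" for K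
  proof
    show "K \<subseteq> carrier P" using subgroup.subset[OF submodule.axioms(1)[OF K]] by simp
    show "carrier P \<subseteq> K"
    proof
      fix x assume x: "x \<in> carrier P"
      note sx = module_map_closed[OF s x]
      have "x = finsum P (\<lambda>i. s x i \<odot>\<^bsub>P\<^esub> t (free_basis ?I R i)) ?I"
        using module_map_free_eq[OF R P t sx, of ?I] ts[OF x] by auto
      moreover have "s x i \<odot>\<^bsub>P\<^esub> t (free_basis ?I R i) \<in> K" if "i \<in> ?I" for i
        using sx that sub submodule.smult_closed[OF K] by (auto simp: copower_carrier_iff PiE_iff)
      ultimately show "x \<in> K" using submodule_finsum_closed[OF P K, of ?I "\<lambda>i. s x i \<odot>\<^bsub>P\<^esub> t (free_basis ?I R i)"] by simp
    qed
  qed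
  then show ?thesis unfolding fin_gen_def using tb
    by (intro exI[of _ "(\<lambda>i. t (free_basis ?I R i)) ` ?I"]) auto
qed

text \<open>The zero module is cut out of \<open>M\<close> so as to have the carrier type of
  \<open>M\<close>: the terms of one resolution must share a type. It is a retract of the free
  module on the empty set.\<close>

lemma zero_module_projective:
  assumes M: "left_module R M"
  shows "projective R (M\<lparr>carrier := {\<zero>\<^bsub>M\<^esub>}\<rparr>)"
proof -
  interpret left_module R M by fact
  have "submodule {\<zero>\<^bsub>M\<^esub>} R M"
    using M.add.triv_subgroup by (simp add: submodule_def submodule_axioms_def)
  then have Z: "left_module R (M\<lparr>carrier := {\<zero>\<^bsub>M\<^esub>}\<rparr>)" by (rule left_module_submodule[OF M])
  have F: "left_module R (free_module ({} :: nat set) R)" by (rule free_left_module[OF R.ring_axioms])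
  show ?thesis
    by (rule projectiveI_retract[OF Z, of "{} :: nat set"])
       (unfold retract_def, rule exI[of _ "\<lambda>_. \<zero>\<^bsub>free_module ({} :: nat set) R\<^esub>"], rule exI[of _ "\<lambda>_. \<zero>\<^bsub>M\<^esub>"],
        use module_map_const_zero[OF F, of "M\<lparr>carrier := {\<zero>\<^bsub>M\<^esub>}\<rparr>"]
          module_map_const_zero[OF Z, of "free_module ({} :: nat set) R"] in simp)
qed

lemma regular_projective:
  assumes R: "ring R" shows "projective R (regular_module R)"
proof -
  note reg = regular_left_module[OF R]
  show ?thesis
    by (rule projectiveI_retract[OF reg, of "{0::nat}"], unfold retract_def,
        intro exI conjI, rule copower_in_map[OF reg, of 0], simp, rule copower_eval_map[of 0])
       (auto simp: copower_in_eval)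
qed

section \<open>Direct sums of two modules\<close>

definition prod_module :: "('r, 'm) module \<Rightarrow> ('r, 'n) module \<Rightarrow> ('r, 'm \<times> 'n) module" where
  "prod_module M N = mk_module (carrier M \<times> carrier N) (\<zero>\<^bsub>M\<^esub>, \<zero>\<^bsub>N\<^esub>)
     (\<lambda>x y. (fst x \<oplus>\<^bsub>M\<^esub> fst y, snd x \<oplus>\<^bsub>N\<^esub> snd y)) (\<lambda>r x. (r \<odot>\<^bsub>M\<^esub> fst x, r \<odot>\<^bsub>N\<^esub> snd x))"

lemma prod_module_simps [simp]:
  "carrier (prod_module M N) = carrier M \<times> carrier N" "\<zero>\<^bsub>prod_module M N\<^esub> = (\<zero>\<^bsub>M\<^esub>, \<zero>\<^bsub>N\<^esub>)"
  "x \<oplus>\<^bsub>prod_module M N\<^esub> y = (fst x \<oplus>\<^bsub>M\<^esub> fst y, snd x \<oplus>\<^bsub>N\<^esub> snd y)"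
  "r \<odot>\<^bsub>prod_module M N\<^esub> x = (r \<odot>\<^bsub>M\<^esub> fst x, r \<odot>\<^bsub>N\<^esub> snd x)"
  by (simp_all add: prod_module_def)

lemma prod_left_module:
  assumes "left_module R M" "left_module R N"
  shows "left_module R (prod_module M N)"
proof -
  interpret M: left_module R M by fact
  interpret N: left_module R N by fact
  have "abelian_group (prod_module M N)"
  proof (rule abelian_groupI)
    fix x assume "x \<in> carrier (prod_module M N)"
    then show "\<exists>y\<in>carrier (prod_module M N). y \<oplus>\<^bsub>prod_module M N\<^esub> x = \<zero>\<^bsub>prod_module M N\<^esub>"
      by (intro bexI[of _ "(\<ominus>\<^bsub>M\<^esub> fst x, \<ominus>\<^bsub>N\<^esub> snd x)"]) (auto simp: M.M.l_neg N.M.l_neg)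
  qed (auto simp: M.M.a_assoc N.M.a_assoc intro: M.M.a_comm N.M.a_comm)
  then show ?thesis
    unfolding left_module_def left_module_axioms_def
    by (auto simp: M.R.ring_axioms M.smult_l_distr N.smult_l_distr M.smult_r_distr N.smult_r_distr
        M.smult_assoc1 N.smult_assoc1)
qed

lemma module_map_fst: "module_map R (prod_module M N) M fst"
  and module_map_snd: "module_map R (prod_module M N) N snd"
  by (auto simp: module_map_def)

lemma module_map_Pair:
  "module_map R L M f \<Longrightarrow> module_map R L N g \<Longrightarrow> module_map R L (prod_module M N) (\<lambda>x. (f x, g x))"
  by (simp add: module_map_def)

text \<open>\<open>P\<close> and \<open>Q\<close> are retracts of free modules over unrelated index
  types. Instead of combining these, the free module on the carrier of the sum is mapped onto it,
  and the two coordinate inclusions are lifted separately and added.\<close>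

lemma prod_projective:
  assumes P: "projective R P" and Q: "projective R Q"
  shows "projective R (prod_module P Q)"
proof -
  let ?D = "prod_module P Q"
  have lP: "left_module R P" and lQ: "left_module R Q" using P Q by (auto intro: projective_left_module)
  interpret P: left_module R P by fact
  interpret Q: left_module R Q by fact
  have R: "ring R" by (rule P.R.ring_axioms)
  have D: "left_module R ?D" by (rule prod_left_module[OF lP lQ])
  let ?I = "carrier ?D"
  let ?F = "free_module ?I R"
  have F: "left_module R ?F" by (rule free_left_module[OF R])
  obtain q where q: "module_map R ?F ?D q"
    and qb: "\<And>x. x \<in> ?I \<Longrightarrow> q (free_basis ?I R x) = x"
    using module_map_free_exists[OF D, where I = ?I and c = "\<lambda>x. x"] by blast
  have surj: "x \<in> q ` carrier ?F" if "x \<in> carrier ?D" for x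
    by (rule image_eqI[of _ _ "free_basis ?I R x"]) (simp_all only: qb[OF that] free_basis_closed[OF R that])
  obtain a where a: "module_map R P ?F a" "\<And>x. x \<in> carrier P \<Longrightarrow> q (a x) = (x, \<zero>\<^bsub>Q\<^esub>)"
    by (rule projective_lift[OF P F D q module_map_Pair[OF module_map_id module_map_const_zero[OF lQ]]])
       (use surj in auto)
  obtain b where b: "module_map R Q ?F b" "\<And>x. x \<in> carrier Q \<Longrightarrow> q (b x) = (\<zero>\<^bsub>P\<^esub>, x)"
    by (rule projective_lift[OF Q F D q module_map_Pair[OF module_map_const_zero[OF lP] module_map_id]])
       (use surj in auto)
  have "module_map R ?D ?F (\<lambda>x. a (fst x) \<oplus>\<^bsub>?F\<^esub> b (snd x))"
    by (intro module_map_plus D F module_map_comp[OF module_map_fst a(1)] module_map_comp[OF module_map_snd b(1)])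
  moreover have "q (a (fst x) \<oplus>\<^bsub>?F\<^esub> b (snd x)) = x" if "x \<in> carrier ?D" for x
  proof -
    have x: "fst x \<in> carrier P" "snd x \<in> carrier Q" using that by auto
    have "q (a (fst x) \<oplus>\<^bsub>?F\<^esub> b (snd x)) = q (a (fst x)) \<oplus>\<^bsub>?D\<^esub> q (b (snd x))"
      by (rule module_map_add[OF q module_map_closed[OF a(1) x(1)] module_map_closed[OF b(1) x(2)]])
    then show ?thesis using x by (simp add: a(2) b(2))
  qed
  ultimately have "retract R ?D ?F" unfolding retract_def using q by blast
  then show ?thesis by (rule projectiveI_retract[OF D])
qed

section \<open>Resolutions and the vanishing of Ext\<close>

text \<open>\<open>projective_resolution\<close> with \<open>module_map\<close> in place of
  \<open>mod_hom\<close>, so that differentials and augmentations may be given by formulas that are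
  not extensional; \<open>resolves_restrict\<close> leads back.\<close>

definition resolves ::
    "('r, 'k) ring_scheme \<Rightarrow> ('r, 'x) module \<Rightarrow>
     (nat \<Rightarrow> ('r, 'p) module) \<Rightarrow> (nat \<Rightarrow> 'p \<Rightarrow> 'p) \<Rightarrow> ('p \<Rightarrow> 'x) \<Rightarrow> bool" where
  "resolves R X P d e \<longleftrightarrow>
     left_module R X \<and>
     (\<forall>i. projective R (P i)) \<and>
     (\<forall>i. module_map R (P (Suc i)) (P i) (d i)) \<and>
     module_map R (P 0) X e \<and>
     e ` carrier (P 0) = carrier X \<and>
     d 0 ` carrier (P (Suc 0)) = {x \<in> carrier (P 0). e x = \<zero>\<^bsub>X\<^esub>} \<and>
     (\<forall>i. d (Suc i) ` carrier (P (Suc (Suc i))) = {x \<in> carrier (P (Suc i)). d i x = \<zero>\<^bsub>P i\<^esub>})"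

lemma exact_at_iff:
  "exact_at (add_monoid L) f (add_monoid M) g (add_monoid N) \<longleftrightarrow>
     f ` carrier L = {x \<in> carrier M. g x = \<zero>\<^bsub>N\<^esub>}"
  by (simp add: exact_at_def kernel_def)

lemma projective_resolution_resolves:
  "left_module R X \<Longrightarrow> projective_resolution R X P d e \<Longrightarrow> resolves R X P d e"
  by (simp add: projective_resolution_def resolves_def exact_at_iff mod_hom_iff)

context
  fixes R :: "('r, 'k) ring_scheme" and X :: "('r, 'x) module"
    and P :: "nat \<Rightarrow> ('r, 'p) module" and d e
  assumes res: "resolves R X P d e"
begin

lemma resolves_modules: "left_module R X" "projective R (P i)" "left_module R (P i)"
  and resolves_maps: "module_map R (P (Suc i)) (P i) (d i)" "module_map R (P 0) X e"
  and resolves_surj: "e ` carrier (P 0) = carrier X"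
  and resolves_exact0: "d 0 ` carrier (P (Suc 0)) = {x \<in> carrier (P 0). e x = \<zero>\<^bsub>X\<^esub>}"
  and resolves_exact: "d (Suc i) ` carrier (P (Suc (Suc i))) = {x \<in> carrier (P (Suc i)). d i x = \<zero>\<^bsub>P i\<^esub>}"
  using res projective_left_module by (auto simp: resolves_def)

lemma resolves_complex0: "x \<in> carrier (P (Suc 0)) \<Longrightarrow> e (d 0 x) = \<zero>\<^bsub>X\<^esub>"
  using resolves_exact0 by blast

lemma resolves_complex: "x \<in> carrier (P (Suc (Suc i))) \<Longrightarrow> d i (d (Suc i) x) = \<zero>\<^bsub>P i\<^esub>"
  using resolves_exact[of i] by blast

lemma resolves_restrict:
  "projective_resolution R X P (\<lambda>i. restrict (d i) (carrier (P (Suc i)))) (restrict e (carrier (P 0)))"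
proof -
  have "{x. (x \<in> C \<longrightarrow> Q x) \<and> x \<in> C} = {x \<in> C. Q x}" for C :: "'p set" and Q
    by auto
  then show ?thesis
    using resolves_modules resolves_maps resolves_surj resolves_exact0 resolves_exact
    by (simp add: projective_resolution_def exact_at_iff restrict_mod_hom)
qed

end

text \<open>\<open>P\<close> only has to be a complex of projectives and \<open>Q\<close> to be
  exact. This covers both the comparison of two resolutions and the twisting maps in
  \<open>horseshoe\<close>, where the complex is shifted and its differential negated.\<close>

lemma lift_chain:
  assumes P: "\<And>i. projective R (P i)" and \<delta>: "\<And>i. module_map R (P (Suc i)) (P i) (\<delta> i)"
    and \<delta>\<delta>: "\<And>i x. x \<in> carrier (P (Suc (Suc i))) \<Longrightarrow> \<delta> i (\<delta> (Suc i) x) = \<zero>\<^bsub>P i\<^esub>"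
    and Q: "\<And>i. left_module R (Q i)" and D: "\<And>i. module_map R (Q (Suc i)) (Q i) (D i)"
    and ex: "\<And>i y. y \<in> carrier (Q (Suc i)) \<Longrightarrow> D i y = \<zero>\<^bsub>Q i\<^esub> \<Longrightarrow> y \<in> D (Suc i) ` carrier (Q (Suc (Suc i)))"
    and f0: "module_map R (P 0) (Q 0) f0"
    and f0D: "\<And>x. x \<in> carrier (P (Suc 0)) \<Longrightarrow> f0 (\<delta> 0 x) \<in> D 0 ` carrier (Q (Suc 0))"
  obtains f where "f 0 = f0" "\<And>i. module_map R (P i) (Q i) (f i)"
    "\<And>i x. x \<in> carrier (P (Suc i)) \<Longrightarrow> D i (f (Suc i) x) = f i (\<delta> i x)"
proof -
  have lP: "left_module R (P i)" for i using P by (rule projective_left_module)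
  \<comment> \<open>The invariant records that \<open>g \<circ> \<delta> n\<close> lands in the
    image of \<open>D n\<close>, which is what the next lift needs; the last conjunct pins down the
    initial map.\<close>
  let ?P = "\<lambda>n g. module_map R (P n) (Q n) g \<and> (\<forall>x\<in>carrier (P (Suc n)). g (\<delta> n x) \<in> D n ` carrier (Q (Suc n))) \<and>
      (n = 0 \<longrightarrow> g = f0)"
  have "\<exists>f. \<forall>n. ?P n (f n) \<and> (\<forall>x\<in>carrier (P (Suc n)). D n (f (Suc n) x) = f n (\<delta> n x))"
  proof (rule dependent_nat_choice)
    show "\<exists>g. ?P 0 g" using f0 f0D by blast
    fix g n assume "?P n g"
    then have g: "module_map R (P n) (Q n) g"
      and im: "\<And>x. x \<in> carrier (P (Suc n)) \<Longrightarrow> g (\<delta> n x) \<in> D n ` carrier (Q (Suc n))" by auto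
    obtain h where h: "module_map R (P (Suc n)) (Q (Suc n)) h"
      "\<And>x. x \<in> carrier (P (Suc n)) \<Longrightarrow> D n (h x) = g (\<delta> n x)"
      using projective_lift[OF P Q Q D module_map_comp[OF \<delta> g] im] by blast
    have "h (\<delta> (Suc n) x) \<in> D (Suc n) ` carrier (Q (Suc (Suc n)))" if x: "x \<in> carrier (P (Suc (Suc n)))" for x
    proof (rule ex)
      have dx: "\<delta> (Suc n) x \<in> carrier (P (Suc n))" by (rule module_map_closed[OF \<delta> x])
      then show "h (\<delta> (Suc n) x) \<in> carrier (Q (Suc n))" by (rule module_map_closed[OF h(1)])
      show "D n (h (\<delta> (Suc n) x)) = \<zero>\<^bsub>Q n\<^esub>"
        using h(2)[OF dx] \<delta>\<delta>[OF x] module_map_zero[OF lP Q g] by simp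
    qed
    then show "\<exists>h. ?P (Suc n) h \<and> (\<forall>x\<in>carrier (P (Suc n)). D n (h x) = g (\<delta> n x))"
      using h by (intro exI[of _ h]) auto
  qed
  then obtain f where "\<forall>n. ?P n (f n) \<and> (\<forall>x\<in>carrier (P (Suc n)). D n (f (Suc n) x) = f n (\<delta> n x))" ..
  then show ?thesis by (intro that[of f]) auto
qed

lemma lift_resolution:
  assumes P: "resolves R X P d e" and Q: "resolves R Y Q d' e'" and s: "module_map R X Y s"
  obtains f where "\<And>i. module_map R (P i) (Q i) (f i)"
    "\<And>x. x \<in> carrier (P 0) \<Longrightarrow> e' (f 0 x) = s (e x)"
    "\<And>i x. x \<in> carrier (P (Suc i)) \<Longrightarrow> d' i (f (Suc i) x) = f i (d i x)"
proof -
  note Pm = resolves_modules[OF P] resolves_maps[OF P] and Qm = resolves_modules[OF Q] resolves_maps[OF Q]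
  have "s (e x) \<in> e' ` carrier (Q 0)" if "x \<in> carrier (P 0)" for x
    using module_map_closed[OF s module_map_closed[OF Pm(5) that]] resolves_surj[OF Q] by simp
  then obtain f0 where f0: "module_map R (P 0) (Q 0) f0" "\<And>x. x \<in> carrier (P 0) \<Longrightarrow> e' (f0 x) = s (e x)"
    using projective_lift[OF Pm(2) Qm(3) Qm(1) Qm(5) module_map_comp[OF Pm(5) s]] by blast
  have f0D: "f0 (d 0 x) \<in> d' 0 ` carrier (Q (Suc 0))" if x: "x \<in> carrier (P (Suc 0))" for x
  proof -
    have dx: "d 0 x \<in> carrier (P 0)" by (rule module_map_closed[OF Pm(4) x])
    have "e' (f0 (d 0 x)) = \<zero>\<^bsub>Y\<^esub>"
      using f0(2)[OF dx] resolves_complex0[OF P x] module_map_zero[OF Pm(1) Qm(1) s] by simp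
    then show ?thesis using module_map_closed[OF f0(1) dx] resolves_exact0[OF Q] by simp
  qed
  have ex: "y \<in> d' (Suc i) ` carrier (Q (Suc (Suc i)))" if "y \<in> carrier (Q (Suc i))" "d' i y = \<zero>\<^bsub>Q i\<^esub>" for i y
    using resolves_exact[OF Q, of i] that by blast
  obtain f where "f 0 = f0" "\<And>i. module_map R (P i) (Q i) (f i)"
    "\<And>i x. x \<in> carrier (P (Suc i)) \<Longrightarrow> d' i (f (Suc i) x) = f i (d i x)"
    using lift_chain[OF Pm(2,4) resolves_complex[OF P] Qm(3,4) ex f0(1) f0D] by blast
  then show ?thesis using f0 by (intro that[of f]) auto
qed

text \<open>\<open>F\<close> covers the zero map of \<open>X\<close>, so \<open>F 0\<close> lands in
  the image of \<open>d 0\<close> and a homotopy can be built by successive lifting. Its equation is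
  recorded in positive degrees, where Ext is asked to vanish.\<close>

lemma null_homotopy:
  assumes P: "resolves R X P d e"
    and F: "\<And>i. module_map R (P i) (P i) (F i)"
    and Fd: "\<And>i x. x \<in> carrier (P (Suc i)) \<Longrightarrow> d i (F (Suc i) x) = F i (d i x)"
    and Fe: "\<And>x. x \<in> carrier (P 0) \<Longrightarrow> e (F 0 x) = \<zero>\<^bsub>X\<^esub>"
  obtains h where "\<And>i. module_map R (P i) (P (Suc i)) (h i)"
    "\<And>i x. x \<in> carrier (P (Suc i)) \<Longrightarrow> F (Suc i) x = d (Suc i) (h (Suc i) x) \<oplus>\<^bsub>P (Suc i)\<^esub> h i (d i x)"
proof -
  note Pm = resolves_modules[OF P] resolves_maps[OF P]
  \<comment> \<open>This is weaker than the homotopy equation in degree \<open>n\<close>, but it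
    suffices for the next lift: it makes \<open>F (Suc n) - h \<circ> d n\<close> take values in the
    cycles.\<close>
  let ?P = "\<lambda>n h. module_map R (P n) (P (Suc n)) h \<and> (\<forall>x\<in>carrier (P (Suc n)). d n (h (d n x)) = F n (d n x))"
  have "\<exists>h. \<forall>n. ?P n (h n) \<and>
      (\<forall>x\<in>carrier (P (Suc n)). d (Suc n) (h (Suc n) x) = F (Suc n) x \<ominus>\<^bsub>P (Suc n)\<^esub> h n (d n x))"
  proof (rule dependent_nat_choice)
    have "F 0 x \<in> d 0 ` carrier (P (Suc 0))" if "x \<in> carrier (P 0)" for x
      using Fe[OF that] module_map_closed[OF F that] resolves_exact0[OF P] by simp
    then obtain h where h: "module_map R (P 0) (P (Suc 0)) h" "\<And>x. x \<in> carrier (P 0) \<Longrightarrow> d 0 (h x) = F 0 x"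
      using projective_lift[OF Pm(2) Pm(3) Pm(3) Pm(4) F] by blast
    then show "\<exists>h. ?P 0 h" using module_map_closed[OF Pm(4)] by blast
    fix h n assume "?P n h"
    then have h: "module_map R (P n) (P (Suc n)) h"
      and hF: "\<And>x. x \<in> carrier (P (Suc n)) \<Longrightarrow> d n (h (d n x)) = F n (d n x)" by auto
    interpret Pn: left_module R "P n" by (rule Pm(3))
    interpret PS: left_module R "P (Suc n)" by (rule Pm(3))
    have G: "module_map R (P (Suc n)) (P (Suc n)) (\<lambda>x. F (Suc n) x \<ominus>\<^bsub>P (Suc n)\<^esub> h (d n x))"
      by (intro module_map_minus Pm(3) F module_map_comp[OF Pm(4) h])
    have "F (Suc n) x \<ominus>\<^bsub>P (Suc n)\<^esub> h (d n x) \<in> d (Suc n) ` carrier (P (Suc (Suc n)))"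
      if x: "x \<in> carrier (P (Suc n))" for x
    proof -
      note dx = module_map_closed[OF Pm(4) x]
      have "d n (F (Suc n) x \<ominus>\<^bsub>P (Suc n)\<^esub> h (d n x)) = \<zero>\<^bsub>P n\<^esub>"
        using module_map_diff[OF Pm(3) Pm(3) Pm(4) module_map_closed[OF F x] module_map_closed[OF h dx]]
          Fd[OF x] hF[OF x] module_map_closed[OF F dx] by (simp add: Pn.M.r_neg a_minus_def)
      then show ?thesis using module_map_closed[OF G x] resolves_exact[OF P, of n] by simp
    qed
    then obtain k where k: "module_map R (P (Suc n)) (P (Suc (Suc n))) k"
      "\<And>x. x \<in> carrier (P (Suc n)) \<Longrightarrow> d (Suc n) (k x) = F (Suc n) x \<ominus>\<^bsub>P (Suc n)\<^esub> h (d n x)"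
      using projective_lift[OF Pm(2) Pm(3) Pm(3) Pm(4) G] by blast
    have "d (Suc n) (k (d (Suc n) x)) = F (Suc n) (d (Suc n) x)" if x: "x \<in> carrier (P (Suc (Suc n)))" for x
    proof -
      note dx = module_map_closed[OF Pm(4) x]
      show ?thesis
        using k(2)[OF dx] resolves_complex[OF P x] module_map_zero[OF Pm(3) Pm(3) h] module_map_closed[OF F dx]
        by (simp add: a_minus_def)
    qed
    then show "\<exists>k. ?P (Suc n) k \<and>
       (\<forall>x\<in>carrier (P (Suc n)). d (Suc n) (k x) = F (Suc n) x \<ominus>\<^bsub>P (Suc n)\<^esub> h (d n x))"
      using k by blast
  qed
  then obtain h where h: "\<And>n. module_map R (P n) (P (Suc n)) (h n)"
    "\<And>n x. x \<in> carrier (P (Suc n)) \<Longrightarrow> d (Suc n) (h (Suc n) x) = F (Suc n) x \<ominus>\<^bsub>P (Suc n)\<^esub> h n (d n x)"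
    by blast
  have "F (Suc n) x = d (Suc n) (h (Suc n) x) \<oplus>\<^bsub>P (Suc n)\<^esub> h n (d n x)" if x: "x \<in> carrier (P (Suc n))" for n x
  proof -
    interpret PS: left_module R "P (Suc n)" by (rule Pm(3))
    show ?thesis
      using h(2)[OF x] module_map_closed[OF F x] module_map_closed[OF h(1) module_map_closed[OF Pm(4) x]]
      by (simp add: a_minus_def PS.M.a_assoc PS.M.l_neg)
  qed
  then show ?thesis using h(1) that by blast
qed

text \<open>The cohomology of \<open>Hom(P, M)\<close> vanishes in all positive degrees; the index
  \<open>i\<close> refers to degree \<open>Suc i\<close>. The elementwise form avoids quotient
  groups.\<close>

definition ext_vanishes ::
    "('r, 'k) ring_scheme \<Rightarrow> (nat \<Rightarrow> ('r, 'p) module) \<Rightarrow> (nat \<Rightarrow> 'p \<Rightarrow> 'p) \<Rightarrow> ('r, 'm) module \<Rightarrow> bool" where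
  "ext_vanishes R P d M \<longleftrightarrow>
     (\<forall>i z. module_map R (P (Suc i)) M z \<longrightarrow>
        (\<forall>x\<in>carrier (P (Suc (Suc i))). z (d (Suc i) x) = \<zero>\<^bsub>M\<^esub>) \<longrightarrow>
        (\<exists>w. module_map R (P i) M w \<and> (\<forall>x\<in>carrier (P (Suc i)). z x = w (d i x))))"

lemma ext_vanishesD:
  assumes "ext_vanishes R P d M" "module_map R (P (Suc i)) M z"
    and "\<And>x. x \<in> carrier (P (Suc (Suc i))) \<Longrightarrow> z (d (Suc i) x) = \<zero>\<^bsub>M\<^esub>"
  shows "\<exists>w. module_map R (P i) M w \<and> (\<forall>x\<in>carrier (P (Suc i)). z x = w (d i x))"
  using assms by (simp add: ext_vanishes_def)

text \<open>
  The lift of \<open>\<Sum>\<^sub>i t\<^sub>i s\<^sub>i = id\<close> to the resolution \<open>P\<close> is homotopic to the identity, so every cocycle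
  on \<open>P\<close> is cohomologous to one that factors through \<open>Q\<close>.
\<close>

lemma ext_vanishes_sum_retract:
  assumes P: "resolves R X P d e" and Q: "resolves R Y Q d' e'" and M: "left_module R M"
    and s: "\<And>i. i \<in> I \<Longrightarrow> module_map R X Y (s i)" and t: "\<And>i. i \<in> I \<Longrightarrow> module_map R Y X (t i)"
    and ts: "\<And>x. x \<in> carrier X \<Longrightarrow> finsum X (\<lambda>i. t i (s i x)) I = x"
    and van: "ext_vanishes R Q d' M"
  shows "ext_vanishes R P d M"
proof -
  note Pm = resolves_modules[OF P] resolves_maps[OF P] and Qm = resolves_modules[OF Q] resolves_maps[OF Q]
  interpret M: left_module R M by fact
  interpret X: left_module R X by (rule Pm(1))
  have "\<forall>i\<in>I. \<exists>f. (\<forall>n. module_map R (P n) (Q n) (f n)) \<and> (\<forall>x\<in>carrier (P 0). e' (f 0 x) = s i (e x)) \<and>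
      (\<forall>n. \<forall>x\<in>carrier (P (Suc n)). d' n (f (Suc n) x) = f n (d n x))"
  proof
    fix i assume i: "i \<in> I"
    show "\<exists>f. (\<forall>n. module_map R (P n) (Q n) (f n)) \<and> (\<forall>x\<in>carrier (P 0). e' (f 0 x) = s i (e x)) \<and>
      (\<forall>n. \<forall>x\<in>carrier (P (Suc n)). d' n (f (Suc n) x) = f n (d n x))"
      by (rule lift_resolution[OF P Q s[OF i]]) blast
  qed
  from bchoice[OF this] obtain f where f: "\<And>i n. i \<in> I \<Longrightarrow> module_map R (P n) (Q n) (f i n)"
    "\<And>i x. i \<in> I \<Longrightarrow> x \<in> carrier (P 0) \<Longrightarrow> e' (f i 0 x) = s i (e x)"
    "\<And>i n x. i \<in> I \<Longrightarrow> x \<in> carrier (P (Suc n)) \<Longrightarrow> d' n (f i (Suc n) x) = f i n (d n x)" by blast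
  have "\<forall>i\<in>I. \<exists>g. (\<forall>n. module_map R (Q n) (P n) (g n)) \<and> (\<forall>x\<in>carrier (Q 0). e (g 0 x) = t i (e' x)) \<and>
      (\<forall>n. \<forall>x\<in>carrier (Q (Suc n)). d n (g (Suc n) x) = g n (d' n x))"
  proof
    fix i assume i: "i \<in> I"
    show "\<exists>g. (\<forall>n. module_map R (Q n) (P n) (g n)) \<and> (\<forall>x\<in>carrier (Q 0). e (g 0 x) = t i (e' x)) \<and>
      (\<forall>n. \<forall>x\<in>carrier (Q (Suc n)). d n (g (Suc n) x) = g n (d' n x))"
      by (rule lift_resolution[OF Q P t[OF i]]) blast
  qed
  from bchoice[OF this] obtain g where g: "\<And>i n. i \<in> I \<Longrightarrow> module_map R (Q n) (P n) (g i n)"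
    "\<And>i x. i \<in> I \<Longrightarrow> x \<in> carrier (Q 0) \<Longrightarrow> e (g i 0 x) = t i (e' x)"
    "\<And>i n x. i \<in> I \<Longrightarrow> x \<in> carrier (Q (Suc n)) \<Longrightarrow> d n (g i (Suc n) x) = g i n (d' n x)" by blast
  define S where "S n x = finsum (P n) (\<lambda>i. g i n (f i n x)) I" for n x
  \<comment> \<open>\<open>S\<close> lifts the identity of \<open>X\<close>, so \<open>F\<close>
    lifts zero and is null-homotopic.\<close>
  define F where "F n x = S n x \<ominus>\<^bsub>P n\<^esub> x" for n x
  have gf: "module_map R (P n) (P n) (\<lambda>x. g i n (f i n x))" if "i \<in> I" for i n
    by (rule module_map_comp[OF f(1)[OF that] g(1)[OF that]])
  have S: "module_map R (P n) (P n) (S n)" for n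
    unfolding S_def by (rule module_map_sum[OF Pm(3) Pm(3) gf])
  have F: "module_map R (P n) (P n) (F n)" for n
    unfolding F_def by (rule module_map_minus[OF Pm(3) Pm(3) S module_map_id])
  have Sd: "d n (S (Suc n) x) = S n (d n x)" if x: "x \<in> carrier (P (Suc n))" for n x
  proof -
    interpret Pn: left_module R "P n" by (rule Pm(3))
    have "d n (S (Suc n) x) = finsum (P n) (\<lambda>i. d n (g i (Suc n) (f i (Suc n) x))) I"
      unfolding S_def by (rule module_map_finsum[OF Pm(3) Pm(3) Pm(4) module_map_closed[OF gf x]])
    also have "\<dots> = S n (d n x)" unfolding S_def
    proof (rule Pn.M.finsum_cong')
      fix i assume i: "i \<in> I"
      show "d n (g i (Suc n) (f i (Suc n) x)) = g i n (f i n (d n x))"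
        using g(3)[OF i module_map_closed[OF f(1)[OF i] x]] f(3)[OF i x] by simp
    qed (use module_map_closed[OF gf module_map_closed[OF Pm(4) x]] in auto)
    finally show ?thesis .
  qed
  have Fd: "d n (F (Suc n) x) = F n (d n x)" if x: "x \<in> carrier (P (Suc n))" for n x
    unfolding F_def
    using module_map_diff[OF Pm(3) Pm(3) Pm(4) module_map_closed[OF S x] x] Sd[OF x] by simp
  have Fe: "e (F 0 x) = \<zero>\<^bsub>X\<^esub>" if x: "x \<in> carrier (P 0)" for x
  proof -
    have ex: "e x \<in> carrier X" by (rule module_map_closed[OF Pm(5) x])
    have "e (S 0 x) = finsum X (\<lambda>i. e (g i 0 (f i 0 x))) I"
      unfolding S_def by (rule module_map_finsum[OF Pm(3) Pm(1) Pm(5) module_map_closed[OF gf x]])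
    also have "\<dots> = finsum X (\<lambda>i. t i (s i (e x))) I"
    proof (rule X.M.finsum_cong')
      fix i assume i: "i \<in> I"
      show "e (g i 0 (f i 0 x)) = t i (s i (e x))"
        using g(2)[OF i module_map_closed[OF f(1)[OF i] x]] f(2)[OF i x] by simp
    qed (use module_map_closed[OF module_map_comp[OF s t] ex] in auto)
    also have "\<dots> = e x" by (rule ts[OF ex])
    finally show ?thesis
      unfolding F_def using module_map_diff[OF Pm(3) Pm(1) Pm(5) module_map_closed[OF S x] x] ex
      by (simp add: a_minus_def X.M.r_neg)
  qed
  obtain h where h: "\<And>n. module_map R (P n) (P (Suc n)) (h n)"
    "\<And>n x. x \<in> carrier (P (Suc n)) \<Longrightarrow> F (Suc n) x = d (Suc n) (h (Suc n) x) \<oplus>\<^bsub>P (Suc n)\<^esub> h n (d n x)"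
    using null_homotopy[OF P F Fd Fe] by blast
  show ?thesis unfolding ext_vanishes_def
  proof (intro allI impI)
    fix n z assume z: "module_map R (P (Suc n)) M z"
      and zd: "\<forall>x\<in>carrier (P (Suc (Suc n))). z (d (Suc n) x) = \<zero>\<^bsub>M\<^esub>"
    have "\<forall>i\<in>I. \<exists>w. module_map R (Q n) M w \<and> (\<forall>y\<in>carrier (Q (Suc n)). z (g i (Suc n) y) = w (d' n y))"
    proof
      fix i assume i: "i \<in> I"
      \<comment> \<open>\<open>g i\<close> commutes with the differentials, so it pulls the cocycle
        \<open>z\<close> back to a cocycle on \<open>Q\<close>.\<close>
      have zg: "z (g i (Suc n) (d' (Suc n) y)) = \<zero>\<^bsub>M\<^esub>" if y: "y \<in> carrier (Q (Suc (Suc n)))" for y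
        using g(3)[OF i y] zd module_map_closed[OF g(1)[OF i] y] by metis
      show "\<exists>w. module_map R (Q n) M w \<and> (\<forall>y\<in>carrier (Q (Suc n)). z (g i (Suc n) y) = w (d' n y))"
        by (rule ext_vanishesD[OF van module_map_comp[OF g(1)[OF i] z] zg])
    qed
    from bchoice[OF this] obtain w where "\<forall>i\<in>I. module_map R (Q n) M (w i) \<and>
        (\<forall>y\<in>carrier (Q (Suc n)). z (g i (Suc n) y) = w i (d' n y))" by (elim exE)
    then have w: "\<And>i. i \<in> I \<Longrightarrow> module_map R (Q n) M (w i)"
      "\<And>i y. i \<in> I \<Longrightarrow> y \<in> carrier (Q (Suc n)) \<Longrightarrow> z (g i (Suc n) y) = w i (d' n y)" by simp_all
    define u where "u p = finsum M (\<lambda>i. w i (f i n p)) I" for p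
    have wf: "module_map R (P n) M (\<lambda>p. w i (f i n p))" if "i \<in> I" for i
      by (rule module_map_comp[OF f(1)[OF that] w(1)[OF that]])
    have u: "module_map R (P n) M u"
      unfolding u_def by (rule module_map_sum[OF Pm(3) M wf])
    note zh = module_map_comp[OF h(1) z]
    \<comment> \<open>Applied to the homotopy equation, the cocycle \<open>z\<close> kills the term
      \<open>d (Suc n) (h (Suc n) x)\<close>. What remains, together with the coboundaries
      \<open>w i\<close> on \<open>Q\<close>, expresses \<open>z x\<close> through
      \<open>d n x\<close>.\<close>
    have "z x = u (d n x) \<ominus>\<^bsub>M\<^esub> z (h n (d n x))" if x: "x \<in> carrier (P (Suc n))" for x
    proof -
      have dx: "d n x \<in> carrier (P n)" by (rule module_map_closed[OF Pm(4) x])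
      have hx: "h (Suc n) x \<in> carrier (P (Suc (Suc n)))" by (rule module_map_closed[OF h(1) x])
      have zhc: "z (h n (d n x)) \<in> carrier M" by (rule module_map_closed[OF zh dx])
      have "z (S (Suc n) x) = finsum M (\<lambda>i. z (g i (Suc n) (f i (Suc n) x))) I"
        unfolding S_def by (rule module_map_finsum[OF Pm(3) M z module_map_closed[OF gf x]])
      also have "\<dots> = u (d n x)" unfolding u_def
      proof (rule M.M.finsum_cong')
        fix i assume i: "i \<in> I"
        show "z (g i (Suc n) (f i (Suc n) x)) = w i (f i n (d n x))"
          using w(2)[OF i module_map_closed[OF f(1)[OF i] x]] f(3)[OF i x] by simp
      qed (use module_map_closed[OF wf dx] in auto)
      finally have 1: "z (S (Suc n) x) = u (d n x)" .
      have "z (F (Suc n) x) = z (d (Suc n) (h (Suc n) x)) \<oplus>\<^bsub>M\<^esub> z (h n (d n x))"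
        unfolding h(2)[OF x]
        by (rule module_map_add[OF z module_map_closed[OF Pm(4) hx] module_map_closed[OF h(1) dx]])
      then have "z (F (Suc n) x) = z (h n (d n x))" using zd hx zhc by simp
      then have "u (d n x) \<ominus>\<^bsub>M\<^esub> z x = z (h n (d n x))"
        unfolding F_def using module_map_diff[OF Pm(3) M z module_map_closed[OF S x] x] 1 by simp
      then have "u (d n x) \<ominus>\<^bsub>M\<^esub> z (h n (d n x)) = u (d n x) \<ominus>\<^bsub>M\<^esub> (u (d n x) \<ominus>\<^bsub>M\<^esub> z x)" by simp
      also have "\<dots> = z x"
        using module_map_closed[OF u dx] module_map_closed[OF z x]
        by (simp add: a_minus_def M.M.minus_add M.M.r_neg2 M.M.a_assoc[symmetric] M.M.r_neg)
      finally show ?thesis ..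
    qed
    then show "\<exists>w. module_map R (P n) M w \<and> (\<forall>x\<in>carrier (P (Suc n)). z x = w (d n x))"
      by (intro exI[of _ "\<lambda>p. u p \<ominus>\<^bsub>M\<^esub> z (h n p)"] conjI module_map_minus[OF Pm(3) M u zh]) auto
  qed
qed

text \<open>The family with one member. For \<open>X = Y\<close> this is independence of the
  resolution and of the carrier type of its terms.\<close>

lemma ext_vanishes_retract:
  assumes P: "resolves R X P d e" and Q: "resolves R Y Q d' e'" and M: "left_module R M"
    and ret: "retract R X Y" and van: "ext_vanishes R Q d' M"
  shows "ext_vanishes R P d M"
proof -
  interpret X: left_module R X by (rule resolves_modules(1)[OF P])
  obtain s t where st: "module_map R X Y s" "module_map R Y X t" "\<And>x. x \<in> carrier X \<Longrightarrow> t (s x) = x"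
    using ret unfolding retract_def by blast
  show ?thesis
    by (rule ext_vanishes_sum_retract[OF P Q M _ _ _ van, of "{0::nat}" "\<lambda>_. s" "\<lambda>_. t"])
       (use st in \<open>auto simp: X.M.finsum_insert\<close>)
qed

lemma retract_refl: "retract R X X"
  unfolding retract_def using module_map_id by blast

section \<open>The groups that define Ext\<close>

lemma hom_group_comm:
  assumes M: "left_module R M" and N: "left_module R N"
  shows "comm_group (hom_group R M N)"
proof (rule comm_groupI)
  interpret M: left_module R M by fact
  interpret N: left_module R N by fact
  fix f g assume "f \<in> carrier (hom_group R M N)" "g \<in> carrier (hom_group R M N)"
  then have f: "module_map R M N f" "f \<in> extensional (carrier M)"
    and g: "module_map R M N g" "g \<in> extensional (carrier M)"
    by (auto simp: hom_group_def mod_hom_iff)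
  note c = module_map_closed[OF f(1)] module_map_closed[OF g(1)]
  show "f \<otimes>\<^bsub>hom_group R M N\<^esub> g \<in> carrier (hom_group R M N)"
    using restrict_mod_hom[OF M module_map_plus[OF M N f(1) g(1)]] by (simp add: hom_group_def)
  show "f \<otimes>\<^bsub>hom_group R M N\<^esub> g = g \<otimes>\<^bsub>hom_group R M N\<^esub> f"
    by (auto simp: hom_group_def c intro!: restrict_ext N.M.a_comm)
  show "\<one>\<^bsub>hom_group R M N\<^esub> \<otimes>\<^bsub>hom_group R M N\<^esub> f = f"
    by (rule extensionalityI[OF _ f(2)]) (auto simp: hom_group_def c)
  show "\<exists>h\<in>carrier (hom_group R M N). h \<otimes>\<^bsub>hom_group R M N\<^esub> f = \<one>\<^bsub>hom_group R M N\<^esub>"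
    using restrict_mod_hom[OF M module_map_uminus[OF M N f(1)]]
    by (intro bexI[of _ "\<lambda>x\<in>carrier M. \<ominus>\<^bsub>N\<^esub> f x"]) (auto simp: hom_group_def c N.M.l_neg intro!: restrict_ext)
  fix h assume "h \<in> carrier (hom_group R M N)"
  then have h: "module_map R M N h" by (auto simp: hom_group_def mod_hom_iff)
  show "f \<otimes>\<^bsub>hom_group R M N\<^esub> g \<otimes>\<^bsub>hom_group R M N\<^esub> h = f \<otimes>\<^bsub>hom_group R M N\<^esub> (g \<otimes>\<^bsub>hom_group R M N\<^esub> h)"
    by (auto simp: hom_group_def c module_map_closed[OF h] N.M.a_assoc intro!: restrict_ext)
next
  show "\<one>\<^bsub>hom_group R M N\<^esub> \<in> carrier (hom_group R M N)"
    using restrict_mod_hom[OF M module_map_const_zero[OF N]] by (simp add: hom_group_def)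
qed

lemma pullback_hom:
  assumes M: "left_module R M" and L: "left_module R L" and N: "left_module R N" and f: "module_map R M L f"
  shows "pullback M f \<in> hom (hom_group R L N) (hom_group R M N)"
proof (rule homI)
  fix g assume "g \<in> carrier (hom_group R L N)"
  then have g: "module_map R L N g" by (auto simp: hom_group_def mod_hom_iff)
  show "pullback M f g \<in> carrier (hom_group R M N)"
    using restrict_mod_hom[OF M module_map_comp[OF f g]] by (simp add: hom_group_def pullback_def compose_def)
  fix h assume "h \<in> carrier (hom_group R L N)"
  show "pullback M f (g \<otimes>\<^bsub>hom_group R L N\<^esub> h) = pullback M f g \<otimes>\<^bsub>hom_group R M N\<^esub> pullback M f h"
    by (auto simp: hom_group_def pullback_def compose_def module_map_closed[OF f] intro!: restrict_ext)
qed

text \<open>Commutativity makes \<open>B\<close> normal in \<open>Z\<close>, and the coset of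
  \<open>x\<close> is the neutral one exactly when \<open>x\<close> lies in
  \<open>B\<close>.\<close>

lemma (in comm_group) trivial_subquotient_iff:
  assumes Z: "subgroup Z G" and B: "subgroup B G" and BZ: "B \<subseteq> Z"
  shows "trivial_group (G\<lparr>carrier := Z\<rparr> Mod B) \<longleftrightarrow> Z \<subseteq> B"
proof -
  let ?H = "G\<lparr>carrier := Z\<rparr>"
  interpret H: comm_group ?H by (rule group.group_comm_groupI[OF subgroup.subgroup_is_group[OF Z is_group]])
      (use subgroup.subset[OF Z] m_comm in auto)
  have B': "subgroup B ?H" using B Z BZ by (simp add: subgroup_incl)
  interpret B: normal B ?H by (rule H.subgroup_imp_normal[OF B'])
  have car: "carrier (?H Mod B) = (\<lambda>x. B #>\<^bsub>?H\<^esub> x) ` Z" by (simp add: carrier_FactGroup)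
  have mem: "x \<in> B #>\<^bsub>?H\<^esub> x" if "x \<in> Z" for x
    using H.rcos_self[OF _ B'] that by simp
  have eq: "B #>\<^bsub>?H\<^esub> x = B" if "x \<in> B" for x
    using H.coset_join2[OF _ B' that] that BZ by auto
  show ?thesis
  proof
    assume "trivial_group (?H Mod B)"
    then have "(\<lambda>x. B #>\<^bsub>?H\<^esub> x) ` Z = {B}" by (simp add: trivial_group_def car)
    then show "Z \<subseteq> B" using mem by blast
  next
    assume "Z \<subseteq> B"
    then have "carrier (?H Mod B) = {B}" unfolding car using eq BZ subgroup.one_closed[OF B] by auto
    then show "trivial_group (?H Mod B)" by (simp add: trivial_group_def B.factorgroup_is_group)
  qed
qed

text \<open>A positive degree has the form \<open>Suc i\<close>, where the coboundaries are the
  image of a pullback. Elements of the Hom groups are extensional while \<open>ext_vanishes\<close>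
  speaks about arbitrary maps, hence the restrictions in both directions.\<close>

lemma ext_trivial_iff_of_resolution:
  assumes P: "projective_resolution R X P d e" and X: "left_module R X" and M: "left_module R M"
  shows "(\<forall>i>0. trivial_group (hom_cohomology R P d M i)) \<longleftrightarrow> ext_vanishes R P d M"
proof -
  have res: "resolves R X P d e" using projective_resolution_resolves[OF X P] .
  note Pm = resolves_modules[OF res] resolves_maps[OF res]
  interpret M: left_module R M by fact
  let ?H = "\<lambda>i. hom_group R (P i) M"
  let ?Z = "\<lambda>i. hom_cocycles R P d M i" and ?B = "\<lambda>i. hom_coboundaries R P d M i"
  have gh: "group_hom (?H i) (?H (Suc i)) (pullback (P (Suc i)) (d i))" for i
    using hom_group_comm[OF Pm(3) M] pullback_hom[OF Pm(3) Pm(3) M Pm(4)]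
    by (simp add: group_hom_def group_hom_axioms_def comm_group_def)
  have Z: "z \<in> ?Z (Suc i) \<longleftrightarrow> z \<in> mod_hom R (P (Suc i)) M \<and>
      (\<forall>x\<in>carrier (P (Suc (Suc i))). z (d (Suc i) x) = \<zero>\<^bsub>M\<^esub>)" for z i
    by (auto simp: hom_cocycles_def kernel_def hom_group_def pullback_def compose_def fun_eq_iff)
  have B: "z \<in> ?B (Suc i) \<longleftrightarrow> (\<exists>w\<in>mod_hom R (P i) M. z = (\<lambda>x\<in>carrier (P (Suc i)). w (d i x)))" for z i
    by (auto simp: pullback_def compose_def)
  have BZ: "?B (Suc i) \<subseteq> ?Z (Suc i)" for i
  proof
    fix z assume "z \<in> ?B (Suc i)"
    then obtain w where "w \<in> mod_hom R (P i) M" and z: "z = (\<lambda>x\<in>carrier (P (Suc i)). w (d i x))"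
      unfolding B by (elim bexE)
    then have w: "module_map R (P i) M w" by (simp add: mod_hom_iff)
    show "z \<in> ?Z (Suc i)" unfolding Z z
      using restrict_mod_hom[OF Pm(3) module_map_comp[OF Pm(4) w]] module_map_closed[OF Pm(4)]
        resolves_complex[OF res] module_map_zero[OF Pm(3) M w] by simp
  qed
  have "trivial_group (hom_cohomology R P d M (Suc i)) \<longleftrightarrow> ?Z (Suc i) \<subseteq> ?B (Suc i)" for i
  proof -
    have "subgroup (?Z (Suc i)) (?H (Suc i))"
      unfolding hom_cocycles_def by (rule group_hom.subgroup_kernel[OF gh])
    moreover have "subgroup (?B (Suc i)) (?H (Suc i))"
      using group_hom.img_is_subgroup[OF gh, of i] by (simp add: hom_group_def)
    ultimately show ?thesis unfolding hom_cohomology_def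
      by (rule comm_group.trivial_subquotient_iff[OF hom_group_comm[OF Pm(3) M] _ _ BZ])
  qed
  then have "(\<forall>i>0. trivial_group (hom_cohomology R P d M i)) \<longleftrightarrow> (\<forall>i. ?Z (Suc i) \<subseteq> ?B (Suc i))"
    by (metis gr0_conv_Suc)
  also have "\<dots> \<longleftrightarrow> ext_vanishes R P d M"
  proof
    assume L: "\<forall>i. ?Z (Suc i) \<subseteq> ?B (Suc i)"
    show "ext_vanishes R P d M" unfolding ext_vanishes_def
    proof (intro allI impI)
      fix i z assume z: "module_map R (P (Suc i)) M z"
        and zd: "\<forall>x\<in>carrier (P (Suc (Suc i))). z (d (Suc i) x) = \<zero>\<^bsub>M\<^esub>"
      have "restrict z (carrier (P (Suc i))) \<in> ?Z (Suc i)" unfolding Z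
        using restrict_mod_hom[OF Pm(3) z] zd module_map_closed[OF Pm(4)] by simp
      then have "restrict z (carrier (P (Suc i))) \<in> ?B (Suc i)" using L by blast
      then obtain w where "w \<in> mod_hom R (P i) M"
        and w': "restrict z (carrier (P (Suc i))) = (\<lambda>x\<in>carrier (P (Suc i)). w (d i x))"
        unfolding B by (elim bexE)
      then have w: "module_map R (P i) M w" by (simp add: mod_hom_iff)
      have "z x = w (d i x)" if "x \<in> carrier (P (Suc i))" for x using fun_cong[OF w', of x] that by simp
      then show "\<exists>w. module_map R (P i) M w \<and> (\<forall>x\<in>carrier (P (Suc i)). z x = w (d i x))"
        using w by (intro exI[of _ w] conjI ballI)
    qed
  next
    assume van: "ext_vanishes R P d M"
    show "\<forall>i. ?Z (Suc i) \<subseteq> ?B (Suc i)"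
    proof (intro allI subsetI)
      fix i z assume "z \<in> ?Z (Suc i)"
      then have z: "module_map R (P (Suc i)) M z" "z \<in> extensional (carrier (P (Suc i)))"
        and zd: "\<And>x. x \<in> carrier (P (Suc (Suc i))) \<Longrightarrow> z (d (Suc i) x) = \<zero>\<^bsub>M\<^esub>"
        unfolding Z mod_hom_iff by auto
      obtain w where w: "module_map R (P i) M w" "\<forall>x\<in>carrier (P (Suc i)). z x = w (d i x)"
        using ext_vanishesD[OF van z(1)] zd by meson
      have "z = (\<lambda>x\<in>carrier (P (Suc i)). restrict w (carrier (P i)) (d i x))"
        by (rule extensionalityI[OF z(2)]) (use w(2) module_map_closed[OF Pm(4)] in auto)
      then show "z \<in> ?B (Suc i)" unfolding B by (intro bexI[OF _ restrict_mod_hom[OF Pm(3) w(1)]])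
    qed
  qed
  finally show ?thesis .
qed

lemma some_resolution:
  fixes X :: "('r, 'x) module"
  assumes "left_module R X" "some_resolution R X = (P, d, e)"
  shows "projective_resolution R X P d e"
proof -
  have "\<exists>p :: (nat \<Rightarrow> ('r, ('r, 'x) res_carrier) module) \<times>
      (nat \<Rightarrow> ('r, 'x) res_carrier \<Rightarrow> ('r, 'x) res_carrier) \<times> (('r, 'x) res_carrier \<Rightarrow> 'x).
      case p of (P, d, e) \<Rightarrow> projective_resolution R X P d e"
    using projective_resolution_exists[OF assms(1)] by auto
  from someI_ex[OF this] show ?thesis using assms(2) by (simp add: some_resolution_def)
qed

text \<open>\<open>P\<close> is compared in both directions with the resolution that
  \<open>Ext\<close> picks, over the identity of \<open>X\<close>. Hence Ext may be tested on any
  resolution, whatever the type of its terms.\<close>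

lemma ext_trivial_iff:
  assumes P: "resolves R X P d e" and M: "left_module R M"
  shows "(\<forall>i>0. trivial_group (Ext R i X M)) \<longleftrightarrow> ext_vanishes R P d M"
proof -
  have X: "left_module R X" by (rule resolves_modules(1)[OF P])
  obtain Q d' e' where Q: "some_resolution R X = (Q, d', e')" by (cases "some_resolution R X")
  have pQ: "projective_resolution R X Q d' e'" by (rule some_resolution[OF X Q])
  have rQ: "resolves R X Q d' e'" by (rule projective_resolution_resolves[OF X pQ])
  have "(\<forall>i>0. trivial_group (Ext R i X M)) \<longleftrightarrow> ext_vanishes R Q d' M"
    using ext_trivial_iff_of_resolution[OF pQ X M] by (simp add: Ext_def Q)
  also have "\<dots> \<longleftrightarrow> ext_vanishes R P d M"
    using ext_vanishes_retract[OF P rQ M retract_refl] ext_vanishes_retract[OF rQ P M retract_refl] by blast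
  finally show ?thesis .
qed

section \<open>Vanishing of Ext in short exact sequences\<close>

text \<open>Two preimages of an element under \<open>p\<close> differ by an element of the kernel,
  which \<open>f\<close> kills; so the choice made by \<open>inv_into\<close> does not
  matter.\<close>

lemma factor_through_surj:
  assumes D: "left_module R D" and L: "left_module R L" and M: "left_module R M"
    and p: "module_map R D L p" and f: "module_map R D M f" and surj: "p ` carrier D = carrier L"
    and ker: "\<And>x. x \<in> carrier D \<Longrightarrow> p x = \<zero>\<^bsub>L\<^esub> \<Longrightarrow> f x = \<zero>\<^bsub>M\<^esub>"
  obtains g where "module_map R L M g" "\<And>x. x \<in> carrier D \<Longrightarrow> g (p x) = f x"
proof -
  interpret D: left_module R D by fact
  interpret L: left_module R L by fact
  interpret M: left_module R M by fact
  note pc = module_map_closed[OF p] and fc = module_map_closed[OF f]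
  have eq: "f x = f y" if "x \<in> carrier D" "y \<in> carrier D" "p x = p y" for x y
  proof -
    have "p (x \<ominus>\<^bsub>D\<^esub> y) = \<zero>\<^bsub>L\<^esub>"
      using module_map_diff[OF D L p that(1,2)] that pc by (simp add: a_minus_def L.M.r_neg)
    then have "f x \<ominus>\<^bsub>M\<^esub> f y = \<zero>\<^bsub>M\<^esub>"
      using ker[of "x \<ominus>\<^bsub>D\<^esub> y"] module_map_diff[OF D M f that(1,2)] that by simp
    then have "\<ominus>\<^bsub>M\<^esub> (\<ominus>\<^bsub>M\<^esub> f y) = f x"
      by (intro M.M.minus_equality) (use fc that in \<open>simp_all add: a_minus_def\<close>)
    then show ?thesis using fc that by simp
  qed
  define g where "g l = f (inv_into (carrier D) p l)" for l
  have gp: "g (p x) = f x" if "x \<in> carrier D" for x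
    unfolding g_def by (rule eq) (use that in \<open>auto intro: inv_into_into f_inv_into_f\<close>)
  have "module_map R L M g"
  proof (rule module_mapI)
    fix l assume "l \<in> carrier L"
    then obtain x where x: "x \<in> carrier D" "l = p x" using surj by blast
    then show "g l \<in> carrier M" using gp fc by simp
    {
      fix k assume "k \<in> carrier L"
      then obtain y where y: "y \<in> carrier D" "k = p y" using surj by blast
      then show "g (l \<oplus>\<^bsub>L\<^esub> k) = g l \<oplus>\<^bsub>M\<^esub> g k"
        using x gp by (simp add: module_map_add[OF p, symmetric] module_map_add[OF f])
    }
    {
      fix r assume "r \<in> carrier R"
      then show "g (r \<odot>\<^bsub>L\<^esub> l) = r \<odot>\<^bsub>M\<^esub> g l"
        using x gp by (simp add: module_map_smult[OF p, symmetric] module_map_smult[OF f])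
    }
  qed
  then show ?thesis using gp by (rule that)
qed

locale short_exact =
  fixes R :: "('r, 'k) ring_scheme" and K :: "('r, 'x) module" and L :: "('r, 'y) module"
    and C :: "('r, 'z) module" and u p
  assumes K: "left_module R K" and L: "left_module R L" and C: "left_module R C"
    and u: "module_map R K L u" and p: "module_map R L C p"
    and inj: "inj_on u (carrier K)" and surj: "p ` carrier L = carrier C"
    and exact: "u ` carrier K = {x \<in> carrier L. p x = \<zero>\<^bsub>C\<^esub>}"
begin

sublocale K: left_module R K by (rule K)
sublocale L: left_module R L by (rule L)
sublocale C: left_module R C by (rule C)

lemma pu: "x \<in> carrier K \<Longrightarrow> p (u x) = \<zero>\<^bsub>C\<^esub>"
  using exact by blast

lemma u_eq: "x \<in> carrier K \<Longrightarrow> y \<in> carrier K \<Longrightarrow> u x = u y \<Longrightarrow> x = y"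
  using inj by (simp add: inj_on_eq_iff)

text \<open>This is what \<open>Ext\<^sup>1(C, M) = 0\<close> gives in the long exact sequence.
  \<open>L\<close> is the quotient of \<open>P 0 \<oplus> K\<close> by the elements
  \<open>(d 0 y, - \<gamma> y)\<close>, and the extension is assembled from \<open>f\<close> on
  \<open>K\<close> and a solution \<open>w\<close> of a coboundary equation on
  \<open>P 0\<close>.\<close>

lemma extend_hom:
  assumes P: "resolves R C P d e" and M: "left_module R M"
    and van: "ext_vanishes R P d M" and f: "module_map R K M f"
  obtains g where "module_map R L M g" "\<And>x. x \<in> carrier K \<Longrightarrow> g (u x) = f x"
proof -
  interpret M: left_module R M by (rule M)
  note Pm = resolves_modules[OF P] resolves_maps[OF P]
  have "e x \<in> p ` carrier L" if "x \<in> carrier (P 0)" for x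
    using module_map_closed[OF Pm(5) that] surj by simp
  then obtain \<alpha> where \<alpha>: "module_map R (P 0) L \<alpha>" "\<And>x. x \<in> carrier (P 0) \<Longrightarrow> p (\<alpha> x) = e x"
    using projective_lift[OF Pm(2) L C p Pm(5)] by blast
  note \<alpha>d = module_map_comp[OF Pm(4)[of 0] \<alpha>(1)]
  have "\<alpha> (d 0 x) \<in> u ` carrier K" if x: "x \<in> carrier (P (Suc 0))" for x
    unfolding exact
    using \<alpha>(2)[OF module_map_closed[OF Pm(4) x]] resolves_complex0[OF P x] module_map_closed[OF \<alpha>d x] by simp
  \<comment> \<open>The lift \<open>\<alpha>\<close> of the augmentation takes boundaries into the
    image of \<open>K\<close>; \<open>\<gamma>\<close> is the resulting 1-cocycle, which represents
    the extension \<open>L\<close>.\<close>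
  then obtain \<gamma> where \<gamma>: "module_map R (P (Suc 0)) K \<gamma>" "\<And>x. x \<in> carrier (P (Suc 0)) \<Longrightarrow> u (\<gamma> x) = \<alpha> (d 0 x)"
    using projective_lift[OF Pm(2) K L u \<alpha>d] by blast
  have "\<gamma> (d (Suc 0) x) = \<zero>\<^bsub>K\<^esub>" if x: "x \<in> carrier (P (Suc (Suc 0)))" for x
  proof (rule u_eq)
    have dx: "d (Suc 0) x \<in> carrier (P (Suc 0))" by (rule module_map_closed[OF Pm(4) x])
    show "\<gamma> (d (Suc 0) x) \<in> carrier K" by (rule module_map_closed[OF \<gamma>(1) dx])
    show "u (\<gamma> (d (Suc 0) x)) = u \<zero>\<^bsub>K\<^esub>"
      using \<gamma>(2)[OF dx] resolves_complex[OF P x] module_map_zero[OF Pm(3) L \<alpha>(1)] module_map_zero[OF K L u]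
      by simp
  qed simp
  then have "f (\<gamma> (d (Suc 0) x)) = \<zero>\<^bsub>M\<^esub>" if "x \<in> carrier (P (Suc (Suc 0)))" for x
    using that module_map_zero[OF K M f] by simp
  then obtain w where w: "module_map R (P 0) M w" "\<forall>x\<in>carrier (P (Suc 0)). f (\<gamma> x) = w (d 0 x)"
    using ext_vanishesD[OF van module_map_comp[OF \<gamma>(1) f]] by meson
  let ?D = "prod_module (P 0) K"
  have D: "left_module R ?D" by (rule prod_left_module[OF Pm(3) K])
  interpret P0: left_module R "P 0" by (rule Pm(3))
  have \<theta>: "module_map R ?D L (\<lambda>x. \<alpha> (fst x) \<oplus>\<^bsub>L\<^esub> u (snd x))"
    by (intro module_map_plus D L module_map_comp[OF module_map_fst \<alpha>(1)] module_map_comp[OF module_map_snd u])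
  have \<psi>: "module_map R ?D M (\<lambda>x. w (fst x) \<oplus>\<^bsub>M\<^esub> f (snd x))"
    by (intro module_map_plus D M module_map_comp[OF module_map_fst w(1)] module_map_comp[OF module_map_snd f])
  have \<theta>_surj: "(\<lambda>x. \<alpha> (fst x) \<oplus>\<^bsub>L\<^esub> u (snd x)) ` carrier ?D = carrier L"
  proof
    show "(\<lambda>x. \<alpha> (fst x) \<oplus>\<^bsub>L\<^esub> u (snd x)) ` carrier ?D \<subseteq> carrier L"
      using module_map_closed[OF \<theta>] by auto
    show "carrier L \<subseteq> (\<lambda>x. \<alpha> (fst x) \<oplus>\<^bsub>L\<^esub> u (snd x)) ` carrier ?D"
    proof
      fix l assume l: "l \<in> carrier L"
      obtain q where q: "q \<in> carrier (P 0)" "p l = e q"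
        using resolves_surj[OF P] module_map_closed[OF p l] by (metis imageE)
      note \<alpha>q = module_map_closed[OF \<alpha>(1) q(1)]
      have "\<ominus>\<^bsub>L\<^esub> \<alpha> q \<oplus>\<^bsub>L\<^esub> l \<in> u ` carrier K"
        unfolding exact using l \<alpha>q q \<alpha>(2)[OF q(1)] module_map_closed[OF p l]
        by (simp add: module_map_add[OF p] module_map_neg[OF L C p] C.M.l_neg)
      then obtain k where k: "k \<in> carrier K" "u k = \<ominus>\<^bsub>L\<^esub> \<alpha> q \<oplus>\<^bsub>L\<^esub> l" by (metis imageE)
      show "l \<in> (\<lambda>x. \<alpha> (fst x) \<oplus>\<^bsub>L\<^esub> u (snd x)) ` carrier ?D"
        by (rule image_eqI[of _ _ "(q, k)"]) (use k q \<alpha>q l in \<open>simp_all add: L.M.r_neg2\<close>)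
    qed
  qed
  \<comment> \<open>The kernel of the map onto \<open>L\<close> consists of pairs
    \<open>(d 0 y, - \<gamma> y)\<close>, and on these the two summands cancel because
    \<open>f \<circ> \<gamma> = w \<circ> d 0\<close>.\<close>
  have "w (fst x) \<oplus>\<^bsub>M\<^esub> f (snd x) = \<zero>\<^bsub>M\<^esub>"
    if x: "x \<in> carrier ?D" and 0: "\<alpha> (fst x) \<oplus>\<^bsub>L\<^esub> u (snd x) = \<zero>\<^bsub>L\<^esub>" for x
  proof -
    obtain q k where qk: "x = (q, k)" "q \<in> carrier (P 0)" "k \<in> carrier K" using x by auto
    note \<alpha>q = module_map_closed[OF \<alpha>(1) qk(2)] and uk = module_map_closed[OF u qk(3)]
    have 0: "\<alpha> q \<oplus>\<^bsub>L\<^esub> u k = \<zero>\<^bsub>L\<^esub>" using 0 qk(1) by simp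
    have "e q = p (\<alpha> q \<oplus>\<^bsub>L\<^esub> u k)"
      using module_map_add[OF p \<alpha>q uk] \<alpha>(2)[OF qk(2)] pu[OF qk(3)] module_map_closed[OF Pm(5) qk(2)] by simp
    then have "e q = \<zero>\<^bsub>C\<^esub>" using 0 module_map_zero[OF L C p] by simp
    then obtain y where y: "y \<in> carrier (P (Suc 0))" "q = d 0 y"
      using resolves_exact0[OF P] qk(2) by blast
    note \<gamma>y = module_map_closed[OF \<gamma>(1) y(1)]
    have "u k = \<ominus>\<^bsub>L\<^esub> \<alpha> q"
      using L.M.minus_equality[of "u k" "\<alpha> q"] 0 L.M.a_comm[OF uk \<alpha>q] uk \<alpha>q by simp
    also have "\<dots> = u (\<ominus>\<^bsub>K\<^esub> \<gamma> y)" using \<gamma>(2)[OF y(1)] module_map_neg[OF K L u \<gamma>y] y(2) by simp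
    finally have "k = \<ominus>\<^bsub>K\<^esub> \<gamma> y" using u_eq qk(3) \<gamma>y by simp
    then have "f k = \<ominus>\<^bsub>M\<^esub> w q" using module_map_neg[OF K M f \<gamma>y] w(2) y by simp
    then show ?thesis using qk module_map_closed[OF w(1) qk(2)] by (simp add: M.M.r_neg)
  qed
  then obtain g where g: "module_map R L M g"
    and g\<theta>: "\<And>x. x \<in> carrier ?D \<Longrightarrow> g (\<alpha> (fst x) \<oplus>\<^bsub>L\<^esub> u (snd x)) = w (fst x) \<oplus>\<^bsub>M\<^esub> f (snd x)"
    using factor_through_surj[OF D L M \<theta> \<psi> \<theta>_surj] by blast
  have "g (u x) = f x" if x: "x \<in> carrier K" for x
    using g\<theta>[of "(\<zero>\<^bsub>P 0\<^esub>, x)"] x module_map_zero[OF Pm(3) L \<alpha>(1)] module_map_zero[OF Pm(3) M w(1)]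
      module_map_closed[OF u x] module_map_closed[OF f x] by simp
  with g show ?thesis by (rule that)
qed

text \<open>The resolution of \<open>L\<close> is the sum of the two given ones with its
  differential twisted by \<open>\<beta>\<close>. The maps \<open>\<alpha>\<close> and
  \<open>\<beta>\<close> and their equations belong to the conclusion because
  \<open>ext_vanishes_cokernel\<close> computes with them.\<close>

lemma horseshoe:
  assumes Q: "resolves R K Q dQ eQ" and P: "resolves R C P d e"
  obtains \<alpha> \<beta> where "module_map R (P 0) L \<alpha>" "\<And>i. module_map R (P (Suc i)) (Q i) (\<beta> i)"
    "\<And>x. x \<in> carrier (P (Suc 0)) \<Longrightarrow> u (eQ (\<beta> 0 x)) = \<ominus>\<^bsub>L\<^esub> \<alpha> (d 0 x)"
    "\<And>i x. x \<in> carrier (P (Suc (Suc i))) \<Longrightarrow> dQ i (\<beta> (Suc i) x) = \<ominus>\<^bsub>Q i\<^esub> \<beta> i (d (Suc i) x)"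
    "resolves R L (\<lambda>i. prod_module (Q i) (P i)) (\<lambda>i x. (dQ i (fst x) \<oplus>\<^bsub>Q i\<^esub> \<beta> i (snd x), d i (snd x)))
       (\<lambda>x. u (eQ (fst x)) \<oplus>\<^bsub>L\<^esub> \<alpha> (snd x))"
proof -
  note Pm = resolves_modules[OF P] resolves_maps[OF P]
  note Qm = resolves_modules[OF Q] resolves_maps[OF Q]
  note ueQ = module_map_comp[OF Qm(5) u]
  have "e x \<in> p ` carrier L" if "x \<in> carrier (P 0)" for x
    using module_map_closed[OF Pm(5) that] surj by simp
  then obtain \<alpha> where \<alpha>: "module_map R (P 0) L \<alpha>" "\<And>x. x \<in> carrier (P 0) \<Longrightarrow> p (\<alpha> x) = e x"
    using projective_lift[OF Pm(2) L C p Pm(5)] by blast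
  have \<alpha>d: "module_map R (P (Suc 0)) L (\<lambda>x. \<ominus>\<^bsub>L\<^esub> \<alpha> (d 0 x))"
    by (intro module_map_uminus Pm(3) L module_map_comp[OF Pm(4) \<alpha>(1)])
  have im: "(\<lambda>x. u (eQ x)) ` carrier (Q 0) = {x \<in> carrier L. p x = \<zero>\<^bsub>C\<^esub>}"
    using resolves_surj[OF Q] exact by (simp add: image_image[symmetric])
  have "\<ominus>\<^bsub>L\<^esub> \<alpha> (d 0 x) \<in> (\<lambda>x. u (eQ x)) ` carrier (Q 0)" if x: "x \<in> carrier (P (Suc 0))" for x
  proof -
    note dx = module_map_closed[OF Pm(4) x]
    show ?thesis unfolding im
      using module_map_neg[OF L C p module_map_closed[OF \<alpha>(1) dx]] \<alpha>(2)[OF dx] resolves_complex0[OF P x]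
        module_map_closed[OF \<alpha>d x] by simp
  qed
  then obtain b where b: "module_map R (P (Suc 0)) (Q 0) b"
    "\<And>x. x \<in> carrier (P (Suc 0)) \<Longrightarrow> u (eQ (b x)) = \<ominus>\<^bsub>L\<^esub> \<alpha> (d 0 x)"
    using projective_lift[OF Pm(2) Qm(3) L ueQ \<alpha>d] by blast
  \<comment> \<open>The twisted differential squares to zero only if
    \<open>dQ \<circ> \<beta> = - \<beta> \<circ> d\<close>. Moving the sign into the differential
    makes \<open>\<beta>\<close> an ordinary chain map; the index is shifted because
    \<open>\<beta> i\<close> starts at \<open>P (Suc i)\<close>.\<close>
  let ?\<delta> = "\<lambda>i x. \<ominus>\<^bsub>P (Suc i)\<^esub> d (Suc i) x"
  have \<delta>: "module_map R (P (Suc (Suc i))) (P (Suc i)) (?\<delta> i)" for i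
    by (intro module_map_uminus Pm(3) Pm(4))
  have \<delta>\<delta>: "?\<delta> i (?\<delta> (Suc i) x) = \<zero>\<^bsub>P (Suc i)\<^esub>" if x: "x \<in> carrier (P (Suc (Suc (Suc i))))" for i x
  proof -
    interpret left_module R "P (Suc i)" by (rule Pm(3))
    show ?thesis
      using module_map_neg[OF Pm(3) Pm(3) Pm(4) module_map_closed[OF Pm(4) x]] resolves_complex[OF P x] by simp
  qed
  have exQ: "y \<in> dQ (Suc i) ` carrier (Q (Suc (Suc i)))" if "y \<in> carrier (Q (Suc i))" "dQ i y = \<zero>\<^bsub>Q i\<^esub>" for i y
    using resolves_exact[OF Q, of i] that by blast
  have bD: "b (?\<delta> 0 x) \<in> dQ 0 ` carrier (Q (Suc 0))" if x: "x \<in> carrier (P (Suc (Suc 0)))" for x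
  proof -
    interpret P0: left_module R "P 0" by (rule Pm(3))
    note \<delta>x = module_map_closed[OF \<delta> x]
    note bx = module_map_closed[OF b(1) \<delta>x]
    have "d 0 (?\<delta> 0 x) = \<zero>\<^bsub>P 0\<^esub>"
      using module_map_neg[OF Pm(3) Pm(3) Pm(4) module_map_closed[OF Pm(4) x]] resolves_complex[OF P x] by simp
    then have "u (eQ (b (?\<delta> 0 x))) = u \<zero>\<^bsub>K\<^esub>"
      using b(2)[OF \<delta>x] module_map_zero[OF Pm(3) L \<alpha>(1)] module_map_zero[OF K L u] by simp
    then have "eQ (b (?\<delta> 0 x)) = \<zero>\<^bsub>K\<^esub>" using u_eq module_map_closed[OF Qm(5) bx] by blast
    then show ?thesis using resolves_exact0[OF Q] bx by blast
  qed
  obtain \<beta> where \<beta>0: "\<beta> 0 = b" and \<beta>: "\<And>i. module_map R (P (Suc i)) (Q i) (\<beta> i)"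
    and \<beta>d: "\<And>i x. x \<in> carrier (P (Suc (Suc i))) \<Longrightarrow> dQ i (\<beta> (Suc i) x) = \<beta> i (?\<delta> i x)"
    using lift_chain[where P = "\<lambda>i. P (Suc i)" and \<delta> = ?\<delta> and Q = Q and D = dQ,
        OF Pm(2) \<delta> \<delta>\<delta> Qm(3) Qm(4) exQ b(1) bD] by blast
  have \<beta>n: "dQ i (\<beta> (Suc i) x) = \<ominus>\<^bsub>Q i\<^esub> \<beta> i (d (Suc i) x)" if x: "x \<in> carrier (P (Suc (Suc i)))" for i x
    using \<beta>d[OF x] module_map_neg[OF Pm(3) Qm(3) \<beta> module_map_closed[OF Pm(4) x]] by simp
  have \<beta>e: "u (eQ (\<beta> 0 x)) = \<ominus>\<^bsub>L\<^esub> \<alpha> (d 0 x)" if "x \<in> carrier (P (Suc 0))" for x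
    using b(2)[OF that] \<beta>0 by simp
  let ?H = "\<lambda>i. prod_module (Q i) (P i)"
  let ?dH = "\<lambda>i x. (dQ i (fst x) \<oplus>\<^bsub>Q i\<^esub> \<beta> i (snd x), d i (snd x))"
  let ?eH = "\<lambda>x. u (eQ (fst x)) \<oplus>\<^bsub>L\<^esub> \<alpha> (snd x)"
  have lH: "left_module R (?H i)" for i by (rule prod_left_module[OF Qm(3) Pm(3)])
  have dH: "module_map R (?H (Suc i)) (?H i) (?dH i)" for i
    by (intro module_map_Pair module_map_plus lH Qm(3) module_map_comp[OF module_map_fst Qm(4)]
        module_map_comp[OF module_map_snd \<beta>] module_map_comp[OF module_map_snd Pm(4)])
  have eH: "module_map R (?H 0) L ?eH"
    by (intro module_map_plus lH L module_map_comp[OF module_map_fst ueQ] module_map_comp[OF module_map_snd \<alpha>(1)])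
  have eH_surj: "?eH ` carrier (?H 0) = carrier L"
  proof
    show "?eH ` carrier (?H 0) \<subseteq> carrier L" using module_map_closed[OF eH] by auto
    show "carrier L \<subseteq> ?eH ` carrier (?H 0)"
    proof
      fix l assume l: "l \<in> carrier L"
      obtain x where x: "x \<in> carrier (P 0)" "p l = e x"
        using resolves_surj[OF P] module_map_closed[OF p l] by (metis imageE)
      note \<alpha>x = module_map_closed[OF \<alpha>(1) x(1)]
      have "l \<oplus>\<^bsub>L\<^esub> \<ominus>\<^bsub>L\<^esub> \<alpha> x \<in> (\<lambda>x. u (eQ x)) ` carrier (Q 0)"
        unfolding im using l \<alpha>x x \<alpha>(2)[OF x(1)] module_map_closed[OF p l]
        by (simp add: module_map_add[OF p] module_map_neg[OF L C p] C.M.r_neg)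
      then obtain q where q: "q \<in> carrier (Q 0)" "u (eQ q) = l \<oplus>\<^bsub>L\<^esub> \<ominus>\<^bsub>L\<^esub> \<alpha> x" by (metis imageE)
      show "l \<in> ?eH ` carrier (?H 0)"
        by (rule image_eqI[of _ _ "(q, x)"]) (use q x \<alpha>x l in \<open>simp_all add: L.M.a_assoc L.M.l_neg\<close>)
    qed
  qed
  have ex0: "?dH 0 ` carrier (?H (Suc 0)) = {x \<in> carrier (?H 0). ?eH x = \<zero>\<^bsub>L\<^esub>}"
  proof
    interpret Q0: left_module R "Q 0" by (rule Qm(3))
    show "?dH 0 ` carrier (?H (Suc 0)) \<subseteq> {x \<in> carrier (?H 0). ?eH x = \<zero>\<^bsub>L\<^esub>}"
    proof
      fix z assume "z \<in> ?dH 0 ` carrier (?H (Suc 0))"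
      then obtain y where y: "y \<in> carrier (?H (Suc 0))" "z = ?dH 0 y" by blast
      obtain q x where qx: "y = (q, x)" "q \<in> carrier (Q (Suc 0))" "x \<in> carrier (P (Suc 0))" using y(1) by auto
      note c = module_map_closed[OF Qm(4) qx(2)] module_map_closed[OF \<beta> qx(3)]
        module_map_closed[OF \<alpha>(1) module_map_closed[OF Pm(4) qx(3)]]
      have "u (eQ (dQ 0 q \<oplus>\<^bsub>Q 0\<^esub> \<beta> 0 x)) = u (eQ (dQ 0 q)) \<oplus>\<^bsub>L\<^esub> u (eQ (\<beta> 0 x))"
        by (rule module_map_add[OF ueQ c(1,2)])
      also have "\<dots> = \<ominus>\<^bsub>L\<^esub> \<alpha> (d 0 x)"
        using resolves_complex0[OF Q qx(2)] module_map_zero[OF K L u] \<beta>e[OF qx(3)] c(3) by simp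
      finally have "?eH z = \<zero>\<^bsub>L\<^esub>" using c(3) by (simp add: y(2) qx(1) L.M.l_neg)
      moreover have "z \<in> carrier (?H 0)" unfolding y(2) by (rule module_map_closed[OF dH y(1)])
      ultimately show "z \<in> {x \<in> carrier (?H 0). ?eH x = \<zero>\<^bsub>L\<^esub>}" by simp
    qed
    show "{x \<in> carrier (?H 0). ?eH x = \<zero>\<^bsub>L\<^esub>} \<subseteq> ?dH 0 ` carrier (?H (Suc 0))"
    proof
      fix z assume "z \<in> {x \<in> carrier (?H 0). ?eH x = \<zero>\<^bsub>L\<^esub>}"
      then obtain q x where qx: "z = (q, x)" "q \<in> carrier (Q 0)" "x \<in> carrier (P 0)"
        and 0: "u (eQ q) \<oplus>\<^bsub>L\<^esub> \<alpha> x = \<zero>\<^bsub>L\<^esub>" by auto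
      note \<alpha>x = module_map_closed[OF \<alpha>(1) qx(3)] and eq = module_map_closed[OF Qm(5) qx(2)]
      note ueq = module_map_closed[OF u eq]
      have "e x = p (u (eQ q) \<oplus>\<^bsub>L\<^esub> \<alpha> x)"
        using module_map_add[OF p ueq \<alpha>x] \<alpha>(2)[OF qx(3)] pu[OF eq] module_map_closed[OF Pm(5) qx(3)] by simp
      then have "e x = \<zero>\<^bsub>C\<^esub>" using 0 module_map_zero[OF L C p] by simp
      then obtain y where y: "y \<in> carrier (P (Suc 0))" "x = d 0 y"
        using resolves_exact0[OF P] qx(3) by blast
      note \<beta>y = module_map_closed[OF \<beta> y(1)]
      have "u (eQ q) = \<ominus>\<^bsub>L\<^esub> \<alpha> x" by (rule L.M.minus_equality[OF 0 \<alpha>x ueq, symmetric])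
      also have "\<dots> = u (eQ (\<beta> 0 y))" using \<beta>e[OF y(1)] y(2) by simp
      finally have "eQ q = eQ (\<beta> 0 y)" by (rule u_eq[OF eq module_map_closed[OF Qm(5) \<beta>y]])
      then have "eQ (q \<oplus>\<^bsub>Q 0\<^esub> \<ominus>\<^bsub>Q 0\<^esub> \<beta> 0 y) = \<zero>\<^bsub>K\<^esub>"
        using qx(2) \<beta>y eq by (simp add: module_map_add[OF Qm(5)] module_map_neg[OF Qm(3) Qm(1) Qm(5)] K.M.r_neg)
      then obtain q' where q': "q' \<in> carrier (Q (Suc 0))" "q \<oplus>\<^bsub>Q 0\<^esub> \<ominus>\<^bsub>Q 0\<^esub> \<beta> 0 y = dQ 0 q'"
        using resolves_exact0[OF Q] qx(2) \<beta>y by (metis (mono_tags, lifting) Q0.M.a_closed Q0.M.a_inv_closed imageE mem_Collect_eq)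
      have "q = dQ 0 q' \<oplus>\<^bsub>Q 0\<^esub> \<beta> 0 y"
        unfolding q'(2)[symmetric] using qx(2) \<beta>y by (simp add: Q0.M.a_assoc Q0.M.l_neg)
      then show "z \<in> ?dH 0 ` carrier (?H (Suc 0))"
        by (intro image_eqI[of _ _ "(q', y)"]) (use q' y qx in simp_all)
    qed
  qed
  have ex: "?dH (Suc i) ` carrier (?H (Suc (Suc i))) = {x \<in> carrier (?H (Suc i)). ?dH i x = \<zero>\<^bsub>?H i\<^esub>}" for i
  proof
    interpret Qi: left_module R "Q i" by (rule Qm(3))
    interpret QS: left_module R "Q (Suc i)" by (rule Qm(3))
    show "?dH (Suc i) ` carrier (?H (Suc (Suc i))) \<subseteq> {x \<in> carrier (?H (Suc i)). ?dH i x = \<zero>\<^bsub>?H i\<^esub>}"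
    proof
      fix z assume "z \<in> ?dH (Suc i) ` carrier (?H (Suc (Suc i)))"
      then obtain y where y: "y \<in> carrier (?H (Suc (Suc i)))" "z = ?dH (Suc i) y" by blast
      obtain q x where qx: "y = (q, x)" "q \<in> carrier (Q (Suc (Suc i)))" "x \<in> carrier (P (Suc (Suc i)))"
        using y(1) by auto
      note c = module_map_closed[OF Qm(4) qx(2)] module_map_closed[OF \<beta> qx(3)]
        module_map_closed[OF \<beta> module_map_closed[OF Pm(4) qx(3)]]
      have "dQ i (dQ (Suc i) q \<oplus>\<^bsub>Q (Suc i)\<^esub> \<beta> (Suc i) x) = dQ i (dQ (Suc i) q) \<oplus>\<^bsub>Q i\<^esub> dQ i (\<beta> (Suc i) x)"
        by (rule module_map_add[OF Qm(4) c(1,2)])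
      also have "\<dots> = \<ominus>\<^bsub>Q i\<^esub> \<beta> i (d (Suc i) x)"
        using resolves_complex[OF Q qx(2)] \<beta>n[OF qx(3)] c(3) by simp
      finally have "?dH i z = \<zero>\<^bsub>?H i\<^esub>"
        using c(3) resolves_complex[OF P qx(3)] by (simp add: y(2) qx(1) Qi.M.l_neg)
      moreover have "z \<in> carrier (?H (Suc i))" unfolding y(2) by (rule module_map_closed[OF dH y(1)])
      ultimately show "z \<in> {x \<in> carrier (?H (Suc i)). ?dH i x = \<zero>\<^bsub>?H i\<^esub>}" by simp
    qed
    show "{x \<in> carrier (?H (Suc i)). ?dH i x = \<zero>\<^bsub>?H i\<^esub>} \<subseteq> ?dH (Suc i) ` carrier (?H (Suc (Suc i)))"
    proof
      fix z assume "z \<in> {x \<in> carrier (?H (Suc i)). ?dH i x = \<zero>\<^bsub>?H i\<^esub>}"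
      then obtain q x where qx: "z = (q, x)" "q \<in> carrier (Q (Suc i))" "x \<in> carrier (P (Suc i))"
        and 0: "dQ i q \<oplus>\<^bsub>Q i\<^esub> \<beta> i x = \<zero>\<^bsub>Q i\<^esub>" and dx: "d i x = \<zero>\<^bsub>P i\<^esub>" by auto
      note \<beta>x = module_map_closed[OF \<beta> qx(3)] and eq = module_map_closed[OF Qm(4) qx(2)]
      obtain y where y: "y \<in> carrier (P (Suc (Suc i)))" "x = d (Suc i) y"
        using resolves_exact[OF P, of i] qx(3) dx by blast
      note \<beta>y = module_map_closed[OF \<beta> y(1)]
      have "dQ i q = \<ominus>\<^bsub>Q i\<^esub> \<beta> i x" by (rule Qi.M.minus_equality[OF 0 \<beta>x eq, symmetric])
      also have "\<dots> = dQ i (\<beta> (Suc i) y)" using \<beta>n[OF y(1)] y(2) by simp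
      finally have "dQ i (q \<oplus>\<^bsub>Q (Suc i)\<^esub> \<ominus>\<^bsub>Q (Suc i)\<^esub> \<beta> (Suc i) y) = \<zero>\<^bsub>Q i\<^esub>"
        using qx(2) \<beta>y module_map_closed[OF Qm(4) \<beta>y]
        by (simp add: module_map_add[OF Qm(4)] module_map_neg[OF Qm(3) Qm(3) Qm(4)] Qi.M.r_neg)
      then obtain q' where q': "q' \<in> carrier (Q (Suc (Suc i)))"
        "q \<oplus>\<^bsub>Q (Suc i)\<^esub> \<ominus>\<^bsub>Q (Suc i)\<^esub> \<beta> (Suc i) y = dQ (Suc i) q'"
        using exQ[of "q \<oplus>\<^bsub>Q (Suc i)\<^esub> \<ominus>\<^bsub>Q (Suc i)\<^esub> \<beta> (Suc i) y" i] qx(2) \<beta>y by auto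
      have "q = dQ (Suc i) q' \<oplus>\<^bsub>Q (Suc i)\<^esub> \<beta> (Suc i) y"
        unfolding q'(2)[symmetric] using qx(2) \<beta>y by (simp add: QS.M.a_assoc QS.M.l_neg)
      then show "z \<in> ?dH (Suc i) ` carrier (?H (Suc (Suc i)))"
        by (intro image_eqI[of _ _ "(q', y)"]) (use q' y qx in simp_all)
    qed
  qed
  have "resolves R L ?H ?dH ?eH"
    unfolding resolves_def
    by (intro conjI allI L prod_projective Qm(2) Pm(2) dH eH eH_surj ex0 ex)
  with \<alpha>(1) \<beta> \<beta>e \<beta>n show ?thesis by (rule that)
qed

text \<open>The long exact sequence made explicit. A cocycle on \<open>P\<close> is also one on the
  horseshoe resolution of \<open>L\<close>, where it is the coboundary of some \<open>w\<close>. The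
  component of \<open>w\<close> on \<open>Q\<close> is a cocycle; it is absorbed by the vanishing
  for \<open>K\<close> in positive degrees, and in degree 0 by extending maps from \<open>K\<close>
  to \<open>L\<close>.\<close>

lemma ext_vanishes_cokernel:
  assumes Q: "resolves R K Q dQ eQ" and N: "resolves R L N dN eN" and P: "resolves R C P d e"
    and M: "left_module R M"
    and vK: "ext_vanishes R Q dQ M" and vL: "ext_vanishes R N dN M"
    and extend: "\<And>f. module_map R K M f \<Longrightarrow> \<exists>g. module_map R L M g \<and> (\<forall>x\<in>carrier K. g (u x) = f x)"
  shows "ext_vanishes R P d M"
proof -
  interpret M: left_module R M by (rule M)
  note Pm = resolves_modules[OF P] resolves_maps[OF P]
  note Qm = resolves_modules[OF Q] resolves_maps[OF Q]
  obtain \<alpha> \<beta> where \<alpha>: "module_map R (P 0) L \<alpha>" and \<beta>: "\<And>i. module_map R (P (Suc i)) (Q i) (\<beta> i)"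
    and \<beta>e: "\<And>x. x \<in> carrier (P (Suc 0)) \<Longrightarrow> u (eQ (\<beta> 0 x)) = \<ominus>\<^bsub>L\<^esub> \<alpha> (d 0 x)"
    and \<beta>d: "\<And>i x. x \<in> carrier (P (Suc (Suc i))) \<Longrightarrow> dQ i (\<beta> (Suc i) x) = \<ominus>\<^bsub>Q i\<^esub> \<beta> i (d (Suc i) x)"
    and H: "resolves R L (\<lambda>i. prod_module (Q i) (P i))
       (\<lambda>i x. (dQ i (fst x) \<oplus>\<^bsub>Q i\<^esub> \<beta> i (snd x), d i (snd x))) (\<lambda>x. u (eQ (fst x)) \<oplus>\<^bsub>L\<^esub> \<alpha> (snd x))"
    by (rule horseshoe[OF Q P]) (rule that)
  let ?H = "\<lambda>i. prod_module (Q i) (P i)"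
  let ?dH = "\<lambda>i x. (dQ i (fst x) \<oplus>\<^bsub>Q i\<^esub> \<beta> i (snd x), d i (snd x))"
  have vH: "ext_vanishes R ?H ?dH M"
    by (rule ext_vanishes_retract[OF H N M retract_refl vL])
  show ?thesis unfolding ext_vanishes_def
  proof (intro allI impI)
    fix n z assume z: "module_map R (P (Suc n)) M z"
      and zd: "\<forall>x\<in>carrier (P (Suc (Suc n))). z (d (Suc n) x) = \<zero>\<^bsub>M\<^esub>"
    interpret Pn: left_module R "P n" by (rule Pm(3))
    interpret PS: left_module R "P (Suc n)" by (rule Pm(3))
    interpret Qn: left_module R "Q n" by (rule Qm(3))
    interpret QS: left_module R "Q (Suc n)" by (rule Qm(3))
    have "\<exists>w. module_map R (?H n) M w \<and> (\<forall>x\<in>carrier (?H (Suc n)). z (snd x) = w (?dH n x))"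
      by (rule ext_vanishesD[OF vH module_map_comp[OF module_map_snd z]]) (use zd in auto)
    then obtain w where w: "module_map R (?H n) M w"
      and zw: "\<And>q x. q \<in> carrier (Q (Suc n)) \<Longrightarrow> x \<in> carrier (P (Suc n)) \<Longrightarrow>
        z x = w (dQ n q \<oplus>\<^bsub>Q n\<^esub> \<beta> n x, d n x)" by auto
    define a where "a q = w (q, \<zero>\<^bsub>P n\<^esub>)" for q
    define b where "b x = w (\<zero>\<^bsub>Q n\<^esub>, x)" for x
    have a: "module_map R (Q n) M a" unfolding a_def
      by (rule module_map_comp[OF module_map_Pair[OF module_map_id module_map_const_zero[OF Pm(3)]] w])
    have b: "module_map R (P n) M b" unfolding b_def
      by (rule module_map_comp[OF module_map_Pair[OF module_map_const_zero[OF Qm(3)] module_map_id] w])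
    \<comment> \<open>Setting the \<open>P\<close>-coordinate to zero in \<open>zw\<close> shows
      that \<open>a\<close> is a cocycle on \<open>Q\<close>.\<close>
    have ad: "a (dQ n q) = \<zero>\<^bsub>M\<^esub>" if q: "q \<in> carrier (Q (Suc n))" for q
    proof -
      have "a (dQ n q) = z \<zero>\<^bsub>P (Suc n)\<^esub>"
        using zw[OF q PS.M.zero_closed] module_map_zero[OF Pm(3) Qm(3) \<beta>]
          module_map_zero[OF Pm(3) Pm(3) Pm(4)] module_map_closed[OF Qm(4) q] by (simp add: a_def)
      then show ?thesis by (simp add: module_map_zero[OF Pm(3) M z])
    qed
    have zab: "z x = a (\<beta> n x) \<oplus>\<^bsub>M\<^esub> b (d n x)" if x: "x \<in> carrier (P (Suc n))" for x
    proof -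
      note c = module_map_closed[OF \<beta> x] module_map_closed[OF Pm(4) x]
      have "z x = w (\<beta> n x, d n x)"
        using zw[OF QS.M.zero_closed x] module_map_zero[OF Qm(3) Qm(3) Qm(4)] c by simp
      also have "\<dots> = w ((\<beta> n x, \<zero>\<^bsub>P n\<^esub>) \<oplus>\<^bsub>?H n\<^esub> (\<zero>\<^bsub>Q n\<^esub>, d n x))" using c by simp
      also have "\<dots> = a (\<beta> n x) \<oplus>\<^bsub>M\<^esub> b (d n x)"
        unfolding a_def b_def by (rule module_map_add[OF w]) (use c in simp_all)
      finally show ?thesis .
    qed
    \<comment> \<open>For \<open>n = 0\<close> the cocycle \<open>a\<close> descends to
      \<open>K\<close>, extends to \<open>L\<close> and is pulled back along
      \<open>\<alpha>\<close>; for \<open>n > 0\<close> it is a coboundary on \<open>Q\<close>, and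
      its primitive is pulled back along \<open>\<beta>\<close>. The signs are those of the
      horseshoe.\<close>
    have "\<exists>g. module_map R (P n) M g \<and> (\<forall>x\<in>carrier (P (Suc n)). a (\<beta> n x) = \<ominus>\<^bsub>M\<^esub> g (d n x))"
    proof (cases n)
      case 0
      have a0: "module_map R (Q 0) M a" using a 0 by simp
      have ker: "a q = \<zero>\<^bsub>M\<^esub>" if "q \<in> carrier (Q 0)" "eQ q = \<zero>\<^bsub>K\<^esub>" for q
      proof -
        have "q \<in> dQ 0 ` carrier (Q (Suc 0))" unfolding resolves_exact0[OF Q] using that by simp
        then obtain q' where "q' \<in> carrier (Q (Suc 0))" "q = dQ 0 q'" by (elim imageE)
        then show ?thesis using ad 0 by simp
      qed
      obtain f where f: "module_map R K M f" "\<And>q. q \<in> carrier (Q 0) \<Longrightarrow> f (eQ q) = a q"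
        using factor_through_surj[OF Qm(3) K M Qm(5) a0 resolves_surj[OF Q] ker] by auto
      obtain g where g: "module_map R L M g" "\<forall>x\<in>carrier K. g (u x) = f x" using extend[OF f(1)] by (elim exE conjE)
      have "a (\<beta> 0 x) = \<ominus>\<^bsub>M\<^esub> g (\<alpha> (d 0 x))" if x: "x \<in> carrier (P (Suc 0))" for x
      proof -
        have c: "\<beta> 0 x \<in> carrier (Q 0)" "\<alpha> (d 0 x) \<in> carrier L"
          by (rule module_map_closed[OF \<beta> x], rule module_map_closed[OF \<alpha> module_map_closed[OF Pm(4) x]])
        have "a (\<beta> 0 x) = g (u (eQ (\<beta> 0 x)))"
          using f(2)[OF c(1)] g(2) module_map_closed[OF Qm(5) c(1)] by simp
        then show ?thesis using \<beta>e[OF x] module_map_neg[OF L M g(1) c(2)] by simp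
      qed
      then show ?thesis using module_map_comp[OF \<alpha> g(1)] 0 by (intro exI[of _ "\<lambda>x. g (\<alpha> x)"]) auto
    next
      case (Suc m)
      have "\<exists>v. module_map R (Q m) M v \<and> (\<forall>x\<in>carrier (Q (Suc m)). a x = v (dQ m x))"
        by (rule ext_vanishesD[OF vK]) (use a ad Suc in auto)
      then obtain v where v: "module_map R (Q m) M v" "\<forall>x\<in>carrier (Q (Suc m)). a x = v (dQ m x)"
        by (elim exE conjE)
      have "a (\<beta> n x) = \<ominus>\<^bsub>M\<^esub> v (\<beta> m (d n x))" if x: "x \<in> carrier (P (Suc n))" for x
      proof -
        have x': "x \<in> carrier (P (Suc (Suc m)))" using x Suc by simp
        have "a (\<beta> (Suc m) x) = v (dQ m (\<beta> (Suc m) x))" using v(2) module_map_closed[OF \<beta> x'] by simp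
        also have "\<dots> = \<ominus>\<^bsub>M\<^esub> v (\<beta> m (d (Suc m) x))"
          using \<beta>d[OF x'] module_map_neg[OF Qm(3) M v(1) module_map_closed[OF \<beta> module_map_closed[OF Pm(4) x']]]
          by simp
        finally show ?thesis using Suc by simp
      qed
      then show ?thesis using module_map_comp[OF \<beta> v(1)] Suc by (intro exI[of _ "\<lambda>x. v (\<beta> m x)"]) auto
    qed
    then obtain g where g: "module_map R (P n) M g"
      "\<forall>x\<in>carrier (P (Suc n)). a (\<beta> n x) = \<ominus>\<^bsub>M\<^esub> g (d n x)" by (elim exE conjE)
    have "z x = b (d n x) \<ominus>\<^bsub>M\<^esub> g (d n x)" if x: "x \<in> carrier (P (Suc n))" for x
    proof -
      note dx = module_map_closed[OF Pm(4) x]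
      show ?thesis
        using zab[OF x] g(2) x module_map_closed[OF g(1) dx] module_map_closed[OF b dx]
        by (simp add: a_minus_def M.M.a_comm)
    qed
    then show "\<exists>w. module_map R (P n) M w \<and> (\<forall>x\<in>carrier (P (Suc n)). z x = w (d n x))"
      by (intro exI[of _ "\<lambda>x. b x \<ominus>\<^bsub>M\<^esub> g x"] conjI module_map_minus[OF Pm(3) M b g(1)]) simp
  qed
qed

end

text \<open>This moves a module into the type over which the hypothesis on perpendicular classes
  ranges. Mutual retracts are all that the comparison of Ext needs from the copy.\<close>

lemma module_copy:
  fixes M :: "('r, 'm) module" and g :: "'m \<Rightarrow> 'x"
  assumes M: "left_module R M" and g: "inj g"
  obtains N :: "('r, 'x) module" where "left_module R N" "retract R M N" "retract R N M"
proof -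
  interpret left_module R M by fact
  define N where "N = mk_module (g ` carrier M) (g \<zero>\<^bsub>M\<^esub>) (\<lambda>x y. g (inv_into UNIV g x \<oplus>\<^bsub>M\<^esub> inv_into UNIV g y))
      (\<lambda>r x. g (r \<odot>\<^bsub>M\<^esub> inv_into UNIV g x))"
  have [simp]: "inv_into UNIV g (g x) = x" for x using g by simp
  have "abelian_group N"
  proof (rule abelian_groupI)
    fix x assume "x \<in> carrier N"
    then obtain a where "a \<in> carrier M" "x = g a" by (auto simp: N_def)
    then show "\<exists>y\<in>carrier N. y \<oplus>\<^bsub>N\<^esub> x = \<zero>\<^bsub>N\<^esub>"
      by (intro bexI[of _ "g (\<ominus>\<^bsub>M\<^esub> a)"]) (auto simp: N_def M.l_neg)
  qed (auto simp: N_def M.a_ac)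
  then have N: "left_module R N"
    unfolding left_module_def left_module_axioms_def
    by (auto simp: N_def R.ring_axioms smult_l_distr smult_r_distr smult_assoc1)
  have "module_map R M N g" "module_map R N M (inv_into UNIV g)" by (auto simp: module_map_def N_def)
  moreover have "\<forall>x\<in>carrier N. g (inv_into UNIV g x) = x" by (auto simp: N_def)
  ultimately have "retract R M N" "retract R N M" unfolding retract_def by fastforce+
  with N show ?thesis by (rule that)
qed

lemma resolution_exists:
  fixes X :: "('r, 'x) module"
  assumes "left_module R X"
  obtains P :: "nat \<Rightarrow> ('r, ('r, 'x) res_carrier) module" and d e where "resolves R X P d e"
  using projective_resolution_exists[OF assms] projective_resolution_resolves[OF assms] by blast

text \<open>The inclusion of perpendicular classes speaks about carriers in \<open>'x\<close> and
  about \<open>Ext\<close>. Copying \<open>X\<close> along \<open>g\<close> and changing resolutions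
  makes it available for every \<open>X\<close> whose carrier type embeds in \<open>'x\<close>, and
  on every resolution.\<close>

lemma left_perp_ext_vanishes:
  fixes T :: "('r, 't) module" and V :: "('r, 'v) module" and X :: "('r, 'm) module" and g :: "'m \<Rightarrow> 'x"
  assumes perp: "(left_perp R T :: ('r, 'x) module set) \<subseteq> left_perp R V"
    and T: "left_module R T" and V: "left_module R V" and g: "inj g"
    and P: "resolves R X P d e" and van: "ext_vanishes R P d T"
  shows "ext_vanishes R P d V"
proof -
  obtain N :: "('r, 'x) module" where N: "left_module R N" "retract R X N" "retract R N X"
    by (rule module_copy[OF resolves_modules(1)[OF P] g])
  obtain Q :: "nat \<Rightarrow> ('r, ('r, 'x) res_carrier) module" and dQ eQ where Q: "resolves R N Q dQ eQ"
    by (rule resolution_exists[OF N(1)])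
  have "ext_vanishes R Q dQ T" by (rule ext_vanishes_retract[OF Q P T N(3) van])
  then have "N \<in> left_perp R T" unfolding left_perp_def using ext_trivial_iff[OF Q T] N(1) by blast
  then have "N \<in> left_perp R V" using perp by blast
  then have "ext_vanishes R Q dQ V" unfolding left_perp_def using ext_trivial_iff[OF Q V] by blast
  then show ?thesis by (rule ext_vanishes_retract[OF P Q V N(2)])
qed

section \<open>Frobenius systems and induced modules\<close>

lemma restrict_scalars_simps [simp]:
  "carrier (restrict_scalars \<iota> M) = carrier M" "\<zero>\<^bsub>restrict_scalars \<iota> M\<^esub> = \<zero>\<^bsub>M\<^esub>"
  "x \<oplus>\<^bsub>restrict_scalars \<iota> M\<^esub> y = x \<oplus>\<^bsub>M\<^esub> y" "r \<odot>\<^bsub>restrict_scalars \<iota> M\<^esub> x = \<iota> r \<odot>\<^bsub>M\<^esub> x"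
  by (simp_all add: restrict_scalars_def)

lemma restrict_scalars_left_module:
  assumes \<iota>: "ring_extension R A \<iota>" and M: "left_module A M"
  shows "left_module R (restrict_scalars \<iota> M)"
proof -
  interpret M: left_module A M by fact
  have R: "ring R" and h: "\<iota> \<in> ring_hom R A" using \<iota> by (auto simp: ring_extension_def)
  note hc = ring_hom_closed[OF h]
  have "abelian_group (restrict_scalars \<iota> M)"
  proof (rule abelian_groupI)
    fix x assume "x \<in> carrier (restrict_scalars \<iota> M)"
    then show "\<exists>y\<in>carrier (restrict_scalars \<iota> M). y \<oplus>\<^bsub>restrict_scalars \<iota> M\<^esub> x = \<zero>\<^bsub>restrict_scalars \<iota> M\<^esub>"
      by (intro bexI[of _ "\<ominus>\<^bsub>M\<^esub> x"]) (auto simp: M.M.l_neg)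
  qed (auto simp: M.M.a_assoc intro: M.M.a_comm)
  then show ?thesis
    unfolding left_module_def left_module_axioms_def
    by (auto simp: R hc M.smult_l_distr M.smult_r_distr M.smult_assoc1
        ring_hom_add[OF h] ring_hom_mult[OF h] ring_hom_one[OF h])
qed

lemma restrict_scalars_module_map:
  assumes "ring_extension R A \<iota>" "module_map A M N f"
  shows "module_map R (restrict_scalars \<iota> M) (restrict_scalars \<iota> N) f"
  using assms ring_hom_closed[of \<iota> R A] by (auto simp: ring_extension_def module_map_def)

lemma finsum_submodule:
  fixes M :: "('r, 'm) module"
  assumes M: "left_module R M" and K: "submodule K R M" and f: "\<And>i. i \<in> S \<Longrightarrow> f i \<in> K"
  shows "finsum (M\<lparr>carrier := K\<rparr>) f S = finsum M f S"
proof -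
  have "module_map R (M\<lparr>carrier := K\<rparr>) M (\<lambda>x. x)"
    using subgroup.subset[OF submodule.axioms(1)[OF K]] by (auto simp: module_map_def)
  from module_map_finsum[OF left_module_submodule[OF M K] M this, of S f] f show ?thesis by simp
qed

lemma finsum_regular_module:
  assumes A: "ring A" and f: "\<And>i. i \<in> S \<Longrightarrow> f i \<in> carrier A"
  shows "finsum (regular_module A) f S = finsum A f S"
proof -
  interpret A: ring A by fact
  interpret reg: left_module A "regular_module A" by (rule regular_left_module[OF A])
  show ?thesis
    by (rule additive_finsum[where h = "\<lambda>x. x", OF reg.M.abelian_group_axioms A.abelian_group_axioms])
       (use f in simp_all)
qed

text \<open>
  \<open>(E, b, y)\<close> is a Frobenius system: \<open>E\<close> is the Frobenius homomorphism and \<open>b\<close>, \<open>y\<close> are dual bases.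
\<close>

locale frobenius_system =
  fixes R :: "('r, 'k) ring_scheme" and A :: "('a, 'l) ring_scheme" and \<iota> :: "'r \<Rightarrow> 'a"
    and E :: "'a \<Rightarrow> 'r" and I :: "'i set" and b y :: "'i \<Rightarrow> 'a"
  assumes extension: "ring_extension R A \<iota>" and finite_I: "finite I"
    and E_closed: "a \<in> carrier A \<Longrightarrow> E a \<in> carrier R"
    and E_add: "a \<in> carrier A \<Longrightarrow> c \<in> carrier A \<Longrightarrow> E (a \<oplus>\<^bsub>A\<^esub> c) = E a \<oplus>\<^bsub>R\<^esub> E c"
    and E_left: "r \<in> carrier R \<Longrightarrow> a \<in> carrier A \<Longrightarrow> E (\<iota> r \<otimes>\<^bsub>A\<^esub> a) = r \<otimes>\<^bsub>R\<^esub> E a"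
    and E_right: "r \<in> carrier R \<Longrightarrow> a \<in> carrier A \<Longrightarrow> E (a \<otimes>\<^bsub>A\<^esub> \<iota> r) = E a \<otimes>\<^bsub>R\<^esub> r"
    and b_closed: "i \<in> I \<Longrightarrow> b i \<in> carrier A" and y_closed: "i \<in> I \<Longrightarrow> y i \<in> carrier A"
    and dual_left: "a \<in> carrier A \<Longrightarrow> finsum A (\<lambda>i. \<iota> (E (a \<otimes>\<^bsub>A\<^esub> b i)) \<otimes>\<^bsub>A\<^esub> y i) I = a"
    and dual_right: "a \<in> carrier A \<Longrightarrow> finsum A (\<lambda>i. b i \<otimes>\<^bsub>A\<^esub> \<iota> (E (y i \<otimes>\<^bsub>A\<^esub> a))) I = a"
begin

lemma rings: "ring R" "ring A" and iota: "\<iota> \<in> ring_hom R A"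
  using extension by (auto simp: ring_extension_def)

sublocale R: ring R by (rule rings)
sublocale A: ring A by (rule rings)

lemmas iota_closed [simp] = ring_hom_closed[OF iota]

declare E_closed [simp] b_closed [simp] y_closed [simp]

text \<open>
  The relation \<open>N \<cong> A \<otimes>\<^sub>R M\<close>, where \<open>\<eta> m = 1 \<otimes> m\<close> and \<open>\<epsilon> (a \<otimes> m) = E a m\<close>. It leaves the choice of
  the carrier of \<open>N\<close> free, which makes it possible to respect the carrier types that are prescribed
  in the definition of Wakamatsu tilting modules.
\<close>

definition induced :: "('r, 'm) module \<Rightarrow> ('a, 'n) module \<Rightarrow> ('m \<Rightarrow> 'n) \<Rightarrow> ('n \<Rightarrow> 'm) \<Rightarrow> bool" where
  "induced M N \<eta> \<epsilon> \<longleftrightarrow> left_module R M \<and> left_module A N \<and>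
     module_map R M (restrict_scalars \<iota> N) \<eta> \<and> module_map R (restrict_scalars \<iota> N) M \<epsilon> \<and>
     (\<forall>a\<in>carrier A. \<forall>m\<in>carrier M. \<epsilon> (a \<odot>\<^bsub>N\<^esub> \<eta> m) = E a \<odot>\<^bsub>M\<^esub> m) \<and>
     (\<forall>x\<in>carrier N. finsum N (\<lambda>i. b i \<odot>\<^bsub>N\<^esub> \<eta> (\<epsilon> (y i \<odot>\<^bsub>N\<^esub> x))) I = x)"

text \<open>The transpose of \<open>g\<close> under the adjunction between extension and restriction
  of scalars. The formula is forced by the expansion of \<open>x\<close> as the sum of the
  \<open>b i \<odot> \<eta> (\<epsilon> (y i \<odot> x))\<close>.\<close>

definition induced_lift :: "('a, 'n) module \<Rightarrow> ('n \<Rightarrow> 'm) \<Rightarrow> ('a, 'p) module \<Rightarrow> ('m \<Rightarrow> 'p) \<Rightarrow> 'n \<Rightarrow> 'p" where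
  "induced_lift N \<epsilon> L g x = finsum L (\<lambda>i. b i \<odot>\<^bsub>L\<^esub> g (\<epsilon> (y i \<odot>\<^bsub>N\<^esub> x))) I"

context
  fixes M :: "('r, 'm) module" and N :: "('a, 'n) module" and \<eta> \<epsilon>
  assumes ind: "induced M N \<eta> \<epsilon>"
begin

lemma induced_modules: "left_module R M" "left_module A N" "left_module R (restrict_scalars \<iota> N)"
  and induced_maps: "module_map R M (restrict_scalars \<iota> N) \<eta>" "module_map R (restrict_scalars \<iota> N) M \<epsilon>"
  and induced_counit: "a \<in> carrier A \<Longrightarrow> m \<in> carrier M \<Longrightarrow> \<epsilon> (a \<odot>\<^bsub>N\<^esub> \<eta> m) = E a \<odot>\<^bsub>M\<^esub> m"
  and induced_expand: "x \<in> carrier N \<Longrightarrow> finsum N (\<lambda>i. b i \<odot>\<^bsub>N\<^esub> \<eta> (\<epsilon> (y i \<odot>\<^bsub>N\<^esub> x))) I = x"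
  using ind restrict_scalars_left_module[OF extension] by (auto simp: induced_def)

interpretation M: left_module R M by (rule induced_modules)
interpretation N: left_module A N by (rule induced_modules)

lemma eta_closed [simp]: "m \<in> carrier M \<Longrightarrow> \<eta> m \<in> carrier N"
  using module_map_closed[OF induced_maps(1)] by simp

lemma eps_closed [simp]: "x \<in> carrier N \<Longrightarrow> \<epsilon> x \<in> carrier M"
  using module_map_closed[OF induced_maps(2)] by simp

lemma eps_finsum:
  assumes "\<And>i. i \<in> S \<Longrightarrow> f i \<in> carrier N"
  shows "\<epsilon> (finsum N f S) = finsum M (\<lambda>i. \<epsilon> (f i)) S"
  by (rule additive_finsum)
     (use assms module_map_add[OF induced_maps(2)] in
       \<open>auto simp: M.M.abelian_group_axioms N.M.abelian_group_axioms\<close>)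

text \<open>\<open>\<epsilon>\<close> is linear over \<open>R\<close> only. Expanding
  \<open>x\<close> and using \<open>\<epsilon> (a \<odot> \<eta> m) = E a \<odot> m\<close> shows
  how a scalar from \<open>A\<close> acts in terms of the finitely many coordinates
  \<open>\<epsilon> (y j \<odot> x)\<close>.\<close>

lemma eps_smult:
  assumes a: "a \<in> carrier A" and x: "x \<in> carrier N"
  shows "\<epsilon> (a \<odot>\<^bsub>N\<^esub> x) = finsum M (\<lambda>j. E (a \<otimes>\<^bsub>A\<^esub> b j) \<odot>\<^bsub>M\<^esub> \<epsilon> (y j \<odot>\<^bsub>N\<^esub> x)) I"
proof -
  have "\<epsilon> (a \<odot>\<^bsub>N\<^esub> x) = \<epsilon> (a \<odot>\<^bsub>N\<^esub> finsum N (\<lambda>j. b j \<odot>\<^bsub>N\<^esub> \<eta> (\<epsilon> (y j \<odot>\<^bsub>N\<^esub> x))) I)"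
    by (simp add: induced_expand[OF x])
  also have "a \<odot>\<^bsub>N\<^esub> finsum N (\<lambda>j. b j \<odot>\<^bsub>N\<^esub> \<eta> (\<epsilon> (y j \<odot>\<^bsub>N\<^esub> x))) I
      = finsum N (\<lambda>j. a \<odot>\<^bsub>N\<^esub> (b j \<odot>\<^bsub>N\<^esub> \<eta> (\<epsilon> (y j \<odot>\<^bsub>N\<^esub> x)))) I"
    by (rule N.finsum_smult_ldistr[OF a]) (simp add: x)
  also have "\<epsilon> \<dots> = finsum M (\<lambda>j. \<epsilon> (a \<odot>\<^bsub>N\<^esub> (b j \<odot>\<^bsub>N\<^esub> \<eta> (\<epsilon> (y j \<odot>\<^bsub>N\<^esub> x))))) I"
    by (rule eps_finsum) (simp add: a x)
  also have "\<dots> = finsum M (\<lambda>j. E (a \<otimes>\<^bsub>A\<^esub> b j) \<odot>\<^bsub>M\<^esub> \<epsilon> (y j \<odot>\<^bsub>N\<^esub> x)) I"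
    by (rule M.M.finsum_cong')
       (use a x in \<open>auto simp: N.smult_assoc1[symmetric] induced_counit\<close>)
  finally show ?thesis .
qed

text \<open>By the expansion, \<open>x\<close> is determined by its coordinates
  \<open>\<epsilon> (y i \<odot> x)\<close>.\<close>

lemma induced_zero_iff:
  assumes x: "x \<in> carrier N" and z: "\<And>i. i \<in> I \<Longrightarrow> \<epsilon> (y i \<odot>\<^bsub>N\<^esub> x) = \<zero>\<^bsub>M\<^esub>"
  shows "x = \<zero>\<^bsub>N\<^esub>"
proof -
  have "x = finsum N (\<lambda>i. b i \<odot>\<^bsub>N\<^esub> \<eta> (\<epsilon> (y i \<odot>\<^bsub>N\<^esub> x))) I" by (simp add: induced_expand[OF x])
  also have "\<dots> = finsum N (\<lambda>i. \<zero>\<^bsub>N\<^esub>) I"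
    by (rule N.M.finsum_cong')
       (use z module_map_zero[OF induced_modules(1,3) induced_maps(1)] in auto)
  finally show ?thesis by simp
qed

context
  fixes L :: "('a, 'p) module" and g
  assumes L: "left_module A L" and g: "module_map R M (restrict_scalars \<iota> L) g"
begin

interpretation L: left_module A L by (rule L)

lemma lift_g_closed [simp]: "m \<in> carrier M \<Longrightarrow> g m \<in> carrier L"
  using module_map_closed[OF g] by simp

lemma lift_g_smult: "r \<in> carrier R \<Longrightarrow> m \<in> carrier M \<Longrightarrow> g (r \<odot>\<^bsub>M\<^esub> m) = \<iota> r \<odot>\<^bsub>L\<^esub> g m"
  using module_map_smult[OF g] by simp

lemma lift_g_finsum:
  assumes "\<And>i. i \<in> S \<Longrightarrow> f i \<in> carrier M"
  shows "g (finsum M f S) = finsum L (\<lambda>i. g (f i)) S"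
  by (rule additive_finsum)
     (use assms module_map_add[OF g] in
       \<open>auto simp: M.M.abelian_group_axioms L.M.abelian_group_axioms\<close>)

text \<open>The formula for the lift shows additivity but not linearity over \<open>A\<close>. After
  an exchange of sums, moving \<open>a\<close> to the front is the identity
  \<open>dual_right\<close> for the element \<open>a \<otimes> b j\<close>.\<close>

lemma induced_lift_smult:
  assumes a: "a \<in> carrier A" and x: "x \<in> carrier N"
  shows "induced_lift N \<epsilon> L g (a \<odot>\<^bsub>N\<^esub> x) = a \<odot>\<^bsub>L\<^esub> induced_lift N \<epsilon> L g x"
proof -
  define c where "c j = g (\<epsilon> (y j \<odot>\<^bsub>N\<^esub> x))" for j
  have c: "c j \<in> carrier L" if "j \<in> I" for j using that x by (simp add: c_def)
  define e where "e i j = E (y i \<otimes>\<^bsub>A\<^esub> (a \<otimes>\<^bsub>A\<^esub> b j))" for i j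
  have e: "e i j \<in> carrier R" if "i \<in> I" "j \<in> I" for i j using that a by (simp add: e_def)
  have "b i \<odot>\<^bsub>L\<^esub> g (\<epsilon> (y i \<odot>\<^bsub>N\<^esub> (a \<odot>\<^bsub>N\<^esub> x))) = finsum L (\<lambda>j. (b i \<otimes>\<^bsub>A\<^esub> \<iota> (e i j)) \<odot>\<^bsub>L\<^esub> c j) I"
    if i: "i \<in> I" for i
  proof -
    have "\<epsilon> (y i \<odot>\<^bsub>N\<^esub> (a \<odot>\<^bsub>N\<^esub> x)) = \<epsilon> ((y i \<otimes>\<^bsub>A\<^esub> a) \<odot>\<^bsub>N\<^esub> x)"
      using i a x by (simp add: N.smult_assoc1)
    also have "\<dots> = finsum M (\<lambda>j. E (y i \<otimes>\<^bsub>A\<^esub> a \<otimes>\<^bsub>A\<^esub> b j) \<odot>\<^bsub>M\<^esub> \<epsilon> (y j \<odot>\<^bsub>N\<^esub> x)) I"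
      by (rule eps_smult) (use i a x in simp_all)
    also have "\<dots> = finsum M (\<lambda>j. e i j \<odot>\<^bsub>M\<^esub> \<epsilon> (y j \<odot>\<^bsub>N\<^esub> x)) I"
      by (rule M.M.finsum_cong') (use i a x in \<open>auto simp: e_def A.m_assoc\<close>)
    also have "g \<dots> = finsum L (\<lambda>j. g (e i j \<odot>\<^bsub>M\<^esub> \<epsilon> (y j \<odot>\<^bsub>N\<^esub> x))) I"
      by (rule lift_g_finsum) (use i e x in auto)
    also have "\<dots> = finsum L (\<lambda>j. \<iota> (e i j) \<odot>\<^bsub>L\<^esub> c j) I"
      by (rule L.M.finsum_cong') (use i e x in \<open>auto simp: c_def lift_g_smult\<close>)
    also have "b i \<odot>\<^bsub>L\<^esub> \<dots> = finsum L (\<lambda>j. b i \<odot>\<^bsub>L\<^esub> (\<iota> (e i j) \<odot>\<^bsub>L\<^esub> c j)) I"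
      by (rule L.finsum_smult_ldistr) (use i e c in auto)
    also have "\<dots> = finsum L (\<lambda>j. (b i \<otimes>\<^bsub>A\<^esub> \<iota> (e i j)) \<odot>\<^bsub>L\<^esub> c j) I"
      by (rule L.M.finsum_cong') (use i e c in \<open>auto simp: L.smult_assoc1\<close>)
    finally show ?thesis .
  qed
  then have "induced_lift N \<epsilon> L g (a \<odot>\<^bsub>N\<^esub> x)
      = finsum L (\<lambda>i. finsum L (\<lambda>j. (b i \<otimes>\<^bsub>A\<^esub> \<iota> (e i j)) \<odot>\<^bsub>L\<^esub> c j) I) I"
    unfolding induced_lift_def by (intro L.M.finsum_cong') (use e c in auto)
  also have "\<dots> = finsum L (\<lambda>j. finsum L (\<lambda>i. (b i \<otimes>\<^bsub>A\<^esub> \<iota> (e i j)) \<odot>\<^bsub>L\<^esub> c j) I) I"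
    by (rule L.M.finsum_swap) (use finite_I e c in auto)
  also have "\<dots> = finsum L (\<lambda>j. a \<odot>\<^bsub>L\<^esub> (b j \<odot>\<^bsub>L\<^esub> c j)) I"
  proof (rule L.M.finsum_cong')
    fix j assume j: "j \<in> I"
    have "finsum L (\<lambda>i. (b i \<otimes>\<^bsub>A\<^esub> \<iota> (e i j)) \<odot>\<^bsub>L\<^esub> c j) I
        = finsum A (\<lambda>i. b i \<otimes>\<^bsub>A\<^esub> \<iota> (e i j)) I \<odot>\<^bsub>L\<^esub> c j"
      by (rule L.finsum_smult_rdistr[symmetric]) (use j e c in auto)
    also have "finsum A (\<lambda>i. b i \<otimes>\<^bsub>A\<^esub> \<iota> (e i j)) I = a \<otimes>\<^bsub>A\<^esub> b j"
      unfolding e_def by (rule dual_right) (use j a in simp)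
    finally show "finsum L (\<lambda>i. (b i \<otimes>\<^bsub>A\<^esub> \<iota> (e i j)) \<odot>\<^bsub>L\<^esub> c j) I = a \<odot>\<^bsub>L\<^esub> (b j \<odot>\<^bsub>L\<^esub> c j)"
      using j a c by (simp add: L.smult_assoc1)
  qed (use a c in auto)
  also have "\<dots> = a \<odot>\<^bsub>L\<^esub> induced_lift N \<epsilon> L g x"
    unfolding induced_lift_def c_def[symmetric] by (rule L.finsum_smult_ldistr[symmetric]) (use a c in auto)
  finally show ?thesis .
qed

lemma induced_lift_map: "module_map A N L (induced_lift N \<epsilon> L g)"
proof (rule module_mapI)
  fix x assume x: "x \<in> carrier N"
  show "induced_lift N \<epsilon> L g x \<in> carrier L" unfolding induced_lift_def using x by (intro L.M.finsum_closed) auto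
  show "induced_lift N \<epsilon> L g (a \<odot>\<^bsub>N\<^esub> x) = a \<odot>\<^bsub>L\<^esub> induced_lift N \<epsilon> L g x" if "a \<in> carrier A" for a
    by (rule induced_lift_smult[OF that x])
  fix z assume z: "z \<in> carrier N"
  have "induced_lift N \<epsilon> L g (x \<oplus>\<^bsub>N\<^esub> z)
      = finsum L (\<lambda>i. b i \<odot>\<^bsub>L\<^esub> g (\<epsilon> (y i \<odot>\<^bsub>N\<^esub> x)) \<oplus>\<^bsub>L\<^esub> b i \<odot>\<^bsub>L\<^esub> g (\<epsilon> (y i \<odot>\<^bsub>N\<^esub> z))) I"
    unfolding induced_lift_def
    by (rule L.M.finsum_cong')
       (use x z module_map_add[OF induced_maps(2)] module_map_add[OF g] in
         \<open>auto simp: N.smult_r_distr L.smult_r_distr\<close>)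
  also have "\<dots> = induced_lift N \<epsilon> L g x \<oplus>\<^bsub>L\<^esub> induced_lift N \<epsilon> L g z"
    unfolding induced_lift_def by (rule L.M.finsum_addf) (use x z in auto)
  finally show "induced_lift N \<epsilon> L g (x \<oplus>\<^bsub>N\<^esub> z) = induced_lift N \<epsilon> L g x \<oplus>\<^bsub>L\<^esub> induced_lift N \<epsilon> L g z" .
qed

lemma induced_lift_eta:
  assumes m: "m \<in> carrier M"
  shows "induced_lift N \<epsilon> L g (\<eta> m) = g m"
proof -
  \<comment> \<open>The factor 1 behind \<open>y i\<close> brings the sum into the shape of
    \<open>dual_right\<close> at 1.\<close>
  have "induced_lift N \<epsilon> L g (\<eta> m) = finsum L (\<lambda>i. (b i \<otimes>\<^bsub>A\<^esub> \<iota> (E (y i \<otimes>\<^bsub>A\<^esub> \<one>\<^bsub>A\<^esub>))) \<odot>\<^bsub>L\<^esub> g m) I"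
    unfolding induced_lift_def
    by (rule L.M.finsum_cong') (use m in \<open>auto simp: induced_counit lift_g_smult L.smult_assoc1\<close>)
  also have "\<dots> = finsum A (\<lambda>i. b i \<otimes>\<^bsub>A\<^esub> \<iota> (E (y i \<otimes>\<^bsub>A\<^esub> \<one>\<^bsub>A\<^esub>))) I \<odot>\<^bsub>L\<^esub> g m"
    by (rule L.finsum_smult_rdistr[symmetric]) (use m in auto)
  also have "\<dots> = g m" by (subst dual_right) (use m in simp_all)
  finally show ?thesis .
qed

lemma induced_lift_unique:
  assumes h: "module_map A N L h" and hg: "\<And>m. m \<in> carrier M \<Longrightarrow> h (\<eta> m) = g m" and x: "x \<in> carrier N"
  shows "h x = induced_lift N \<epsilon> L g x"
proof -
  have "h x = h (finsum N (\<lambda>i. b i \<odot>\<^bsub>N\<^esub> \<eta> (\<epsilon> (y i \<odot>\<^bsub>N\<^esub> x))) I)" by (simp add: induced_expand[OF x])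
  also have "\<dots> = finsum L (\<lambda>i. h (b i \<odot>\<^bsub>N\<^esub> \<eta> (\<epsilon> (y i \<odot>\<^bsub>N\<^esub> x)))) I"
    by (rule module_map_finsum[OF induced_modules(2) L h]) (use x in simp)
  also have "\<dots> = induced_lift N \<epsilon> L g x"
    unfolding induced_lift_def
    by (rule L.M.finsum_cong') (use x hg in \<open>auto simp: module_map_smult[OF h]\<close>)
  finally show ?thesis .
qed

end

end

text \<open>The functor \<open>A \<otimes>\<^sub>R -\<close> on morphisms.\<close>

definition induced_map ::
    "('a, 'n) module \<Rightarrow> ('n \<Rightarrow> 'm) \<Rightarrow> ('a, 'p) module \<Rightarrow> ('q \<Rightarrow> 'p) \<Rightarrow> ('m \<Rightarrow> 'q) \<Rightarrow> 'n \<Rightarrow> 'p" where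
  "induced_map N \<epsilon> N' \<eta>' f = induced_lift N \<epsilon> N' (\<lambda>m. \<eta>' (f m))"

context
  fixes M :: "('r, 'm) module" and N :: "('a, 'n) module" and \<eta> \<epsilon>
    and M' :: "('r, 'p) module" and N' :: "('a, 'q) module" and \<eta>' \<epsilon>' and f
  assumes ind: "induced M N \<eta> \<epsilon>" and ind': "induced M' N' \<eta>' \<epsilon>'" and f: "module_map R M M' f"
begin

interpretation M: left_module R M by (rule induced_modules[OF ind])
interpretation N: left_module A N by (rule induced_modules[OF ind])
interpretation M': left_module R M' by (rule induced_modules[OF ind'])
interpretation N': left_module A N' by (rule induced_modules[OF ind'])

lemma eta_f: "module_map R M (restrict_scalars \<iota> N') (\<lambda>m. \<eta>' (f m))"
  by (rule module_map_comp[OF f induced_maps(1)[OF ind']])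

lemma induced_map_map: "module_map A N N' (induced_map N \<epsilon> N' \<eta>' f)"
  unfolding induced_map_def by (rule induced_lift_map[OF ind induced_modules(2)[OF ind'] eta_f])

lemma induced_map_eta: "m \<in> carrier M \<Longrightarrow> induced_map N \<epsilon> N' \<eta>' f (\<eta> m) = \<eta>' (f m)"
  unfolding induced_map_def by (rule induced_lift_eta[OF ind induced_modules(2)[OF ind'] eta_f])

text \<open>Naturality of \<open>\<epsilon>\<close>. The scalar is included because
  \<open>\<epsilon>\<close> is not linear over \<open>A\<close>; with \<open>a = y i\<close> this
  says that the induced map acts on coordinates as \<open>f\<close>.\<close>

lemma eps_induced_map:
  assumes a: "a \<in> carrier A" and x: "x \<in> carrier N"
  shows "\<epsilon>' (a \<odot>\<^bsub>N'\<^esub> induced_map N \<epsilon> N' \<eta>' f x) = f (\<epsilon> (a \<odot>\<^bsub>N\<^esub> x))"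
proof -
  note [simp] = eta_closed[OF ind] eps_closed[OF ind] eta_closed[OF ind'] eps_closed[OF ind'] module_map_closed[OF f]
  have "a \<odot>\<^bsub>N'\<^esub> induced_map N \<epsilon> N' \<eta>' f x = finsum N' (\<lambda>i. a \<odot>\<^bsub>N'\<^esub> (b i \<odot>\<^bsub>N'\<^esub> \<eta>' (f (\<epsilon> (y i \<odot>\<^bsub>N\<^esub> x))))) I"
    unfolding induced_map_def induced_lift_def by (rule N'.finsum_smult_ldistr) (use a x in auto)
  also have "\<epsilon>' \<dots> = finsum M' (\<lambda>i. \<epsilon>' (a \<odot>\<^bsub>N'\<^esub> (b i \<odot>\<^bsub>N'\<^esub> \<eta>' (f (\<epsilon> (y i \<odot>\<^bsub>N\<^esub> x)))))) I"
    by (rule eps_finsum[OF ind']) (use a x in auto)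
  also have "\<dots> = finsum M' (\<lambda>i. f (E (a \<otimes>\<^bsub>A\<^esub> b i) \<odot>\<^bsub>M\<^esub> \<epsilon> (y i \<odot>\<^bsub>N\<^esub> x))) I"
    by (rule M'.M.finsum_cong')
       (use a x in \<open>auto simp: N'.smult_assoc1[symmetric] induced_counit[OF ind'] module_map_smult[OF f]\<close>)
  also have "\<dots> = f (finsum M (\<lambda>i. E (a \<otimes>\<^bsub>A\<^esub> b i) \<odot>\<^bsub>M\<^esub> \<epsilon> (y i \<odot>\<^bsub>N\<^esub> x)) I)"
    by (rule module_map_finsum[OF induced_modules(1)[OF ind] induced_modules(1)[OF ind'] f, symmetric])
       (use a x in auto)
  also have "\<dots> = f (\<epsilon> (a \<odot>\<^bsub>N\<^esub> x))" by (simp only: eps_smult[OF ind a x])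
  finally show ?thesis .
qed

text \<open>Preimages of the coordinates of \<open>x\<close> are chosen one by one and recombined as
  the sum of the \<open>b i \<odot> \<eta> (m i)\<close>; its image is the expansion of
  \<open>x\<close>.\<close>

lemma induced_map_in_image:
  assumes x: "x \<in> carrier N'" and im: "\<And>i. i \<in> I \<Longrightarrow> \<epsilon>' (y i \<odot>\<^bsub>N'\<^esub> x) \<in> f ` carrier M"
  shows "x \<in> induced_map N \<epsilon> N' \<eta>' f ` carrier N"
proof -
  define m where "m i = inv_into (carrier M) f (\<epsilon>' (y i \<odot>\<^bsub>N'\<^esub> x))" for i
  have m: "m i \<in> carrier M" "f (m i) = \<epsilon>' (y i \<odot>\<^bsub>N'\<^esub> x)" if "i \<in> I" for i
    unfolding m_def by (rule inv_into_into[OF im[OF that]], rule f_inv_into_f[OF im[OF that]])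
  note [simp] = eta_closed[OF ind] m(1)
  let ?z = "finsum N (\<lambda>i. b i \<odot>\<^bsub>N\<^esub> \<eta> (m i)) I"
  have "induced_map N \<epsilon> N' \<eta>' f ?z = finsum N' (\<lambda>i. induced_map N \<epsilon> N' \<eta>' f (b i \<odot>\<^bsub>N\<^esub> \<eta> (m i))) I"
    by (rule module_map_finsum[OF induced_modules(2)[OF ind] induced_modules(2)[OF ind'] induced_map_map]) simp
  also have "\<dots> = finsum N' (\<lambda>i. b i \<odot>\<^bsub>N'\<^esub> \<eta>' (\<epsilon>' (y i \<odot>\<^bsub>N'\<^esub> x))) I"
    by (rule N'.M.finsum_cong')
       (use x m eta_closed[OF ind'] eps_closed[OF ind'] in
         \<open>auto simp: module_map_smult[OF induced_map_map] induced_map_eta\<close>)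
  also have "\<dots> = x" by (rule induced_expand[OF ind' x])
  finally have "induced_map N \<epsilon> N' \<eta>' f ?z = x" .
  moreover have "?z \<in> carrier N" by (rule N.M.finsum_closed) auto
  ultimately show ?thesis by blast
qed

lemma induced_map_surj:
  assumes "f ` carrier M = carrier M'"
  shows "induced_map N \<epsilon> N' \<eta>' f ` carrier N = carrier N'"
  using induced_map_in_image module_map_closed[OF induced_map_map] assms eps_closed[OF ind'] by auto

lemma induced_map_inj:
  assumes inj: "inj_on f (carrier M)"
  shows "inj_on (induced_map N \<epsilon> N' \<eta>' f) (carrier N)"
proof (rule inj_onI)
  fix x z assume x: "x \<in> carrier N" and z: "z \<in> carrier N"
    and eq: "induced_map N \<epsilon> N' \<eta>' f x = induced_map N \<epsilon> N' \<eta>' f z"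
  have "\<epsilon> (y i \<odot>\<^bsub>N\<^esub> x) = \<epsilon> (y i \<odot>\<^bsub>N\<^esub> z)" if i: "i \<in> I" for i
  proof (rule inj_onD[OF inj])
    show "f (\<epsilon> (y i \<odot>\<^bsub>N\<^esub> x)) = f (\<epsilon> (y i \<odot>\<^bsub>N\<^esub> z))"
      using i x z by (simp add: eps_induced_map[symmetric] eq)
  qed (use i x z eps_closed[OF ind] in auto)
  then have "finsum N (\<lambda>i. b i \<odot>\<^bsub>N\<^esub> \<eta> (\<epsilon> (y i \<odot>\<^bsub>N\<^esub> x))) I = finsum N (\<lambda>i. b i \<odot>\<^bsub>N\<^esub> \<eta> (\<epsilon> (y i \<odot>\<^bsub>N\<^esub> z))) I"
    by (intro N.M.finsum_cong') (use x z eps_closed[OF ind] eta_closed[OF ind] in auto)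
  then show "x = z" by (simp add: induced_expand[OF ind] x z)
qed

end

text \<open>Both inclusions are tested on coordinates, where they reduce to exactness over
  \<open>R\<close>. The dual bases thus do the work of flatness of \<open>A\<close> as a right
  \<open>R\<close>-module.\<close>

lemma induced_map_exact:
  assumes 1: "induced M N \<eta> \<epsilon>" and 2: "induced M' N' \<eta>' \<epsilon>'" and 3: "induced M'' N'' \<eta>'' \<epsilon>''"
    and f: "module_map R M M' f" and k: "module_map R M' M'' k"
    and ex: "f ` carrier M = {x \<in> carrier M'. k x = \<zero>\<^bsub>M''\<^esub>}"
  shows "induced_map N \<epsilon> N' \<eta>' f ` carrier N =
    {x \<in> carrier N'. induced_map N' \<epsilon>' N'' \<eta>'' k x = \<zero>\<^bsub>N''\<^esub>}" (is "?F ` _ = {x \<in> _. ?G x = _}")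
proof -
  interpret N: left_module A N by (rule induced_modules[OF 1])
  interpret N': left_module A N' by (rule induced_modules[OF 2])
  interpret N'': left_module A N'' by (rule induced_modules[OF 3])
  note F = induced_map_map[OF 1 2 f] and G = induced_map_map[OF 2 3 k]
  have "?G (?F x) = \<zero>\<^bsub>N''\<^esub>" if x: "x \<in> carrier N" for x
  proof (rule induced_zero_iff[OF 3])
    have Fx: "?F x \<in> carrier N'" by (rule module_map_closed[OF F x])
    then show "?G (?F x) \<in> carrier N''" by (rule module_map_closed[OF G])
    fix i assume i: "i \<in> I"
    have "\<epsilon>'' (y i \<odot>\<^bsub>N''\<^esub> ?G (?F x)) = k (\<epsilon>' (y i \<odot>\<^bsub>N'\<^esub> ?F x))"
      by (rule eps_induced_map[OF 2 3 k y_closed[OF i] Fx])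
    also have "\<dots> = k (f (\<epsilon> (y i \<odot>\<^bsub>N\<^esub> x)))"
      by (simp only: eps_induced_map[OF 1 2 f y_closed[OF i] x])
    also have "\<dots> = \<zero>\<^bsub>M''\<^esub>" using ex eps_closed[OF 1] i x by auto
    finally show "\<epsilon>'' (y i \<odot>\<^bsub>N''\<^esub> ?G (?F x)) = \<zero>\<^bsub>M''\<^esub>" .
  qed
  moreover have "x \<in> ?F ` carrier N" if x: "x \<in> carrier N'" "?G x = \<zero>\<^bsub>N''\<^esub>" for x
  proof (rule induced_map_in_image[OF 1 2 f x(1)])
    fix i assume i: "i \<in> I"
    have "k (\<epsilon>' (y i \<odot>\<^bsub>N'\<^esub> x)) = \<epsilon>'' (y i \<odot>\<^bsub>N''\<^esub> ?G x)"
      by (rule eps_induced_map[OF 2 3 k y_closed[OF i] x(1), symmetric])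
    also have "\<dots> = \<zero>\<^bsub>M''\<^esub>"
      using x(2) i module_map_zero[OF induced_modules(3,1)[OF 3] induced_maps(2)[OF 3]] by simp
    finally show "\<epsilon>' (y i \<odot>\<^bsub>N'\<^esub> x) \<in> f ` carrier M" unfolding ex using i x eps_closed[OF 2] by simp
  qed
  ultimately show ?thesis using module_map_closed[OF F] by auto
qed

lemma induced_map_comp_eta:
  assumes 1: "induced M N \<eta> \<epsilon>" and L: "left_module A L" and h: "module_map A N L h"
  shows "module_map R M (restrict_scalars \<iota> L) (\<lambda>m. h (\<eta> m))"
  by (rule module_map_comp[OF induced_maps(1)[OF 1] restrict_scalars_module_map[OF extension h]])

text \<open>Naturality of the adjunction: a factorization of the transpose
  \<open>h \<circ> \<eta>\<close> through \<open>f\<close> over \<open>R\<close> yields one of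
  \<open>h\<close> through the induced map over \<open>A\<close>. In this way solutions of lifting
  problems return from \<open>R\<close> to \<open>A\<close>.\<close>

lemma induced_factor:
  assumes 1: "induced M N \<eta> \<epsilon>" and 2: "induced M' N' \<eta>' \<epsilon>'" and f: "module_map R M M' f"
    and L: "left_module A L" and h: "module_map A N L h"
    and w: "module_map R M' (restrict_scalars \<iota> L) w"
    and eq: "\<And>m. m \<in> carrier M \<Longrightarrow> h (\<eta> m) = w (f m)" and x: "x \<in> carrier N"
  shows "h x = induced_lift N' \<epsilon>' L w (induced_map N \<epsilon> N' \<eta>' f x)"
proof -
  have g: "module_map R M (restrict_scalars \<iota> L) (\<lambda>m. w (f m))" by (rule module_map_comp[OF f w])
  have "module_map A N L (\<lambda>x. induced_lift N' \<epsilon>' L w (induced_map N \<epsilon> N' \<eta>' f x))"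
    by (rule module_map_comp[OF induced_map_map[OF 1 2 f] induced_lift_map[OF 2 L w]])
  then have "induced_lift N' \<epsilon>' L w (induced_map N \<epsilon> N' \<eta>' f x) = induced_lift N \<epsilon> L (\<lambda>m. w (f m)) x"
    by (rule induced_lift_unique[OF 1 L g _ _ x])
       (simp add: induced_map_eta[OF 1 2 f] induced_lift_eta[OF 2 L w] module_map_closed[OF f])
  also have "\<dots> = h x" by (rule induced_lift_unique[OF 1 L g h eq x, symmetric])
  finally show ?thesis ..
qed

text \<open>For \<open>A = A \<otimes>\<^sub>R R\<close> the condition on \<open>\<epsilon>\<close>
  is \<open>E_right\<close> and the expansion is \<open>dual_right\<close>.\<close>

lemma induced_regular: "induced (regular_module R) (regular_module A) \<iota> E"
  unfolding induced_def
  using rings restrict_scalars_left_module[OF extension] dual_right ring_hom_add[OF iota] ring_hom_mult[OF iota]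
  by (auto simp: regular_left_module module_map_def E_add E_left E_right finsum_regular_module)

lemma induced_copower:
  assumes 1: "induced M N \<eta> \<epsilon>" and J: "finite J"
  shows "induced (copower J M) (copower J N) (\<lambda>v. \<lambda>j\<in>J. \<eta> (v j)) (\<lambda>v. \<lambda>j\<in>J. \<epsilon> (v j))"
proof -
  interpret M: left_module R M by (rule induced_modules[OF 1])
  interpret N: left_module A N by (rule induced_modules[OF 1])
  have cM: "left_module R (copower J M)" and cN: "left_module A (copower J N)"
    using induced_modules[OF 1] by (auto intro: copower_left_module)
  interpret cN: left_module A "copower J N" by (rule cN)
  note [simp] = eta_closed[OF 1] eps_closed[OF 1] copower_finite_carrier[OF J]
  have [simp]: "v j \<in> C" if "v \<in> J \<rightarrow>\<^sub>E C" "j \<in> J" for v j and C :: "'s set" using that by auto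
  have ops [simp]: "(v \<oplus>\<^bsub>copower J L\<^esub> w) = (\<lambda>j\<in>J. v j \<oplus>\<^bsub>L\<^esub> w j)" "(r \<odot>\<^bsub>copower J L\<^esub> v) = (\<lambda>j\<in>J. r \<odot>\<^bsub>L\<^esub> v j)"
    for v w r and L :: "('s, 'u) module"
    by (simp_all add: copower_def)
  have e: "module_map R (copower J M) (restrict_scalars \<iota> (copower J N)) (\<lambda>v. \<lambda>j\<in>J. \<eta> (v j))"
    using module_map_add[OF induced_maps(1)[OF 1]] module_map_smult[OF induced_maps(1)[OF 1]]
    by (intro module_mapI) (auto intro!: restrict_ext)
  have e': "module_map R (restrict_scalars \<iota> (copower J N)) (copower J M) (\<lambda>v. \<lambda>j\<in>J. \<epsilon> (v j))"
    using module_map_add[OF induced_maps(2)[OF 1]] module_map_smult[OF induced_maps(2)[OF 1]]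
    by (intro module_mapI) (auto intro!: restrict_ext)
  have "finsum (copower J N) (\<lambda>i. b i \<odot>\<^bsub>copower J N\<^esub> (\<lambda>j\<in>J. \<eta> ((\<lambda>j\<in>J. \<epsilon> ((y i \<odot>\<^bsub>copower J N\<^esub> x) j)) j))) I = x"
    (is "finsum _ ?t I = x") if x: "x \<in> carrier (copower J N)" for x
  proof (rule copower_ext)
    have t: "?t i \<in> carrier (copower J N)" if "i \<in> I" for i using that x by auto
    then show "finsum (copower J N) ?t I \<in> carrier (copower J N)" by (intro cN.M.finsum_closed) auto
    fix j assume j: "j \<in> J"
    have xj: "x j \<in> carrier N" using x j by auto
    have "finsum (copower J N) ?t I j = finsum N (\<lambda>i. ?t i j) I"
      by (rule module_map_finsum[OF cN induced_modules(2)[OF 1] copower_eval_map[OF j] t])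
    also have "\<dots> = finsum N (\<lambda>i. b i \<odot>\<^bsub>N\<^esub> \<eta> (\<epsilon> (y i \<odot>\<^bsub>N\<^esub> x j))) I"
      by (rule N.M.finsum_cong') (use j xj in auto)
    also have "\<dots> = x j" by (rule induced_expand[OF 1 xj])
    finally show "finsum (copower J N) ?t I j = x j" .
  qed (rule x)
  then show ?thesis
    unfolding induced_def using cM cN e e' induced_counit[OF 1] by (auto intro!: restrict_ext)
qed

text \<open>A retract of \<open>M'\<close> induces the image of the corresponding idempotent of \<open>A \<otimes>\<^sub>R M'\<close>.\<close>

lemma induced_retract:
  assumes 1: "induced M' N' \<eta>' \<epsilon>'" and M: "left_module R M" and ret: "retract R M M'"
  obtains K \<eta> \<epsilon> where "induced M (N'\<lparr>carrier := K\<rparr>) \<eta> \<epsilon>" "retract A (N'\<lparr>carrier := K\<rparr>) N'"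
proof -
  interpret M: left_module R M by (rule M)
  interpret M': left_module R M' by (rule induced_modules[OF 1])
  interpret N': left_module A N' by (rule induced_modules[OF 1])
  obtain s t where s: "module_map R M M' s" and t: "module_map R M' M t"
    and ts: "\<And>x. x \<in> carrier M \<Longrightarrow> t (s x) = x" using ret unfolding retract_def by blast
  have st: "module_map R M' M' (\<lambda>x. s (t x))" by (rule module_map_comp[OF t s])
  define q where "q = induced_map N' \<epsilon>' N' \<eta>' (\<lambda>x. s (t x))"
  have q: "module_map A N' N' q" unfolding q_def by (rule induced_map_map[OF 1 1 st])
  note [simp] = eta_closed[OF 1] eps_closed[OF 1] module_map_closed[OF s] module_map_closed[OF t]
    module_map_closed[OF q]
  have q_eq: "q x = finsum N' (\<lambda>i. b i \<odot>\<^bsub>N'\<^esub> \<eta>' (s (t (\<epsilon>' (y i \<odot>\<^bsub>N'\<^esub> x))))) I" for x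
    by (simp add: q_def induced_map_def induced_lift_def)
  have qeta: "q (\<eta>' (s m)) = \<eta>' (s m)" if "m \<in> carrier M" for m
    unfolding q_def using induced_map_eta[OF 1 1 st, of "s m"] that ts by simp
  have qeps: "\<epsilon>' (a \<odot>\<^bsub>N'\<^esub> q x) = s (t (\<epsilon>' (a \<odot>\<^bsub>N'\<^esub> x)))" if "a \<in> carrier A" "x \<in> carrier N'" for a x
    unfolding q_def by (rule eps_induced_map[OF 1 1 st that])
  \<comment> \<open>\<open>q x\<close> depends only on the values of \<open>s \<circ> t\<close> at
    the coordinates of \<open>x\<close>, and by \<open>qeps\<close> the coordinates of
    \<open>q x\<close> are already fixed by \<open>s \<circ> t\<close>.\<close>
  have qq: "q (q x) = q x" if x: "x \<in> carrier N'" for x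
    unfolding q_eq[of "q x"] unfolding q_eq[of x]
    by (rule N'.M.finsum_cong') (use x in \<open>auto simp: qeps[unfolded q_eq[of x]] q_eq[symmetric] qeps ts\<close>)
  define K where "K = q ` carrier N'"
  define N where "N = N'\<lparr>carrier := K\<rparr>"
  have K: "submodule K A N'" unfolding K_def
    by (rule module_map_image_submodule[OF induced_modules(2)[OF 1] induced_modules(2)[OF 1] q])
  have N: "left_module A N" unfolding N_def by (rule left_module_submodule[OF induced_modules(2)[OF 1] K])
  have KN: "x \<in> carrier N'" "q x = x" if "x \<in> K" for x using that qq by (auto simp: K_def)
  have etaK: "\<eta>' (s m) \<in> K" if "m \<in> carrier M" for m
    unfolding K_def by (rule image_eqI[where x = "\<eta>' (s m)"]) (simp_all add: qeta that)
  have smK: "a \<odot>\<^bsub>N'\<^esub> x \<in> K" if "a \<in> carrier A" "x \<in> K" for a x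
    using submodule.smult_closed[OF K that] .
  have "induced M N (\<lambda>m. \<eta>' (s m)) (\<lambda>x. t (\<epsilon>' x))"
    unfolding induced_def
  proof (intro conjI M N ballI)
    show "module_map R M (restrict_scalars \<iota> N) (\<lambda>m. \<eta>' (s m))"
      using module_map_comp[OF s induced_maps(1)[OF 1]] etaK by (simp add: module_map_def N_def)
    show "module_map R (restrict_scalars \<iota> N) M (\<lambda>x. t (\<epsilon>' x))"
      using module_map_comp[OF induced_maps(2)[OF 1] t] KN(1) by (simp add: module_map_def N_def)
    show "t (\<epsilon>' (a \<odot>\<^bsub>N\<^esub> \<eta>' (s m))) = E a \<odot>\<^bsub>M\<^esub> m" if "a \<in> carrier A" "m \<in> carrier M" for a m
      using that induced_counit[OF 1] module_map_smult[OF t] ts by (simp add: N_def)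
    fix x assume "x \<in> carrier N"
    then have x: "x \<in> K" by (simp add: N_def)
    have "finsum N (\<lambda>i. b i \<odot>\<^bsub>N\<^esub> \<eta>' (s (t (\<epsilon>' (y i \<odot>\<^bsub>N\<^esub> x))))) I
        = finsum N' (\<lambda>i. b i \<odot>\<^bsub>N'\<^esub> \<eta>' (s (t (\<epsilon>' (y i \<odot>\<^bsub>N'\<^esub> x))))) I"
      unfolding N_def by simp (rule finsum_submodule[OF induced_modules(2)[OF 1] K], use x KN(1) etaK smK in simp)
    also have "\<dots> = x" using q_eq KN(2)[OF x] by simp
    finally show "finsum N (\<lambda>i. b i \<odot>\<^bsub>N\<^esub> \<eta>' (s (t (\<epsilon>' (y i \<odot>\<^bsub>N\<^esub> x))))) I = x" .
  qed
  moreover have "retract A N N'" unfolding retract_def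
  proof (intro exI conjI ballI)
    show "module_map A N N' (\<lambda>x. x)" using KN(1) by (simp add: module_map_def N_def)
    show "module_map A N' N q" using q by (simp add: module_map_def N_def K_def)
    show "q x = x" if "x \<in> carrier N" for x using that KN(2) by (simp add: N_def)
  qed
  ultimately show ?thesis unfolding N_def by (rule that)
qed

end

section \<open>Tensor products\<close>

lemma additive_zero:
  assumes M: "abelian_group M" and N: "abelian_group N"
    and cl: "\<And>x. x \<in> carrier M \<Longrightarrow> h x \<in> carrier N"
    and add: "\<And>x y. x \<in> carrier M \<Longrightarrow> y \<in> carrier M \<Longrightarrow> h (x \<oplus>\<^bsub>M\<^esub> y) = h x \<oplus>\<^bsub>N\<^esub> h y"
  shows "h \<zero>\<^bsub>M\<^esub> = \<zero>\<^bsub>N\<^esub>"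
  using additive_finsum[OF M N cl add, of "{}" "\<lambda>_. \<zero>\<^bsub>M\<^esub>"] M N
  by (simp add: abelian_group_def abelian_monoid.finsum_empty)

lemma additive_diff:
  assumes M: "abelian_group M" and N: "abelian_group N"
    and cl: "\<And>x. x \<in> carrier M \<Longrightarrow> h x \<in> carrier N"
    and add: "\<And>x y. x \<in> carrier M \<Longrightarrow> y \<in> carrier M \<Longrightarrow> h (x \<oplus>\<^bsub>M\<^esub> y) = h x \<oplus>\<^bsub>N\<^esub> h y"
    and x: "x \<in> carrier M" and y: "y \<in> carrier M"
  shows "h (x \<ominus>\<^bsub>M\<^esub> y) = h x \<ominus>\<^bsub>N\<^esub> h y"
proof -
  interpret M: abelian_group M by fact
  interpret N: abelian_group N by fact
  have "h (x \<ominus>\<^bsub>M\<^esub> y) \<oplus>\<^bsub>N\<^esub> h y = h x"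
    using x y by (simp add: add[symmetric] a_minus_def M.a_assoc M.l_neg)
  then have "h x \<ominus>\<^bsub>N\<^esub> h y = (h (x \<ominus>\<^bsub>M\<^esub> y) \<oplus>\<^bsub>N\<^esub> h y) \<ominus>\<^bsub>N\<^esub> h y" by simp
  also have "\<dots> = h (x \<ominus>\<^bsub>M\<^esub> y)"
    using x y cl by (simp add: a_minus_def N.a_assoc N.r_neg)
  finally show ?thesis ..
qed

locale tensor_product =
  fixes R :: "('r, 'k) ring_scheme" and A :: "('a, 'l) ring_scheme" and \<iota> :: "'r \<Rightarrow> 'a"
    and T :: "('r, 't) module"
  assumes extension: "ring_extension R A \<iota>" and T: "left_module R T"
begin

sublocale R: ring R using extension by (simp add: ring_extension_def)
sublocale A: ring A using extension by (simp add: ring_extension_def)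
sublocale T: left_module R T by (rule T)

lemma iota: "\<iota> \<in> ring_hom R A" using extension by (simp add: ring_extension_def)

lemmas iota_closed [simp] = ring_hom_closed[OF iota]

abbreviation "pairs \<equiv> carrier A \<times> carrier T"
abbreviation "F \<equiv> free_Abelian_group pairs"
abbreviation "rels \<equiv> tensor_relations R A \<iota> T"
abbreviation "N \<equiv> generate F rels"
abbreviation "U \<equiv> extend_scalars R A \<iota> T"

definition tclass :: "('a \<times> 't \<Rightarrow>\<^sub>0 int) \<Rightarrow> ('a \<times> 't \<Rightarrow>\<^sub>0 int) set" where
  "tclass x = N #>\<^bsub>F\<^esub> x"

definition act :: "'a \<Rightarrow> ('a \<times> 't \<Rightarrow>\<^sub>0 int) \<Rightarrow> ('a \<times> 't \<Rightarrow>\<^sub>0 int)" where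
  "act a = frag_extend (\<lambda>(b, t). frag_of (a \<otimes>\<^bsub>A\<^esub> b, t))"

definition pure :: "'a \<Rightarrow> 't \<Rightarrow> ('a \<times> 't \<Rightarrow>\<^sub>0 int) set" where
  "pure a t = tclass (frag_of (a, t))"

lemma keys_diffI: "Poly_Mapping.keys x \<subseteq> S \<Longrightarrow> Poly_Mapping.keys y \<subseteq> S \<Longrightarrow> Poly_Mapping.keys (x - y) \<subseteq> S"
  using keys_diff[of x y] by blast

lemma rels_cases [consumes 1, case_names left right balanced]:
  assumes "x \<in> rels"
  obtains b c t where "x = frag_of (b \<oplus>\<^bsub>A\<^esub> c, t) - frag_of (b, t) - frag_of (c, t)"
      "b \<in> carrier A" "c \<in> carrier A" "t \<in> carrier T"
    | b s t where "x = frag_of (b, s \<oplus>\<^bsub>T\<^esub> t) - frag_of (b, s) - frag_of (b, t)"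
      "b \<in> carrier A" "s \<in> carrier T" "t \<in> carrier T"
    | b r t where "x = frag_of (b \<otimes>\<^bsub>A\<^esub> \<iota> r, t) - frag_of (b, r \<odot>\<^bsub>T\<^esub> t)"
      "b \<in> carrier A" "r \<in> carrier R" "t \<in> carrier T"
  using assms unfolding tensor_relations_def by (elim UnE CollectE exE conjE) blast+

lemma rels_left: "a \<in> carrier A \<Longrightarrow> b \<in> carrier A \<Longrightarrow> t \<in> carrier T \<Longrightarrow>
    frag_of (a \<oplus>\<^bsub>A\<^esub> b, t) - frag_of (a, t) - frag_of (b, t) \<in> rels"
  unfolding tensor_relations_def by (rule UnI1, rule UnI1, rule CollectI, intro exI conjI, rule refl)

lemma rels_right: "a \<in> carrier A \<Longrightarrow> s \<in> carrier T \<Longrightarrow> t \<in> carrier T \<Longrightarrow>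
    frag_of (a, s \<oplus>\<^bsub>T\<^esub> t) - frag_of (a, s) - frag_of (a, t) \<in> rels"
  unfolding tensor_relations_def by (rule UnI1, rule UnI2, rule CollectI, intro exI conjI, rule refl)

lemma rels_balanced: "a \<in> carrier A \<Longrightarrow> r \<in> carrier R \<Longrightarrow> t \<in> carrier T \<Longrightarrow>
    frag_of (a \<otimes>\<^bsub>A\<^esub> \<iota> r, t) - frag_of (a, r \<odot>\<^bsub>T\<^esub> t) \<in> rels"
  unfolding tensor_relations_def by (rule UnI2, rule CollectI, intro exI conjI, rule refl)

lemma rels_carrier: "rels \<subseteq> carrier F"
proof
  fix x assume "x \<in> rels"
  then show "x \<in> carrier F" by (cases rule: rels_cases) (simp_all add: keys_diffI)
qed

lemma N_subgroup: "subgroup N F"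
  by (rule group.generate_is_subgroup[OF group_free_Abelian_group rels_carrier])

lemma N_keys: "x \<in> N \<Longrightarrow> Poly_Mapping.keys x \<subseteq> pairs"
  using subgroup.subset[OF N_subgroup] by (auto simp: free_Abelian_group_def)

lemma N_zero: "0 \<in> N"
  using subgroup.one_closed[OF N_subgroup] by simp

lemma N_add: "x \<in> N \<Longrightarrow> y \<in> N \<Longrightarrow> x + y \<in> N"
  using subgroup.m_closed[OF N_subgroup, of x y] by simp

lemma N_minus: "x \<in> N \<Longrightarrow> - x \<in> N"
  using subgroup.m_inv_closed[OF N_subgroup, of x] N_keys by simp

lemma N_diff: "x \<in> N \<Longrightarrow> y \<in> N \<Longrightarrow> x - y \<in> N"
  using N_add[OF _ N_minus] by fastforce

lemma N_rels: "x \<in> rels \<Longrightarrow> x \<in> N"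
  by (rule generate.incl)

lemma tclass_eq: "tclass x = (\<lambda>n. n + x) ` N"
  by (auto simp: tclass_def r_coset_def)

lemma tclass_self: "x \<in> tclass x"
  unfolding tclass_eq using N_zero by force

lemma tclass_cong: "x - y \<in> N \<Longrightarrow> tclass x = tclass y"
proof -
  assume xy: "x - y \<in> N"
  have "n + x \<in> (\<lambda>n. n + y) ` N" if "n \<in> N" for n
    by (rule image_eqI[of _ _ "n + (x - y)"]) (use N_add[OF that xy] in simp_all)
  moreover have "n + y \<in> (\<lambda>n. n + x) ` N" if "n \<in> N" for n
    by (rule image_eqI[of _ _ "n - (x - y)"]) (use N_diff[OF that xy] in simp_all)
  ultimately show ?thesis unfolding tclass_eq by auto
qed

lemma tclass_eqD: "tclass x = tclass y \<Longrightarrow> x - y \<in> N"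
  using tclass_self[of x] unfolding tclass_eq by auto

lemma U_carrier: "carrier U = tclass ` {x. Poly_Mapping.keys x \<subseteq> pairs}"
  by (auto simp: extend_scalars_def Let_def carrier_FactGroup tclass_def free_Abelian_group_def)

lemma U_zero: "\<zero>\<^bsub>U\<^esub> = tclass 0"
  unfolding tclass_eq by (simp add: extend_scalars_def Let_def)

lemma U_add: "tclass x \<oplus>\<^bsub>U\<^esub> tclass z = tclass (x + z)"
proof -
  have "tclass x \<oplus>\<^bsub>U\<^esub> tclass z = {h + k | h k. h \<in> tclass x \<and> k \<in> tclass z}"
    by (auto simp: extend_scalars_def Let_def set_mult_def)
  also have "\<dots> = tclass (x + z)"
  proof (intro equalityI subsetI)
    fix v assume "v \<in> {h + k | h k. h \<in> tclass x \<and> k \<in> tclass z}"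
    then obtain n m where "n \<in> N" "m \<in> N" "v = (n + x) + (m + z)" unfolding tclass_eq by auto
    then show "v \<in> tclass (x + z)" unfolding tclass_eq
      by (intro image_eqI[of _ _ "n + m"]) (simp_all add: N_add)
  next
    fix v assume "v \<in> tclass (x + z)"
    then obtain n where "n \<in> N" "v = n + (x + z)" unfolding tclass_eq by auto
    then show "v \<in> {h + k | h k. h \<in> tclass x \<and> k \<in> tclass z}"
      using tclass_self[of z] unfolding tclass_eq
      by (intro CollectI exI[of _ "n + x"] exI[of _ z]) (simp add: add.assoc)
  qed
  finally show ?thesis .
qed

section \<open>The scalar action on cosets\<close>

lemma act_diff: "act a (x - z) = act a x - act a z"
  and act_add: "act a (x + z) = act a x + act a z"
  and act_of: "act a (frag_of (c, t)) = frag_of (a \<otimes>\<^bsub>A\<^esub> c, t)"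
  by (simp_all add: act_def frag_extend_diff frag_extend_add)

lemma act_zero: "act a 0 = 0"
  by (simp add: act_def)

lemma act_minus: "act a (- x) = - act a x"
  by (simp add: act_def frag_extend_minus)

lemma act_keys:
  assumes "a \<in> carrier A" "Poly_Mapping.keys x \<subseteq> pairs"
  shows "Poly_Mapping.keys (act a x) \<subseteq> pairs"
  unfolding act_def by (rule order_trans[OF keys_frag_extend]) (use assms in auto)

text \<open>Left multiplication by \<open>a\<close> turns a defining relation into one of the same
  kind, since it is additive and commutes with the right action through \<open>\<iota>\<close>. This
  is why it descends to cosets.\<close>

lemma act_rels: "a \<in> carrier A \<Longrightarrow> x \<in> rels \<Longrightarrow> act a x \<in> rels"
proof -
  assume a: "a \<in> carrier A" and x: "x \<in> rels"
  from x show "act a x \<in> rels"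
  proof (cases rule: rels_cases)
    case (left b c t)
    then have "act a x = frag_of ((a \<otimes>\<^bsub>A\<^esub> b) \<oplus>\<^bsub>A\<^esub> (a \<otimes>\<^bsub>A\<^esub> c), t) - frag_of (a \<otimes>\<^bsub>A\<^esub> b, t) - frag_of (a \<otimes>\<^bsub>A\<^esub> c, t)"
      using a by (simp add: act_diff act_of A.r_distr)
    then show ?thesis using rels_left[of "a \<otimes>\<^bsub>A\<^esub> b" "a \<otimes>\<^bsub>A\<^esub> c" t] left a by simp
  next
    case (right b s t)
    then have "act a x = frag_of (a \<otimes>\<^bsub>A\<^esub> b, s \<oplus>\<^bsub>T\<^esub> t) - frag_of (a \<otimes>\<^bsub>A\<^esub> b, s) - frag_of (a \<otimes>\<^bsub>A\<^esub> b, t)"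
      by (simp add: act_diff act_of)
    then show ?thesis using rels_right[of "a \<otimes>\<^bsub>A\<^esub> b" s t] right a by simp
  next
    case (balanced b r t)
    then have "act a x = frag_of ((a \<otimes>\<^bsub>A\<^esub> b) \<otimes>\<^bsub>A\<^esub> \<iota> r, t) - frag_of (a \<otimes>\<^bsub>A\<^esub> b, r \<odot>\<^bsub>T\<^esub> t)"
      using a by (simp add: act_diff act_of A.m_assoc)
    then show ?thesis using rels_balanced[of "a \<otimes>\<^bsub>A\<^esub> b" r t] balanced a by simp
  qed
qed

lemma act_N:
  assumes a: "a \<in> carrier A" and x: "x \<in> N"
  shows "act a x \<in> N"
  using x
proof (induction rule: generate.induct)
  case one then show ?case by (simp add: act_zero N_zero)
next
  case (incl h) then show ?case using act_rels[OF a] N_rels by blast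
next
  case (inv h)
  then have "inv\<^bsub>F\<^esub> h = - h" using rels_carrier by (auto simp: free_Abelian_group_def[symmetric])
  then show ?case using act_rels[OF a inv] N_rels N_minus by (simp add: act_minus)
next
  case (eng h k) then show ?case by (simp add: act_add N_add)
qed

text \<open>The images of all representatives of a coset lie in one coset, so the union defining the
  action is a union of equal sets; it is nonempty because \<open>x\<close> represents its own
  coset.\<close>

lemma U_smult:
  assumes a: "a \<in> carrier A"
  shows "a \<odot>\<^bsub>U\<^esub> tclass x = tclass (act a x)"
proof -
  have "tclass (act a z) = tclass (act a x)" if z: "z \<in> tclass x" for z
  proof (rule tclass_cong)
    obtain n where "n \<in> N" "z = n + x" using z unfolding tclass_eq by auto
    then show "act a z - act a x \<in> N" using act_N[OF a] by (simp add: act_add)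
  qed
  then have "(\<Union>z\<in>tclass x. tclass (act a z)) = (\<Union>z\<in>tclass x. tclass (act a x))"
    by (rule SUP_cong[OF refl])
  also have "\<dots> = tclass (act a x)" using tclass_self[of x] by (simp only: UN_constant) auto
  finally have "(\<Union>z\<in>tclass x. tclass (act a z)) = tclass (act a x)" .
  then show ?thesis by (simp add: extend_scalars_def Let_def tclass_def act_def)
qed

lemma U_abelian_group: "abelian_group U"
proof (rule abelian_groupI)
  fix x assume "x \<in> carrier U"
  then obtain u where u: "Poly_Mapping.keys u \<subseteq> pairs" "x = tclass u" unfolding U_carrier by auto
  then show "\<zero>\<^bsub>U\<^esub> \<oplus>\<^bsub>U\<^esub> x = x" by (simp add: U_zero U_add)
  have "tclass (- u) \<in> carrier U" unfolding U_carrier using u by auto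
  then show "\<exists>z\<in>carrier U. z \<oplus>\<^bsub>U\<^esub> x = \<zero>\<^bsub>U\<^esub>"
    by (intro bexI[of _ "tclass (- u)"]) (simp_all add: u(2) U_add U_zero)
  fix z assume "z \<in> carrier U"
  then obtain v where v: "Poly_Mapping.keys v \<subseteq> pairs" "z = tclass v" unfolding U_carrier by auto
  have "Poly_Mapping.keys (u + v) \<subseteq> pairs" using keys_add[of u v] u v by blast
  then show "x \<oplus>\<^bsub>U\<^esub> z \<in> carrier U" unfolding U_carrier using u v by (auto simp: U_add)
  show "x \<oplus>\<^bsub>U\<^esub> z = z \<oplus>\<^bsub>U\<^esub> x" by (simp add: u(2) v(2) U_add add.commute)
  fix y assume "y \<in> carrier U"
  then obtain w where "y = tclass w" unfolding U_carrier by auto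
  then show "x \<oplus>\<^bsub>U\<^esub> z \<oplus>\<^bsub>U\<^esub> y = x \<oplus>\<^bsub>U\<^esub> (z \<oplus>\<^bsub>U\<^esub> y)" by (simp add: u(2) v(2) U_add add.assoc)
next
  show "\<zero>\<^bsub>U\<^esub> \<in> carrier U" unfolding U_carrier U_zero by auto
qed

sublocale U: abelian_group U by (rule U_abelian_group)

lemma tclass_closed: "Poly_Mapping.keys x \<subseteq> pairs \<Longrightarrow> tclass x \<in> carrier U"
  unfolding U_carrier by auto

lemma tclass_diff:
  assumes "Poly_Mapping.keys x \<subseteq> pairs" "Poly_Mapping.keys z \<subseteq> pairs"
  shows "tclass (x - z) = tclass x \<ominus>\<^bsub>U\<^esub> tclass z"
proof -
  have "tclass (- z) \<oplus>\<^bsub>U\<^esub> tclass z = \<zero>\<^bsub>U\<^esub>" by (simp add: U_add U_zero)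
  then have "\<ominus>\<^bsub>U\<^esub> tclass z = tclass (- z)"
    by (rule U.minus_equality) (use assms in \<open>simp_all add: tclass_closed\<close>)
  then show ?thesis by (simp add: a_minus_def U_add)
qed

section \<open>Pure tensors and the universal property\<close>

lemma pure_closed [simp]: "a \<in> carrier A \<Longrightarrow> t \<in> carrier T \<Longrightarrow> pure a t \<in> carrier U"
  unfolding pure_def by (rule tclass_closed) simp

lemma pure_add_left:
  assumes "a \<in> carrier A" "b \<in> carrier A" "t \<in> carrier T"
  shows "pure (a \<oplus>\<^bsub>A\<^esub> b) t = pure a t \<oplus>\<^bsub>U\<^esub> pure b t"
proof -
  have "frag_of (a \<oplus>\<^bsub>A\<^esub> b, t) - frag_of (a, t) - frag_of (b, t) \<in> N"
    by (rule N_rels[OF rels_left[OF assms]])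
  then show ?thesis unfolding pure_def U_add by (intro tclass_cong) (simp add: diff_diff_eq)
qed

lemma pure_add_right:
  assumes "a \<in> carrier A" "s \<in> carrier T" "t \<in> carrier T"
  shows "pure a (s \<oplus>\<^bsub>T\<^esub> t) = pure a s \<oplus>\<^bsub>U\<^esub> pure a t"
proof -
  have "frag_of (a, s \<oplus>\<^bsub>T\<^esub> t) - frag_of (a, s) - frag_of (a, t) \<in> N"
    by (rule N_rels[OF rels_right[OF assms]])
  then show ?thesis unfolding pure_def U_add by (intro tclass_cong) (simp add: diff_diff_eq)
qed

lemma pure_balanced:
  assumes "a \<in> carrier A" "r \<in> carrier R" "t \<in> carrier T"
  shows "pure (a \<otimes>\<^bsub>A\<^esub> \<iota> r) t = pure a (r \<odot>\<^bsub>T\<^esub> t)"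
proof -
  have "frag_of (a \<otimes>\<^bsub>A\<^esub> \<iota> r, t) - frag_of (a, r \<odot>\<^bsub>T\<^esub> t) \<in> N"
    by (rule N_rels[OF rels_balanced[OF assms]])
  then show ?thesis unfolding pure_def by (rule tclass_cong)
qed

lemma smult_pure: "a \<in> carrier A \<Longrightarrow> a \<odot>\<^bsub>U\<^esub> pure b t = pure (a \<otimes>\<^bsub>A\<^esub> b) t"
  unfolding pure_def by (simp add: U_smult act_of)

lemma U_smult_closed: "a \<in> carrier A \<Longrightarrow> x \<in> carrier U \<Longrightarrow> a \<odot>\<^bsub>U\<^esub> x \<in> carrier U"
  unfolding U_carrier by (elim imageE) (simp add: U_smult act_keys)

lemma U_smult_add:
  "a \<in> carrier A \<Longrightarrow> x \<in> carrier U \<Longrightarrow> z \<in> carrier U \<Longrightarrow> a \<odot>\<^bsub>U\<^esub> (x \<oplus>\<^bsub>U\<^esub> z) = a \<odot>\<^bsub>U\<^esub> x \<oplus>\<^bsub>U\<^esub> a \<odot>\<^bsub>U\<^esub> z"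
  unfolding U_carrier by (elim imageE) (simp add: U_smult U_add act_add)

lemma tensor_eqI:
  assumes V: "abelian_group V"
    and h: "\<And>x. x \<in> carrier U \<Longrightarrow> h x \<in> carrier V"
      "\<And>x z. x \<in> carrier U \<Longrightarrow> z \<in> carrier U \<Longrightarrow> h (x \<oplus>\<^bsub>U\<^esub> z) = h x \<oplus>\<^bsub>V\<^esub> h z"
    and k: "\<And>x. x \<in> carrier U \<Longrightarrow> k x \<in> carrier V"
      "\<And>x z. x \<in> carrier U \<Longrightarrow> z \<in> carrier U \<Longrightarrow> k (x \<oplus>\<^bsub>U\<^esub> z) = k x \<oplus>\<^bsub>V\<^esub> k z"
    and eq: "\<And>a t. a \<in> carrier A \<Longrightarrow> t \<in> carrier T \<Longrightarrow> h (pure a t) = k (pure a t)"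
    and x: "x \<in> carrier U"
  shows "h x = k x"
proof -
  interpret V: abelian_group V by fact
  obtain u where u: "Poly_Mapping.keys u \<subseteq> pairs" "x = tclass u" using x unfolding U_carrier by auto
  have "h (tclass u) = k (tclass u)"
  proof (rule free_Abelian_group_induct[OF u(1)])
    have "h \<zero>\<^bsub>U\<^esub> = \<zero>\<^bsub>V\<^esub>" "k \<zero>\<^bsub>U\<^esub> = \<zero>\<^bsub>V\<^esub>"
      by (rule additive_zero[OF U_abelian_group V h], assumption+, rule additive_zero[OF U_abelian_group V k])
    then show "h (tclass 0) = k (tclass 0)" by (simp add: U_zero[symmetric])
  next
    fix v w assume vw: "Poly_Mapping.keys v \<subseteq> pairs" "Poly_Mapping.keys w \<subseteq> pairs"
      and IH: "h (tclass v) = k (tclass v)" "h (tclass w) = k (tclass w)"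
    have c: "tclass v \<in> carrier U" "tclass w \<in> carrier U" using vw by (auto intro: tclass_closed)
    show "h (tclass (v - w)) = k (tclass (v - w))"
      unfolding tclass_diff[OF vw]
      using additive_diff[OF U_abelian_group V h c] additive_diff[OF U_abelian_group V k c] IH by simp
  next
    fix p assume "p \<in> pairs"
    then show "h (tclass (frag_of p)) = k (tclass (frag_of p))"
      using eq[of "fst p" "snd p"] by (auto simp: pure_def)
  qed
  then show ?thesis using u by simp
qed

lemma U_left_module: "left_module A U"
proof -
  have "(a \<oplus>\<^bsub>A\<^esub> b) \<odot>\<^bsub>U\<^esub> x = a \<odot>\<^bsub>U\<^esub> x \<oplus>\<^bsub>U\<^esub> b \<odot>\<^bsub>U\<^esub> x"
    if ab: "a \<in> carrier A" "b \<in> carrier A" and x: "x \<in> carrier U" for a b x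
    by (rule tensor_eqI[OF U_abelian_group _ _ _ _ _ x])
       (use ab in \<open>auto simp: U_smult_closed U_smult_add smult_pure A.l_distr pure_add_left U.a_ac\<close>)
  moreover have "(a \<otimes>\<^bsub>A\<^esub> b) \<odot>\<^bsub>U\<^esub> x = a \<odot>\<^bsub>U\<^esub> (b \<odot>\<^bsub>U\<^esub> x)"
    if ab: "a \<in> carrier A" "b \<in> carrier A" and x: "x \<in> carrier U" for a b x
    by (rule tensor_eqI[OF U_abelian_group _ _ _ _ _ x])
       (use ab in \<open>auto simp: U_smult_closed U_smult_add smult_pure A.m_assoc\<close>)
  moreover have "\<one>\<^bsub>A\<^esub> \<odot>\<^bsub>U\<^esub> x = x" if x: "x \<in> carrier U" for x
    by (rule tensor_eqI[OF U_abelian_group _ _ _ _ _ x])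
       (auto simp: U_smult_closed U_smult_add smult_pure)
  ultimately show ?thesis
    unfolding left_module_def left_module_axioms_def
    by (auto simp: A.ring_axioms U_abelian_group U_smult_closed U_smult_add)
qed

text \<open>The map \<open>g\<close> on the free abelian group vanishes on the defining relations,
  hence on the subgroup \<open>N\<close>; so its value does not depend on the representative that
  \<open>SOME\<close> selects.\<close>

lemma tensor_universal:
  assumes V: "abelian_group V"
    and cl: "\<And>a t. a \<in> carrier A \<Longrightarrow> t \<in> carrier T \<Longrightarrow> f a t \<in> carrier V"
    and add_left: "\<And>a b t. a \<in> carrier A \<Longrightarrow> b \<in> carrier A \<Longrightarrow> t \<in> carrier T \<Longrightarrow>
      f (a \<oplus>\<^bsub>A\<^esub> b) t = f a t \<oplus>\<^bsub>V\<^esub> f b t"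
    and add_right: "\<And>a s t. a \<in> carrier A \<Longrightarrow> s \<in> carrier T \<Longrightarrow> t \<in> carrier T \<Longrightarrow>
      f a (s \<oplus>\<^bsub>T\<^esub> t) = f a s \<oplus>\<^bsub>V\<^esub> f a t"
    and balanced: "\<And>a r t. a \<in> carrier A \<Longrightarrow> r \<in> carrier R \<Longrightarrow> t \<in> carrier T \<Longrightarrow>
      f (a \<otimes>\<^bsub>A\<^esub> \<iota> r) t = f a (r \<odot>\<^bsub>T\<^esub> t)"
  obtains h where "\<And>x. x \<in> carrier U \<Longrightarrow> h x \<in> carrier V"
    "\<And>x z. x \<in> carrier U \<Longrightarrow> z \<in> carrier U \<Longrightarrow> h (x \<oplus>\<^bsub>U\<^esub> z) = h x \<oplus>\<^bsub>V\<^esub> h z"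
    "\<And>a t. a \<in> carrier A \<Longrightarrow> t \<in> carrier T \<Longrightarrow> h (pure a t) = f a t"
proof -
  interpret V: abelian_group V by fact
  obtain g where g: "g \<in> hom F (add_monoid V)"
    and gf: "\<And>p. p \<in> pairs \<Longrightarrow> g (frag_of p) = f (fst p) (snd p)"
    by (rule comm_group.free_Abelian_group_universal[OF V.a_comm_group, of "\<lambda>p. f (fst p) (snd p)" pairs])
       (use cl in auto)
  interpret g: group_hom F "add_monoid V" g
    using g by (simp add: group_hom_def group_hom_axioms_def V.a_group)
  have gc: "g x \<in> carrier V" if "Poly_Mapping.keys x \<subseteq> pairs" for x using g.hom_closed[of x] that by simp
  have gadd: "g (x + z) = g x \<oplus>\<^bsub>V\<^esub> g z" if "Poly_Mapping.keys x \<subseteq> pairs" "Poly_Mapping.keys z \<subseteq> pairs" for x z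
    using g.hom_mult[of x z] that by simp
  have gneg: "g (- x) = \<ominus>\<^bsub>V\<^esub> g x" if "Poly_Mapping.keys x \<subseteq> pairs" for x
    using g.hom_inv[of x] that by (simp add: a_inv_def)
  have gdiff: "g (x - z) = g x \<ominus>\<^bsub>V\<^esub> g z" if "Poly_Mapping.keys x \<subseteq> pairs" "Poly_Mapping.keys z \<subseteq> pairs" for x z
    using gadd[of x "- z"] gneg[of z] that by (simp add: a_minus_def)
  have cancel: "(u \<oplus>\<^bsub>V\<^esub> v) \<ominus>\<^bsub>V\<^esub> u \<ominus>\<^bsub>V\<^esub> v = \<zero>\<^bsub>V\<^esub>" if "u \<in> carrier V" "v \<in> carrier V" for u v
  proof -
    have "(u \<oplus>\<^bsub>V\<^esub> v) \<ominus>\<^bsub>V\<^esub> u \<ominus>\<^bsub>V\<^esub> v = (u \<oplus>\<^bsub>V\<^esub> v) \<oplus>\<^bsub>V\<^esub> \<ominus>\<^bsub>V\<^esub> (u \<oplus>\<^bsub>V\<^esub> v)"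
      using that by (simp add: a_minus_def V.a_assoc V.minus_add)
    also have "\<dots> = \<zero>\<^bsub>V\<^esub>" by (rule V.r_neg) (use that in simp)
    finally show ?thesis .
  qed
  have "g x = \<zero>\<^bsub>V\<^esub>" if x: "x \<in> rels" for x
    using x
  proof (cases rule: rels_cases)
    case (left b c t)
    then show ?thesis using cl by (simp add: gdiff keys_diffI gf add_left cancel)
  next
    case (right b s t)
    then show ?thesis using cl by (simp add: gdiff keys_diffI gf add_right cancel)
  next
    case bal: (balanced b r t)
    then show ?thesis using cl by (simp add: gdiff gf balanced a_minus_def V.r_neg)
  qed
  then have "rels \<subseteq> kernel F (add_monoid V) g" using rels_carrier
    unfolding kernel_def by (intro subsetI CollectI conjI) (blast, simp)
  then have N_ker: "N \<subseteq> kernel F (add_monoid V) g"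
    by (rule group.generate_subgroup_incl[OF group_free_Abelian_group _ g.subgroup_kernel])
  define h where "h C = g (SOME u. Poly_Mapping.keys u \<subseteq> pairs \<and> C = tclass u)" for C
  have h: "h (tclass u) = g u" if u: "Poly_Mapping.keys u \<subseteq> pairs" for u
  proof -
    let ?v = "SOME v. Poly_Mapping.keys v \<subseteq> pairs \<and> tclass u = tclass v"
    have v: "Poly_Mapping.keys ?v \<subseteq> pairs \<and> tclass u = tclass ?v" by (rule someI[of _ u]) (use u in simp)
    then have "u - ?v \<in> kernel F (add_monoid V) g" using tclass_eqD N_ker by blast
    then have "g u \<ominus>\<^bsub>V\<^esub> g ?v = \<zero>\<^bsub>V\<^esub>" using gdiff[OF u, of ?v] v by (simp add: kernel_def)
    then have "\<ominus>\<^bsub>V\<^esub> (\<ominus>\<^bsub>V\<^esub> g ?v) = g u"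
      by (intro V.minus_equality) (use gc u v in \<open>simp_all add: a_minus_def\<close>)
    then show ?thesis unfolding h_def using gc v by simp
  qed
  show ?thesis
  proof (rule that[of h])
    fix x assume "x \<in> carrier U"
    then obtain u where u: "Poly_Mapping.keys u \<subseteq> pairs" "x = tclass u" unfolding U_carrier by auto
    show "h x \<in> carrier V" using h u gc by simp
    fix z assume "z \<in> carrier U"
    then obtain v where v: "Poly_Mapping.keys v \<subseteq> pairs" "z = tclass v" unfolding U_carrier by auto
    have "Poly_Mapping.keys (u + v) \<subseteq> pairs" using keys_add[of u v] u v by blast
    then show "h (x \<oplus>\<^bsub>U\<^esub> z) = h x \<oplus>\<^bsub>V\<^esub> h z" using u v h gadd by (simp add: U_add)
  next
    show "h (pure a t) = f a t" if "a \<in> carrier A" "t \<in> carrier T" for a t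
      unfolding pure_def using that h gf by simp
  qed
qed

end

context frobenius_system
begin

text \<open>\<open>\<epsilon>\<close> comes from the map
  \<open>(a, t) \<mapsto> E a \<odot> t\<close>, which is balanced because \<open>E\<close> is right
  linear over \<open>R\<close>; its own linearity over \<open>R\<close> comes from
  \<open>E_left\<close>.\<close>

lemma induced_extend_scalars:
  assumes T: "left_module R T"
  obtains \<eta> \<epsilon> where "induced T (extend_scalars R A \<iota> T) \<eta> \<epsilon>"
proof -
  interpret tensor_product R A \<iota> T by (intro tensor_product.intro extension T)
  interpret U': left_module A U by (rule U_left_module)
  have lU: "left_module R (restrict_scalars \<iota> U)"
    by (rule restrict_scalars_left_module[OF extension U_left_module])
  obtain \<epsilon> where \<epsilon>c: "\<And>x. x \<in> carrier U \<Longrightarrow> \<epsilon> x \<in> carrier T"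
    and \<epsilon>a: "\<And>x z. x \<in> carrier U \<Longrightarrow> z \<in> carrier U \<Longrightarrow> \<epsilon> (x \<oplus>\<^bsub>U\<^esub> z) = \<epsilon> x \<oplus>\<^bsub>T\<^esub> \<epsilon> z"
    and \<epsilon>p: "\<And>a t. a \<in> carrier A \<Longrightarrow> t \<in> carrier T \<Longrightarrow> \<epsilon> (pure a t) = E a \<odot>\<^bsub>T\<^esub> t"
    by (rule tensor_universal[OF T.M.abelian_group_axioms, of "\<lambda>a t. E a \<odot>\<^bsub>T\<^esub> t"])
       (auto simp: E_add E_right T.smult_l_distr T.smult_r_distr T.smult_assoc1)
  define \<eta> where "\<eta> t = pure \<one>\<^bsub>A\<^esub> t" for t
  have \<eta>c: "\<eta> t \<in> carrier U" if "t \<in> carrier T" for t using that by (simp add: \<eta>_def)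
  have \<eta>: "module_map R T (restrict_scalars \<iota> U) \<eta>"
    using pure_balanced[of "\<one>\<^bsub>A\<^esub>"]
    by (intro module_mapI) (auto simp: \<eta>_def pure_add_right smult_pure)
  have "\<epsilon> (\<iota> r \<odot>\<^bsub>U\<^esub> x) = r \<odot>\<^bsub>T\<^esub> \<epsilon> x" if r: "r \<in> carrier R" and x: "x \<in> carrier U" for r x
    by (rule tensor_eqI[OF T.M.abelian_group_axioms _ _ _ _ _ x])
       (use r in \<open>auto simp: \<epsilon>c \<epsilon>a \<epsilon>p U_smult_closed U_smult_add T.smult_r_distr smult_pure E_left T.smult_assoc1\<close>)
  then have \<epsilon>: "module_map R (restrict_scalars \<iota> U) T \<epsilon>"
    by (intro module_mapI) (auto simp: \<epsilon>c \<epsilon>a)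
  \<comment> \<open>The expansion condition says that \<open>\<Phi>\<close> is the identity. On a
    pure tensor it becomes \<open>dual_right\<close> once the scalar
    \<open>E (y i \<otimes> a)\<close> has been moved across the tensor sign.\<close>
  define \<Phi> where "\<Phi> x = finsum U (\<lambda>i. b i \<odot>\<^bsub>U\<^esub> \<eta> (\<epsilon> (y i \<odot>\<^bsub>U\<^esub> x))) I" for x
  have term_closed: "b i \<odot>\<^bsub>U\<^esub> \<eta> (\<epsilon> (y i \<odot>\<^bsub>U\<^esub> x)) \<in> carrier U" if "i \<in> I" "x \<in> carrier U" for i x
    using that by (intro U_smult_closed \<eta>c \<epsilon>c) simp_all
  have \<Phi>_eq: "\<Phi> x = x" if x: "x \<in> carrier U" for x
  proof (rule tensor_eqI[OF U_abelian_group _ _ _ _ _ x])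
    fix x assume x: "x \<in> carrier U"
    show "\<Phi> x \<in> carrier U" unfolding \<Phi>_def by (rule U.finsum_closed) (use term_closed x in auto)
    fix z assume z: "z \<in> carrier U"
    have "\<Phi> (x \<oplus>\<^bsub>U\<^esub> z) = finsum U (\<lambda>i. b i \<odot>\<^bsub>U\<^esub> \<eta> (\<epsilon> (y i \<odot>\<^bsub>U\<^esub> x)) \<oplus>\<^bsub>U\<^esub> b i \<odot>\<^bsub>U\<^esub> \<eta> (\<epsilon> (y i \<odot>\<^bsub>U\<^esub> z))) I"
      unfolding \<Phi>_def
    proof (rule U.finsum_cong')
      fix i assume i: "i \<in> I"
      have c: "y i \<odot>\<^bsub>U\<^esub> x \<in> carrier U" "y i \<odot>\<^bsub>U\<^esub> z \<in> carrier U" using i x z by (simp_all add: U_smult_closed)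
      have "\<eta> (\<epsilon> (y i \<odot>\<^bsub>U\<^esub> (x \<oplus>\<^bsub>U\<^esub> z))) = \<eta> (\<epsilon> (y i \<odot>\<^bsub>U\<^esub> x)) \<oplus>\<^bsub>U\<^esub> \<eta> (\<epsilon> (y i \<odot>\<^bsub>U\<^esub> z))"
        using module_map_add[OF \<eta> \<epsilon>c[OF c(1)] \<epsilon>c[OF c(2)]] i x z c by (simp add: U_smult_add \<epsilon>a)
      then show "b i \<odot>\<^bsub>U\<^esub> \<eta> (\<epsilon> (y i \<odot>\<^bsub>U\<^esub> (x \<oplus>\<^bsub>U\<^esub> z))) =
          b i \<odot>\<^bsub>U\<^esub> \<eta> (\<epsilon> (y i \<odot>\<^bsub>U\<^esub> x)) \<oplus>\<^bsub>U\<^esub> b i \<odot>\<^bsub>U\<^esub> \<eta> (\<epsilon> (y i \<odot>\<^bsub>U\<^esub> z))"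
        using U_smult_add[OF b_closed[OF i] \<eta>c[OF \<epsilon>c[OF c(1)]] \<eta>c[OF \<epsilon>c[OF c(2)]]] by simp
    qed (use term_closed x z in auto)
    also have "\<dots> = \<Phi> x \<oplus>\<^bsub>U\<^esub> \<Phi> z"
      unfolding \<Phi>_def by (rule U.finsum_addf) (use term_closed x z in auto)
    finally show "\<Phi> (x \<oplus>\<^bsub>U\<^esub> z) = \<Phi> x \<oplus>\<^bsub>U\<^esub> \<Phi> z" .
  next
    fix a t assume a: "a \<in> carrier A" and t: "t \<in> carrier T"
    have "\<Phi> (pure a t) = finsum U (\<lambda>i. pure (b i \<otimes>\<^bsub>A\<^esub> \<iota> (E (y i \<otimes>\<^bsub>A\<^esub> a))) t) I"
      unfolding \<Phi>_def
      by (rule U.finsum_cong') (use a t in \<open>auto simp: smult_pure \<epsilon>p \<eta>_def pure_balanced[symmetric]\<close>)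
    also have "\<dots> = pure (finsum A (\<lambda>i. b i \<otimes>\<^bsub>A\<^esub> \<iota> (E (y i \<otimes>\<^bsub>A\<^esub> a))) I) t"
      by (rule additive_finsum[where h = "\<lambda>c. pure c t", symmetric])
         (use a t in \<open>auto simp: A.abelian_group_axioms U_abelian_group pure_add_left\<close>)
    also have "\<dots> = pure a t" by (simp only: dual_right[OF a])
    finally show "\<Phi> (pure a t) = pure a t" .
  qed auto
  have "\<epsilon> (a \<odot>\<^bsub>U\<^esub> \<eta> t) = E a \<odot>\<^bsub>T\<^esub> t" if "a \<in> carrier A" "t \<in> carrier T" for a t
    using that by (simp add: \<eta>_def smult_pure \<epsilon>p)
  then have "induced T U \<eta> \<epsilon>"
    unfolding induced_def using T U_left_module \<eta> \<epsilon> \<Phi>_eq[unfolded \<Phi>_def] by blast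
  then show ?thesis by (rule that)
qed

end

text \<open>With \<open>E = \<phi> 1\<close>, left compatibility says that \<open>\<phi> a\<close>
  is \<open>E (- \<otimes> a)\<close>. A dual basis of the left module \<open>A\<close> consists of
  elements \<open>y i\<close> and coordinate functionals, and \<open>\<phi>\<close> turns the
  functionals into elements \<open>b i\<close>. The second dual basis identity follows from the
  first by injectivity of \<open>\<phi>\<close>.\<close>

lemma frobenius_extension_system:
  assumes frob: "frobenius_extension R A \<iota>"
  obtains E n b y where "frobenius_system R A \<iota> E {..<n::nat} b y"
proof -
  have ext: "ring_extension R A \<iota>" using frob by (simp add: frobenius_extension_def)
  then have R: "ring R" and A: "ring A" and iota: "\<iota> \<in> ring_hom R A" by (auto simp: ring_extension_def)
  interpret R: ring R by (rule R)
  interpret A: ring A by (rule A)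
  note [simp] = ring_hom_closed[OF iota]
  define AR where "AR = restrict_scalars \<iota> (regular_module A)"
  have ARs [simp]: "carrier AR = carrier A" "x \<oplus>\<^bsub>AR\<^esub> z = x \<oplus>\<^bsub>A\<^esub> z" "r \<odot>\<^bsub>AR\<^esub> x = \<iota> r \<otimes>\<^bsub>A\<^esub> x" for r x z
    by (simp_all add: AR_def)
  obtain \<phi> where fg: "fin_gen R AR" and pr: "projective R AR"
    and iso: "\<phi> \<in> iso (add_monoid A) (hom_group R AR (regular_module R))"
    and \<phi>l: "\<And>a c. a \<in> carrier A \<Longrightarrow> c \<in> carrier A \<Longrightarrow> \<phi> (a \<otimes>\<^bsub>A\<^esub> c) = (\<lambda>x\<in>carrier A. \<phi> c (x \<otimes>\<^bsub>A\<^esub> a))"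
    and \<phi>r: "\<And>c r. c \<in> carrier A \<Longrightarrow> r \<in> carrier R \<Longrightarrow> \<phi> (c \<otimes>\<^bsub>A\<^esub> \<iota> r) = (\<lambda>x\<in>carrier A. \<phi> c x \<otimes>\<^bsub>R\<^esub> r)"
    using frob unfolding frobenius_extension_def Let_def AR_def[symmetric] by (elim conjE bexE) auto
  have lAR: "left_module R AR" by (rule projective_left_module[OF pr])
  interpret AR: left_module R AR by (rule lAR)
  have bij: "bij_betw \<phi> (carrier A) (mod_hom R AR (regular_module R))"
    using iso by (simp add: iso_def hom_group_def)
  define E where "E = \<phi> \<one>\<^bsub>A\<^esub>"
  have E: "module_map R AR (regular_module R) E"
    using bij_betwE[OF bij] A.one_closed by (auto simp: E_def mod_hom_iff)
  have \<phi>E: "\<phi> a = (\<lambda>x\<in>carrier A. E (x \<otimes>\<^bsub>A\<^esub> a))" if "a \<in> carrier A" for a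
    using \<phi>l[OF that A.one_closed] that by (simp add: E_def)
  have Ec: "E a \<in> carrier R" if "a \<in> carrier A" for a using module_map_closed[OF E] that by simp
  have Ea: "E (a \<oplus>\<^bsub>A\<^esub> c) = E a \<oplus>\<^bsub>R\<^esub> E c" if "a \<in> carrier A" "c \<in> carrier A" for a c
    using module_map_add[OF E] that by simp
  have El: "E (\<iota> r \<otimes>\<^bsub>A\<^esub> a) = r \<otimes>\<^bsub>R\<^esub> E a" if "r \<in> carrier R" "a \<in> carrier A" for r a
    using module_map_smult[OF E that(1), of a] that by simp
  \<comment> \<open>The two compatibilities compute \<open>\<phi> (\<iota> r)\<close> in two ways:
    as \<open>E (- \<otimes> \<iota> r)\<close> and as \<open>E\<close> followed by right
    multiplication with \<open>r\<close>.\<close>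
  have Er: "E (a \<otimes>\<^bsub>A\<^esub> \<iota> r) = E a \<otimes>\<^bsub>R\<^esub> r" if "r \<in> carrier R" "a \<in> carrier A" for r a
  proof -
    have "(\<lambda>x\<in>carrier A. E (x \<otimes>\<^bsub>A\<^esub> \<iota> r)) = (\<lambda>x\<in>carrier A. E x \<otimes>\<^bsub>R\<^esub> r)"
      using \<phi>r[OF A.one_closed that(1)] \<phi>E[of "\<iota> r"] that by (simp add: E_def)
    from fun_cong[OF this, of a] show ?thesis using that by simp
  qed
  have E_sum: "E (finsum A f S) = finsum R (\<lambda>i. E (f i)) S" if "\<And>i. i \<in> S \<Longrightarrow> f i \<in> carrier A"
    for f and S :: "nat set"
    by (rule additive_finsum) (use that Ec Ea in \<open>auto simp: A.abelian_group_axioms R.abelian_group_axioms\<close>)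
  obtain n :: nat where "retract R AR (free_module {..<n} R)" by (rule fin_gen_projective_retract[OF pr fg])
  then obtain s t where s: "module_map R AR (free_module {..<n} R) s"
    and t: "module_map R (free_module {..<n} R) AR t" and ts: "\<And>x. x \<in> carrier AR \<Longrightarrow> t (s x) = x"
    unfolding retract_def by blast
  define y where "y i = t (free_basis {..<n} R i)" for i
  have y: "y i \<in> carrier A" if "i < n" for i
    unfolding y_def using module_map_closed[OF t free_basis_closed[OF R]] that by simp
  have si: "module_map R AR (regular_module R) (\<lambda>x. s x i)" if "i < n" for i
    by (rule module_map_comp[OF s copower_eval_map]) (use that in simp)
  \<comment> \<open>The element of \<open>A\<close> that represents the \<open>i\<close>-th
    coordinate functional of the splitting \<open>s\<close> in the form
    \<open>E (- \<otimes> b i)\<close>.\<close>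
  define b where "b i = inv_into (carrier A) \<phi> (restrict (\<lambda>x. s x i) (carrier A))" for i
  have \<phi>b: "restrict (\<lambda>x. s x i) (carrier A) \<in> \<phi> ` carrier A" if "i < n" for i
    using restrict_mod_hom[OF lAR si[OF that]] bij by (simp add: bij_betw_def)
  have b1: "b i \<in> carrier A" if "i < n" for i
    unfolding b_def by (rule inv_into_into[OF \<phi>b[OF that]])
  have "E (x \<otimes>\<^bsub>A\<^esub> b i) = s x i" if i: "i < n" and x: "x \<in> carrier A" for i x
  proof -
    have "\<phi> (b i) = restrict (\<lambda>x. s x i) (carrier A)" unfolding b_def by (rule f_inv_into_f[OF \<phi>b[OF i]])
    from fun_cong[OF this, of x] show "E (x \<otimes>\<^bsub>A\<^esub> b i) = s x i" using \<phi>E[OF b1[OF i]] x by simp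
  qed
  note b = b1 this
  have left: "finsum A (\<lambda>i. \<iota> (E (a \<otimes>\<^bsub>A\<^esub> b i)) \<otimes>\<^bsub>A\<^esub> y i) {..<n} = a" if a: "a \<in> carrier A" for a
  proof -
    have sa: "s a \<in> carrier (free_module {..<n} R)" using module_map_closed[OF s] a by simp
    have sai: "s a i \<in> carrier R" if "i < n" for i using module_map_closed[OF si[OF that]] a by simp
    have "a = t (s a)" using ts a by simp
    also have "\<dots> = finsum AR (\<lambda>i. s a i \<odot>\<^bsub>AR\<^esub> t (free_basis {..<n} R i)) {..<n}"
      by (rule module_map_free_eq[OF R lAR t sa]) auto
    also have "\<dots> = finsum A (\<lambda>i. s a i \<odot>\<^bsub>AR\<^esub> t (free_basis {..<n} R i)) {..<n}"
      by (rule additive_finsum[where h = "\<lambda>x. x"])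
         (use sai y in \<open>auto simp: A.abelian_group_axioms AR.M.abelian_group_axioms y_def[symmetric]\<close>)
    also have "\<dots> = finsum A (\<lambda>i. \<iota> (E (a \<otimes>\<^bsub>A\<^esub> b i)) \<otimes>\<^bsub>A\<^esub> y i) {..<n}"
      by (rule A.finsum_cong') (use a b sai y in \<open>auto simp: y_def[symmetric]\<close>)
    finally show ?thesis ..
  qed
  have right: "finsum A (\<lambda>i. b i \<otimes>\<^bsub>A\<^esub> \<iota> (E (y i \<otimes>\<^bsub>A\<^esub> a))) {..<n} = a" if a: "a \<in> carrier A" for a
  proof -
    let ?w = "finsum A (\<lambda>i. b i \<otimes>\<^bsub>A\<^esub> \<iota> (E (y i \<otimes>\<^bsub>A\<^esub> a))) {..<n}"
    have c: "\<iota> (E (y i \<otimes>\<^bsub>A\<^esub> a)) \<in> carrier A" if "i < n" for i using that a y Ec by simp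
    have w: "?w \<in> carrier A" by (rule A.finsum_closed) (use b c in auto)
    \<comment> \<open>Since \<open>\<phi>\<close> is injective, it is enough to test against all
      \<open>z\<close>. Right linearity takes the inner value of \<open>E\<close> out and left
      linearity puts the other one in, which produces the left expansion of \<open>z\<close>
      multiplied by \<open>a\<close>.\<close>
    have "E (z \<otimes>\<^bsub>A\<^esub> ?w) = E (z \<otimes>\<^bsub>A\<^esub> a)" if z: "z \<in> carrier A" for z
    proof -
      have "z \<otimes>\<^bsub>A\<^esub> ?w = finsum A (\<lambda>i. z \<otimes>\<^bsub>A\<^esub> (b i \<otimes>\<^bsub>A\<^esub> \<iota> (E (y i \<otimes>\<^bsub>A\<^esub> a)))) {..<n}"
        by (rule additive_finsum[where h = "\<lambda>x. z \<otimes>\<^bsub>A\<^esub> x"])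
           (use z b c in \<open>auto simp: A.abelian_group_axioms A.r_distr\<close>)
      then have "E (z \<otimes>\<^bsub>A\<^esub> ?w) = finsum R (\<lambda>i. E (z \<otimes>\<^bsub>A\<^esub> (b i \<otimes>\<^bsub>A\<^esub> \<iota> (E (y i \<otimes>\<^bsub>A\<^esub> a))))) {..<n}"
        using E_sum[of "{..<n}" "\<lambda>i. z \<otimes>\<^bsub>A\<^esub> (b i \<otimes>\<^bsub>A\<^esub> \<iota> (E (y i \<otimes>\<^bsub>A\<^esub> a)))"] z b c by simp
      also have "\<dots> = finsum R (\<lambda>i. E ((\<iota> (E (z \<otimes>\<^bsub>A\<^esub> b i)) \<otimes>\<^bsub>A\<^esub> y i) \<otimes>\<^bsub>A\<^esub> a)) {..<n}"
      proof (rule R.finsum_cong')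
        fix i assume "i \<in> {..<n}"
        then have i: "i < n" by simp
        note bi = b(1)[OF i] and yi = y[OF i]
        have "E (z \<otimes>\<^bsub>A\<^esub> (b i \<otimes>\<^bsub>A\<^esub> \<iota> (E (y i \<otimes>\<^bsub>A\<^esub> a)))) = E ((z \<otimes>\<^bsub>A\<^esub> b i) \<otimes>\<^bsub>A\<^esub> \<iota> (E (y i \<otimes>\<^bsub>A\<^esub> a)))"
          using z bi c[OF i] by (simp add: A.m_assoc)
        also have "\<dots> = E (z \<otimes>\<^bsub>A\<^esub> b i) \<otimes>\<^bsub>R\<^esub> E (y i \<otimes>\<^bsub>A\<^esub> a)"
          by (rule Er) (use z bi yi a Ec in simp_all)
        also have "\<dots> = E (\<iota> (E (z \<otimes>\<^bsub>A\<^esub> b i)) \<otimes>\<^bsub>A\<^esub> (y i \<otimes>\<^bsub>A\<^esub> a))"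
          by (rule El[symmetric]) (use z bi yi a Ec in simp_all)
        finally show "E (z \<otimes>\<^bsub>A\<^esub> (b i \<otimes>\<^bsub>A\<^esub> \<iota> (E (y i \<otimes>\<^bsub>A\<^esub> a)))) = E ((\<iota> (E (z \<otimes>\<^bsub>A\<^esub> b i)) \<otimes>\<^bsub>A\<^esub> y i) \<otimes>\<^bsub>A\<^esub> a)"
          using z bi yi a Ec by (simp add: A.m_assoc)
      qed (use z b(1) y a Ec in auto)
      also have "\<dots> = E (finsum A (\<lambda>i. (\<iota> (E (z \<otimes>\<^bsub>A\<^esub> b i)) \<otimes>\<^bsub>A\<^esub> y i) \<otimes>\<^bsub>A\<^esub> a) {..<n})"
        by (rule E_sum[symmetric]) (use z b(1) y a Ec in auto)
      also have "finsum A (\<lambda>i. (\<iota> (E (z \<otimes>\<^bsub>A\<^esub> b i)) \<otimes>\<^bsub>A\<^esub> y i) \<otimes>\<^bsub>A\<^esub> a) {..<n}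
          = finsum A (\<lambda>i. \<iota> (E (z \<otimes>\<^bsub>A\<^esub> b i)) \<otimes>\<^bsub>A\<^esub> y i) {..<n} \<otimes>\<^bsub>A\<^esub> a"
        by (rule additive_finsum[where h = "\<lambda>x. x \<otimes>\<^bsub>A\<^esub> a", symmetric])
           (use z b(1) y a Ec in \<open>auto simp: A.abelian_group_axioms A.l_distr\<close>)
      also have "\<dots> = z \<otimes>\<^bsub>A\<^esub> a" by (simp only: left[OF z])
      finally show ?thesis .
    qed
    then have "\<phi> ?w = \<phi> a" unfolding \<phi>E[OF w] \<phi>E[OF a] by (rule restrict_ext)
    then show ?thesis using bij w a by (auto simp: bij_betw_def dest: inj_onD)
  qed
  have "frobenius_system R A \<iota> E {..<n} b y"
    by unfold_locales (use ext Ec Ea El Er b(1) y left right in auto)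
  then show ?thesis by (rule that)
qed

section \<open>Coresolutions and cosyzygies\<close>

text \<open>A retraction onto a finite power splits into finitely many pairs of maps through the
  module itself. This is the form that \<open>ext_vanishes_sum_retract\<close> asks for, so that
  Ext-vanishing passes from \<open>T\<close> to its add-class without a resolution of the
  power.\<close>

lemma retract_sum:
  assumes T: "left_module R T" and N: "left_module R N" and J: "finite J"
    and ret: "retract R N (copower J T)"
  obtains s t where "\<And>i. i \<in> J \<Longrightarrow> module_map R N T (s i)" "\<And>i. i \<in> J \<Longrightarrow> module_map R T N (t i)"
    "\<And>x. x \<in> carrier N \<Longrightarrow> finsum N (\<lambda>i. t i (s i x)) J = x"
proof -
  have C: "left_module R (copower J T)" by (rule copower_left_module[OF T])
  obtain s t where s: "module_map R N (copower J T) s" and t: "module_map R (copower J T) N t"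
    and ts: "\<And>x. x \<in> carrier N \<Longrightarrow> t (s x) = x" using ret unfolding retract_def by blast
  have si: "module_map R N T (\<lambda>x. s x i)" if "i \<in> J" for i
    by (rule module_map_comp[OF s copower_eval_map[OF that]])
  have ti: "module_map R T N (\<lambda>v. t (copower_in J T i v))" if "i \<in> J" for i
    by (rule module_map_comp[OF copower_in_map[OF T that] t])
  have "finsum N (\<lambda>i. t (copower_in J T i (s x i))) J = x" if x: "x \<in> carrier N" for x
  proof -
    note sx = module_map_closed[OF s x]
    have "t (finsum (copower J T) (\<lambda>i. copower_in J T i (s x i)) J) = finsum N (\<lambda>i. t (copower_in J T i (s x i))) J"
      by (rule module_map_finsum[OF C N t]) (rule module_map_closed[OF copower_in_map[OF T] module_map_closed[OF si x]])
    moreover have "finsum (copower J T) (\<lambda>i. copower_in J T i (s x i)) J = s x"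
      by (rule copower_decomp[OF T sx J, symmetric]) auto
    ultimately show ?thesis using ts[OF x] by simp
  qed
  with si ti show ?thesis by (rule that[of "\<lambda>i x. s x i" "\<lambda>i v. t (copower_in J T i v)"])
qed

lemma add_class_iff_retract:
  assumes T: "left_module R T"
  shows "N \<in> add_class R T \<longleftrightarrow> left_module R N \<and> (\<exists>n::nat. retract R N (copower {..<n} T))"
  unfolding add_class_def using direct_summand_iff_retract[OF _ copower_left_module[OF T]] by blast

lemma add_class_ext_vanishes:
  assumes N: "N \<in> add_class R T" and P: "resolves R T P d e" and Q: "resolves R N Q d' e'"
    and M: "left_module R M" and van: "ext_vanishes R P d M"
  shows "ext_vanishes R Q d' M"
proof -
  have T: "left_module R T" by (rule resolves_modules(1)[OF P])
  obtain n :: nat where lN: "left_module R N" and ret: "retract R N (copower {..<n} T)"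
    using N unfolding add_class_iff_retract[OF T] by blast
  obtain s t where "\<And>i. i \<in> {..<n} \<Longrightarrow> module_map R N T (s i)" "\<And>i. i \<in> {..<n} \<Longrightarrow> module_map R T N (t i)"
    "\<And>x. x \<in> carrier N \<Longrightarrow> finsum N (\<lambda>i. t i (s i x)) {..<n} = x"
    by (rule retract_sum[OF T lN finite_lessThan ret]) (rule that)
  then show ?thesis by (rule ext_vanishes_sum_retract[OF Q P M _ _ _ van])
qed

text \<open>The resolution has \<open>X\<close> in degree 0 and zero modules above, so every cochain
  of positive degree is zero.\<close>

lemma projective_ext_vanishes:
  fixes X :: "('r, 'x) module"
  assumes X: "projective R X"
  obtains P :: "nat \<Rightarrow> ('r, 'x) module" and d e where "resolves R X P d e"
    "\<And>M :: ('r, 'm) module. left_module R M \<Longrightarrow> ext_vanishes R P d M"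
proof -
  have lX: "left_module R X" by (rule projective_left_module[OF X])
  interpret X: left_module R X by (rule lX)
  let ?Z = "X\<lparr>carrier := {\<zero>\<^bsub>X\<^esub>}\<rparr>"
  define P where "P i = (if i = 0 then X else ?Z)" for i :: nat
  have P [simp]: "P 0 = X" "P (Suc i) = ?Z" for i by (simp_all add: P_def)
  have pZ: "projective R ?Z" by (rule zero_module_projective[OF lX])
  have lZ: "left_module R ?Z" by (rule projective_left_module[OF pZ])
  have d: "module_map R (P (Suc i)) (P i) (\<lambda>_. \<zero>\<^bsub>X\<^esub>)" for i
    using module_map_const_zero[OF lX, of ?Z] module_map_const_zero[OF lZ, of ?Z] by (cases i) simp_all
  have pr: "projective R (P i)" for i using X pZ by (cases i) simp_all
  have "resolves R X P (\<lambda>_ _. \<zero>\<^bsub>X\<^esub>) (\<lambda>x. x)"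
    unfolding resolves_def
  proof (intro conjI allI lX pr d)
    show "module_map R (P 0) X (\<lambda>x. x)" by (simp add: module_map_id)
    fix i show "(\<lambda>_. \<zero>\<^bsub>X\<^esub>) ` carrier (P (Suc (Suc i))) = {x \<in> carrier (P (Suc i)). \<zero>\<^bsub>X\<^esub> = \<zero>\<^bsub>P i\<^esub>}"
      by (cases i) auto
  qed auto
  moreover have "ext_vanishes R P (\<lambda>_ _. \<zero>\<^bsub>X\<^esub>) M" if M: "left_module R M" for M :: "('r, 'm) module"
    unfolding ext_vanishes_def
  proof (intro allI impI)
    fix i z assume "module_map R (P (Suc i)) M z"
    then have "z \<zero>\<^bsub>X\<^esub> = \<zero>\<^bsub>M\<^esub>" using module_map_zero[OF lZ M, of z] by simp
    then show "\<exists>w. module_map R (P i) M w \<and> (\<forall>x\<in>carrier (P (Suc i)). z x = w \<zero>\<^bsub>X\<^esub>)"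
      by (intro exI[of _ "\<lambda>_. \<zero>\<^bsub>M\<^esub>"] conjI module_map_const_zero[OF M]) simp
  qed
  ultimately show ?thesis by (rule that)
qed

section \<open>Exactness of Hom sequences in elementwise form\<close>

lemma pullback_surj_iff:
  assumes K: "left_module R K" and L: "left_module R L" and f: "module_map R K L f"
  shows "pullback K f ` mod_hom R L M = mod_hom R K M \<longleftrightarrow>
    (\<forall>g. module_map R K M g \<longrightarrow> (\<exists>w. module_map R L M w \<and> (\<forall>x\<in>carrier K. g x = w (f x))))"
    (is "?l \<longleftrightarrow> ?r")
proof
  assume l: ?l
  show ?r
  proof (intro allI impI)
    fix g assume "module_map R K M g"
    then have "restrict g (carrier K) \<in> pullback K f ` mod_hom R L M"
      using restrict_mod_hom[OF K] l by auto
    then obtain w where w: "w \<in> mod_hom R L M" and e: "restrict g (carrier K) = pullback K f w" by (elim imageE)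
    have "g x = w (f x)" if "x \<in> carrier K" for x
      using fun_cong[OF e, of x] that by (simp add: pullback_def compose_def)
    then show "\<exists>w. module_map R L M w \<and> (\<forall>x\<in>carrier K. g x = w (f x))"
      using w by (intro exI[of _ w] conjI ballI) (simp_all add: mod_hom_iff)
  qed
next
  assume r: ?r
  show ?l
  proof (intro equalityI subsetI)
    fix g assume "g \<in> pullback K f ` mod_hom R L M"
    then obtain w where w: "w \<in> mod_hom R L M" and e: "g = pullback K f w" by (elim imageE)
    have "module_map R L M w" using w by (simp add: mod_hom_iff)
    from restrict_mod_hom[OF K module_map_comp[OF f this]]
    show "g \<in> mod_hom R K M" by (simp add: e pullback_def compose_def)
  next
    fix g assume g: "g \<in> mod_hom R K M"
    then have "module_map R K M g" by (simp add: mod_hom_iff)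
    then obtain w where w: "module_map R L M w" "\<forall>x\<in>carrier K. g x = w (f x)" using r by meson
    have "g = pullback K f (restrict w (carrier L))"
    proof (rule extensionalityI[of _ "carrier K"])
      show "g x = pullback K f (restrict w (carrier L)) x" if "x \<in> carrier K" for x
        using that w(2) module_map_closed[OF f that] by (simp add: pullback_def compose_def)
    qed (use g in \<open>simp_all add: mod_hom_iff pullback_def compose_def\<close>)
    then show "g \<in> pullback K f ` mod_hom R L M" by (intro image_eqI[where x = "restrict w (carrier L)"] restrict_mod_hom[OF L w(1)])
  qed
qed

lemma pullback_exact_iff:
  assumes K: "left_module R K" and L: "left_module R L" and N: "left_module R N" and M: "left_module R M"
    and f: "module_map R K L f" and k: "module_map R L N k"
    and kf: "\<And>x. x \<in> carrier K \<Longrightarrow> k (f x) = \<zero>\<^bsub>N\<^esub>"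
  shows "exact_at (hom_group R N M) (pullback L k) (hom_group R L M) (pullback K f) (hom_group R K M) \<longleftrightarrow>
    (\<forall>g. module_map R L M g \<longrightarrow> (\<forall>x\<in>carrier K. g (f x) = \<zero>\<^bsub>M\<^esub>) \<longrightarrow>
      (\<exists>w. module_map R N M w \<and> (\<forall>x\<in>carrier L. g x = w (k x))))"
    (is "?l \<longleftrightarrow> ?r")
proof -
  have ker: "g \<in> kernel (hom_group R L M) (hom_group R K M) (pullback K f) \<longleftrightarrow>
      g \<in> mod_hom R L M \<and> (\<forall>x\<in>carrier K. g (f x) = \<zero>\<^bsub>M\<^esub>)" for g
    by (auto simp: kernel_def hom_group_def pullback_def compose_def fun_eq_iff)
  have l: "?l \<longleftrightarrow> pullback L k ` mod_hom R N M = kernel (hom_group R L M) (hom_group R K M) (pullback K f)"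
    by (simp add: exact_at_def hom_group_def)
  show ?thesis
  proof
    assume ?l
    then have l: "pullback L k ` mod_hom R N M = kernel (hom_group R L M) (hom_group R K M) (pullback K f)"
      using l by simp
    show ?r
    proof (intro allI impI)
      fix g assume g: "module_map R L M g" "\<forall>x\<in>carrier K. g (f x) = \<zero>\<^bsub>M\<^esub>"
      then have "restrict g (carrier L) \<in> pullback L k ` mod_hom R N M"
        unfolding l ker using restrict_mod_hom[OF L] module_map_closed[OF f] by simp
      then obtain w where w: "w \<in> mod_hom R N M" and e: "restrict g (carrier L) = pullback L k w" by (elim imageE)
      have "g x = w (k x)" if "x \<in> carrier L" for x
        using fun_cong[OF e, of x] that by (simp add: pullback_def compose_def)
      then show "\<exists>w. module_map R N M w \<and> (\<forall>x\<in>carrier L. g x = w (k x))"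
        using w by (intro exI[of _ w] conjI ballI) (simp_all add: mod_hom_iff)
    qed
  next
    assume r: ?r
    show ?l unfolding l
    proof (intro equalityI subsetI)
      fix g assume "g \<in> pullback L k ` mod_hom R N M"
      then obtain w where w: "w \<in> mod_hom R N M" and e: "g = pullback L k w" by (elim imageE)
      have w': "module_map R N M w" using w by (simp add: mod_hom_iff)
      have "g \<in> mod_hom R L M"
        using restrict_mod_hom[OF L module_map_comp[OF k w']] by (simp add: e pullback_def compose_def)
      moreover have "g (f x) = \<zero>\<^bsub>M\<^esub>" if "x \<in> carrier K" for x
        using kf[OF that] module_map_closed[OF f that] module_map_zero[OF N M w']
        by (simp add: e pullback_def compose_def)
      ultimately show "g \<in> kernel (hom_group R L M) (hom_group R K M) (pullback K f)" unfolding ker by blast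
    next
      fix g assume "g \<in> kernel (hom_group R L M) (hom_group R K M) (pullback K f)"
      then have g: "g \<in> mod_hom R L M" and gf: "\<forall>x\<in>carrier K. g (f x) = \<zero>\<^bsub>M\<^esub>" unfolding ker by auto
      have "module_map R L M g" using g by (simp add: mod_hom_iff)
      then obtain w where w: "module_map R N M w" "\<forall>x\<in>carrier L. g x = w (k x)" using r gf by meson
      have "g = pullback L k (restrict w (carrier N))"
      proof (rule extensionalityI[of _ "carrier L"])
        show "g x = pullback L k (restrict w (carrier N)) x" if "x \<in> carrier L" for x
          using that w(2) module_map_closed[OF k that] by (simp add: pullback_def compose_def)
      qed (use g in \<open>simp_all add: mod_hom_iff pullback_def compose_def\<close>)
      then show "g \<in> pullback L k ` mod_hom R N M" by (intro image_eqI[where x = "restrict w (carrier N)"] restrict_mod_hom[OF N w(1)])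
    qed
  qed
qed

definition coresolves ::
    "('r, 'k) ring_scheme \<Rightarrow> ('r, 'm) module \<Rightarrow> (nat \<Rightarrow> ('r, 'p) module) \<Rightarrow> (nat \<Rightarrow> 'p \<Rightarrow> 'p) \<Rightarrow> ('m \<Rightarrow> 'p) \<Rightarrow> bool" where
  "coresolves R K Ts d h \<longleftrightarrow>
     left_module R K \<and> (\<forall>j. left_module R (Ts j)) \<and> module_map R K (Ts 0) h \<and>
     (\<forall>j. module_map R (Ts j) (Ts (Suc j)) (d j)) \<and> inj_on h (carrier K) \<and>
     h ` carrier K = {x \<in> carrier (Ts 0). d 0 x = \<zero>\<^bsub>Ts (Suc 0)\<^esub>} \<and>
     (\<forall>j. d j ` carrier (Ts j) = {x \<in> carrier (Ts (Suc j)). d (Suc j) x = \<zero>\<^bsub>Ts (Suc (Suc j))\<^esub>})"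

text \<open>The conjuncts stand for exactness at \<open>Hom(K, M)\<close>, at
  \<open>Hom(Ts 0, M)\<close> and at the later terms. They state that kernels lie in images; the
  other inclusion comes from consecutive maps composing to zero, as in
  \<open>pullback_exact_iff\<close>.\<close>

definition hom_exact ::
    "('r, 'k) ring_scheme \<Rightarrow> ('r, 'm) module \<Rightarrow> (nat \<Rightarrow> ('r, 'p) module) \<Rightarrow> (nat \<Rightarrow> 'p \<Rightarrow> 'p) \<Rightarrow> ('m \<Rightarrow> 'p) \<Rightarrow>
     ('r, 'n) module \<Rightarrow> bool" where
  "hom_exact R K Ts d h M \<longleftrightarrow>
     (\<forall>g. module_map R K M g \<longrightarrow> (\<exists>w. module_map R (Ts 0) M w \<and> (\<forall>x\<in>carrier K. g x = w (h x)))) \<and>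
     (\<forall>g. module_map R (Ts 0) M g \<longrightarrow> (\<forall>x\<in>carrier K. g (h x) = \<zero>\<^bsub>M\<^esub>) \<longrightarrow>
        (\<exists>w. module_map R (Ts (Suc 0)) M w \<and> (\<forall>x\<in>carrier (Ts 0). g x = w (d 0 x)))) \<and>
     (\<forall>j g. module_map R (Ts (Suc j)) M g \<longrightarrow> (\<forall>x\<in>carrier (Ts j). g (d j x) = \<zero>\<^bsub>M\<^esub>) \<longrightarrow>
        (\<exists>w. module_map R (Ts (Suc (Suc j))) M w \<and> (\<forall>x\<in>carrier (Ts (Suc j)). g x = w (d (Suc j) x))))"

lemma hom_exactD:
  assumes "hom_exact R K Ts d h M"
  shows "module_map R K M f \<Longrightarrow> \<exists>w. module_map R (Ts 0) M w \<and> (\<forall>x\<in>carrier K. f x = w (h x))"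
    and "module_map R (Ts 0) M g \<Longrightarrow> (\<And>x. x \<in> carrier K \<Longrightarrow> g (h x) = \<zero>\<^bsub>M\<^esub>) \<Longrightarrow>
      \<exists>w. module_map R (Ts (Suc 0)) M w \<and> (\<forall>x\<in>carrier (Ts 0). g x = w (d 0 x))"
    and "module_map R (Ts (Suc j)) M g' \<Longrightarrow> (\<And>x. x \<in> carrier (Ts j) \<Longrightarrow> g' (d j x) = \<zero>\<^bsub>M\<^esub>) \<Longrightarrow>
      \<exists>w. module_map R (Ts (Suc (Suc j))) M w \<and> (\<forall>x\<in>carrier (Ts (Suc j)). g' x = w (d (Suc j) x))"
  using assms by (simp_all add: hom_exact_def)

lemma coresolvesD:
  assumes "coresolves R K Ts d h"
  shows "left_module R K" "left_module R (Ts j)" "module_map R K (Ts 0) h"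
    "module_map R (Ts j) (Ts (Suc j)) (d j)" "inj_on h (carrier K)"
    "h ` carrier K = {x \<in> carrier (Ts 0). d 0 x = \<zero>\<^bsub>Ts (Suc 0)\<^esub>}"
    "d j ` carrier (Ts j) = {x \<in> carrier (Ts (Suc j)). d (Suc j) x = \<zero>\<^bsub>Ts (Suc (Suc j))\<^esub>}"
  using assms by (simp_all add: coresolves_def)

lemma hom_exact_pullback_iff:
  assumes c: "coresolves R K Ts d h" and M: "left_module R M"
  shows "hom_exact R K Ts d h M \<longleftrightarrow>
    pullback K h ` mod_hom R (Ts 0) M = mod_hom R K M \<and>
    exact_at (hom_group R (Ts (Suc 0)) M) (pullback (Ts 0) (d 0)) (hom_group R (Ts 0) M) (pullback K h) (hom_group R K M) \<and>
    (\<forall>j. exact_at (hom_group R (Ts (Suc (Suc j))) M) (pullback (Ts (Suc j)) (d (Suc j)))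
        (hom_group R (Ts (Suc j)) M) (pullback (Ts j) (d j)) (hom_group R (Ts j) M))"
proof -
  note cD = coresolvesD[OF c]
  have 0: "d 0 (h x) = \<zero>\<^bsub>Ts (Suc 0)\<^esub>" if "x \<in> carrier K" for x using cD(6) that by blast
  have S: "d (Suc j) (d j x) = \<zero>\<^bsub>Ts (Suc (Suc j))\<^esub>" if "x \<in> carrier (Ts j)" for x j using cD(7)[of j] that by blast
  show ?thesis
    by (simp only: hom_exact_def pullback_surj_iff[OF cD(1,2,3)] pullback_exact_iff[OF cD(1) cD(2) cD(2) M cD(3,4)]
        pullback_exact_iff[OF cD(2) cD(2) cD(2) M cD(4) cD(4)] 0 S)
qed

lemma add_coresolutionD:
  assumes T: "left_module R T" and cor: "add_coresolution R T Ts d h"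
  shows "\<And>j. Ts j \<in> add_class R T" "coresolves R (regular_module R) Ts d h"
    "hom_exact R (regular_module R) Ts d h T"
proof -
  have ring: "ring R" using T by (rule left_module.axioms(1))
  show add: "Ts j \<in> add_class R T" for j using cor by (simp add: add_coresolution_def)
  then have "left_module R (Ts j)" for j by (simp add: add_class_def)
  moreover have "h ` carrier R = {x \<in> carrier (Ts 0). d 0 x = \<zero>\<^bsub>Ts (Suc 0)\<^esub>}"
    using cor[unfolded add_coresolution_def exact_at_iff] by simp
  ultimately show c: "coresolves R (regular_module R) Ts d h"
    using cor regular_left_module[OF ring]
    by (simp add: add_coresolution_def coresolves_def exact_at_iff mod_hom_iff)
  show "hom_exact R (regular_module R) Ts d h T"
    unfolding hom_exact_pullback_iff[OF c T] using cor by (simp add: add_coresolution_def)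
qed

lemma pullback_restrict: "pullback M (restrict f (carrier M)) = pullback M f"
  by (auto simp: pullback_def compose_def fun_eq_iff)

lemma add_coresolutionI:
  fixes Ts :: "nat \<Rightarrow> ('r, 'p) module"
  assumes T: "left_module R T" and add: "\<And>j. Ts j \<in> add_class R T"
    and c: "coresolves R (regular_module R) Ts d h" and ex: "hom_exact R (regular_module R) Ts d h T"
  shows "add_coresolution R T Ts (\<lambda>j. restrict (d j) (carrier (Ts j))) (restrict h (carrier R))"
proof -
  note cD = coresolvesD[OF c]
  have e: "{x. (x \<in> C \<longrightarrow> Q x) \<and> x \<in> C} = {x \<in> C. Q x}" for C :: "'p set" and Q
    by auto
  have h: "restrict h (carrier R) \<in> mod_hom R (regular_module R) (Ts 0)"
    using restrict_mod_hom[OF cD(1) cD(3)] by simp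
  have p: "pullback (regular_module R) (restrict h (carrier R)) = pullback (regular_module R) h"
    using pullback_restrict[of "regular_module R" h] by simp
  have "exact_at (add_monoid (regular_module R)) (restrict h (carrier R)) (add_monoid (Ts 0))
      (restrict (d 0) (carrier (Ts 0))) (add_monoid (Ts (Suc 0)))"
    unfolding exact_at_iff using cD(6) by (simp add: e)
  moreover have "exact_at (add_monoid (Ts j)) (restrict (d j) (carrier (Ts j))) (add_monoid (Ts (Suc j)))
      (restrict (d (Suc j)) (carrier (Ts (Suc j)))) (add_monoid (Ts (Suc (Suc j))))" for j
    unfolding exact_at_iff using cD(7)[of j] by (simp add: e)
  ultimately show ?thesis
    unfolding add_coresolution_def p pullback_restrict One_nat_def
    using add h cD(5) restrict_mod_hom[OF cD(2) cD(4)] ex[unfolded hom_exact_pullback_iff[OF c T]]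
    by (intro conjI allI) (auto simp: inj_on_def)
qed

text \<open>In a coresolution this is the cokernel of the map that precedes \<open>d j\<close>,
  realized as the image of \<open>d j\<close> inside \<open>Ts (Suc j)\<close>. It thereby keeps the
  carrier type of the terms, which the universe of the hypothesis has to accommodate.\<close>

definition cosyzygy :: "(nat \<Rightarrow> ('r, 'p) module) \<Rightarrow> (nat \<Rightarrow> 'p \<Rightarrow> 'p) \<Rightarrow> nat \<Rightarrow> ('r, 'p) module" where
  "cosyzygy Ts d j = (Ts (Suc j))\<lparr>carrier := d j ` carrier (Ts j)\<rparr>"

context
  fixes R :: "('r, 'k) ring_scheme" and K :: "('r, 'm) module"
    and Ts :: "nat \<Rightarrow> ('r, 'p) module" and d h
  assumes c: "coresolves R K Ts d h"
begin

lemma cosyzygy_simps [simp]: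
  "carrier (cosyzygy Ts d j) = d j ` carrier (Ts j)" "\<zero>\<^bsub>cosyzygy Ts d j\<^esub> = \<zero>\<^bsub>Ts (Suc j)\<^esub>"
  by (simp_all add: cosyzygy_def)

lemma cosyzygy_left_module: "left_module R (cosyzygy Ts d j)"
  unfolding cosyzygy_def
  by (intro left_module_submodule module_map_image_submodule coresolvesD[OF c])

lemma cosyzygy_proj: "module_map R (Ts j) (cosyzygy Ts d j) (d j)"
  using coresolvesD(4)[OF c, of j] by (simp add: cosyzygy_def module_map_def)

lemma cosyzygy_incl: "module_map R (cosyzygy Ts d j) (Ts (Suc j)) (\<lambda>x. x)"
  using module_map_closed[OF coresolvesD(4)[OF c, of j]] by (auto simp: cosyzygy_def module_map_def)

lemma cosyzygy_exact0: "short_exact R K (Ts 0) (cosyzygy Ts d 0) h (d 0)"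
  using coresolvesD[OF c] cosyzygy_left_module cosyzygy_proj by (simp add: short_exact_def)

lemma cosyzygy_exact: "short_exact R (cosyzygy Ts d j) (Ts (Suc j)) (cosyzygy Ts d (Suc j)) (\<lambda>x. x) (d (Suc j))"
  using coresolvesD[OF c] cosyzygy_left_module cosyzygy_proj cosyzygy_incl by (simp add: short_exact_def)

text \<open>After composition with \<open>d j\<close>, a map on the cosyzygy kills the image of the
  preceding map; exactness of the Hom sequence at \<open>Ts j\<close> then yields the
  extension.\<close>

lemma cosyzygy_extend:
  assumes M: "left_module R M" and ex: "hom_exact R K Ts d h M" and f: "module_map R (cosyzygy Ts d j) M f"
  shows "\<exists>g. module_map R (Ts (Suc j)) M g \<and> (\<forall>x\<in>carrier (cosyzygy Ts d j). g x = f x)"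
proof -
  note fd = module_map_comp[OF cosyzygy_proj f]
  \<comment> \<open>The map that precedes \<open>d j\<close> is \<open>h\<close> for
    \<open>j = 0\<close> and \<open>d i\<close> for \<open>j = Suc i\<close>.\<close>
  have "\<exists>w. module_map R (Ts (Suc j)) M w \<and> (\<forall>x\<in>carrier (Ts j). f (d j x) = w (d j x))"
  proof (cases j)
    case 0
    interpret short_exact R K "Ts 0" "cosyzygy Ts d 0" h "d 0" by (rule cosyzygy_exact0)
    show ?thesis unfolding 0
      by (rule hom_exactD(2)[OF ex]) (use fd f pu module_map_zero[OF C M] 0 in auto)
  next
    case (Suc i)
    interpret short_exact R "cosyzygy Ts d i" "Ts (Suc i)" "cosyzygy Ts d (Suc i)" "\<lambda>x. x" "d (Suc i)"
      by (rule cosyzygy_exact)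
    show ?thesis unfolding Suc
      by (rule hom_exactD(3)[OF ex]) (use fd f pu module_map_zero[OF C M] Suc in auto)
  qed
  then obtain w where "module_map R (Ts (Suc j)) M w" "\<forall>x\<in>carrier (Ts j). f (d j x) = w (d j x)" by (elim exE conjE)
  then show ?thesis by (intro exI[of _ w]) auto
qed

text \<open>The induction runs along the short exact sequences of cosyzygies, and Hom-exactness
  provides the extension of maps that \<open>ext_vanishes_cokernel\<close> requires at each
  step.\<close>

lemma cosyzygy_ext_vanishes:
  assumes M: "left_module R M" and ex: "hom_exact R K Ts d h M"
    and Q: "resolves R K Q dQ eQ" "ext_vanishes R Q dQ M"
    and Ts: "\<And>j. resolves R (Ts j) (PT j) (dT j) (eT j)" "\<And>j. ext_vanishes R (PT j) (dT j) M"
    and PC: "\<And>j. resolves R (cosyzygy Ts d j) (PC j) (dC j) (eC j)"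
  shows "ext_vanishes R (PC j) (dC j) M"
proof (induction j)
  case 0
  show ?case
  proof (rule short_exact.ext_vanishes_cokernel[OF cosyzygy_exact0 Q(1) Ts(1) PC M Q(2) Ts(2)])
    fix f assume "module_map R K M f"
    then obtain w where "module_map R (Ts 0) M w" "\<forall>x\<in>carrier K. f x = w (h x)"
      using hom_exactD(1)[OF ex] by meson
    then show "\<exists>g. module_map R (Ts 0) M g \<and> (\<forall>x\<in>carrier K. g (h x) = f x)"
      by (intro exI[of _ w]) simp
  qed
next
  case (Suc j)
  show ?case
    by (rule short_exact.ext_vanishes_cokernel[OF cosyzygy_exact PC Ts(1) PC M Suc Ts(2)])
       (rule cosyzygy_extend[OF M ex])
qed

text \<open>A map on \<open>Ts j\<close> that vanishes on the kernel of \<open>d j\<close> factors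
  through the cosyzygy. It extends to \<open>Ts (Suc j)\<close> because Ext of the next cosyzygy
  vanishes.\<close>

lemma hom_exactI_cosyzygy:
  assumes V: "left_module R V"
    and PC: "\<And>j. resolves R (cosyzygy Ts d j) (PC j) (dC j) (eC j)"
    and van: "\<And>j. ext_vanishes R (PC j) (dC j) V"
  shows "hom_exact R K Ts d h V"
proof -
  note cD = coresolvesD[OF c]
  have ext0: "\<exists>w. module_map R (Ts 0) V w \<and> (\<forall>x\<in>carrier K. g x = w (h x))" if g: "module_map R K V g" for g
    by (rule short_exact.extend_hom[OF cosyzygy_exact0 PC V van g]) auto
  have extS: "\<exists>w. module_map R (Ts (Suc j)) V w \<and> (\<forall>x\<in>carrier (cosyzygy Ts d j). w x = f x)"
    if f: "module_map R (cosyzygy Ts d j) V f" for f j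
    by (rule short_exact.extend_hom[OF cosyzygy_exact PC V van f]) auto
  have factor: "\<exists>w. module_map R (Ts (Suc j)) V w \<and> (\<forall>x\<in>carrier (Ts j). g x = w (d j x))"
    if g: "module_map R (Ts j) V g"
      and z: "\<And>x. x \<in> carrier (Ts j) \<Longrightarrow> d j x = \<zero>\<^bsub>Ts (Suc j)\<^esub> \<Longrightarrow> g x = \<zero>\<^bsub>V\<^esub>" for g j
  proof -
    obtain f where f: "module_map R (cosyzygy Ts d j) V f" "\<And>x. x \<in> carrier (Ts j) \<Longrightarrow> f (d j x) = g x"
      by (rule factor_through_surj[OF cD(2) cosyzygy_left_module V cosyzygy_proj g]) (use z in auto)
    obtain w where "module_map R (Ts (Suc j)) V w" "\<forall>x\<in>carrier (cosyzygy Ts d j). w x = f x"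
      using extS[OF f(1)] by (elim exE conjE)
    then show ?thesis using f(2) by (intro exI[of _ w]) simp
  qed
  show ?thesis
    unfolding hom_exact_def
  proof (intro conjI allI impI)
    fix g assume "module_map R K V g"
    then show "\<exists>w. module_map R (Ts 0) V w \<and> (\<forall>x\<in>carrier K. g x = w (h x))" by (rule ext0)
  next
    fix g assume g: "module_map R (Ts 0) V g" and z: "\<forall>x\<in>carrier K. g (h x) = \<zero>\<^bsub>V\<^esub>"
    show "\<exists>w. module_map R (Ts (Suc 0)) V w \<and> (\<forall>x\<in>carrier (Ts 0). g x = w (d 0 x))"
    proof (rule factor[OF g])
      fix x assume "x \<in> carrier (Ts 0)" "d 0 x = \<zero>\<^bsub>Ts (Suc 0)\<^esub>"
      then have "x \<in> h ` carrier K" using cD(6) by simp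
      then show "g x = \<zero>\<^bsub>V\<^esub>" using z by auto
    qed
  next
    fix j g assume g: "module_map R (Ts (Suc j)) V g" and z: "\<forall>x\<in>carrier (Ts j). g (d j x) = \<zero>\<^bsub>V\<^esub>"
    show "\<exists>w. module_map R (Ts (Suc (Suc j))) V w \<and> (\<forall>x\<in>carrier (Ts (Suc j)). g x = w (d (Suc j) x))"
    proof (rule factor[OF g])
      fix x assume "x \<in> carrier (Ts (Suc j))" "d (Suc j) x = \<zero>\<^bsub>Ts (Suc (Suc j))\<^esub>"
      then have "x \<in> d j ` carrier (Ts j)" using cD(7)[of j] by simp
      then show "g x = \<zero>\<^bsub>V\<^esub>" using z by auto
    qed
  qed
qed

end

section \<open>Inducing resolutions, coresolutions and their Hom sequences\<close>

context frobenius_system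
begin

text \<open>\<open>P\<close> is a retract of some \<open>R\<^sup>n\<close>, so its induced module
  can be found inside \<open>A\<^sup>n\<close>. This gives the carrier type
  \<open>nat \<Rightarrow> 'a\<close> that \<open>wakamatsu_tilting\<close> prescribes for the terms
  of a resolution.\<close>

lemma induced_fin_gen_projective:
  assumes P: "projective R P" and fg: "fin_gen R P"
  obtains N :: "('a, nat \<Rightarrow> 'a) module" and \<eta> \<epsilon>
    where "induced P N \<eta> \<epsilon>" "projective A N" "fin_gen A N"
proof -
  obtain n :: nat where ret: "retract R P (free_module {..<n} R)" by (rule fin_gen_projective_retract[OF P fg])
  have ind: "induced (free_module {..<n} R) (free_module {..<n} A)
      (\<lambda>v. \<lambda>j\<in>{..<n}. \<iota> (v j)) (\<lambda>v. \<lambda>j\<in>{..<n}. E (v j))"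
    by (rule induced_copower[OF induced_regular finite_lessThan])
  obtain C \<eta> \<epsilon> where N: "induced P ((free_module {..<n} A)\<lparr>carrier := C\<rparr>) \<eta> \<epsilon>"
    "retract A ((free_module {..<n} A)\<lparr>carrier := C\<rparr>) (free_module {..<n} A)"
    by (rule induced_retract[OF ind projective_left_module[OF P] ret])
  note lN = induced_modules(2)[OF N(1)]
  show ?thesis by (rule that[OF N(1) projectiveI_retract[OF lN N(2)] fin_genI_retract[OF lN N(2)]])
qed

text \<open>Here the induced module is found inside a power \<open>U\<^sup>n\<close>, which gives
  the carrier type prescribed for the terms of a coresolution.\<close>

lemma induced_add_class:
  fixes U :: "('a, 'u) module"
  assumes ind: "induced T U \<eta> \<epsilon>" and M: "M \<in> add_class R T"
  obtains N :: "('a, nat \<Rightarrow> 'u) module" and \<eta>' \<epsilon>' where "induced M N \<eta>' \<epsilon>'" "N \<in> add_class A U"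
proof -
  obtain n :: nat where lM: "left_module R M" and ret: "retract R M (copower {..<n} T)"
    using M unfolding add_class_iff_retract[OF induced_modules(1)[OF ind]] by blast
  obtain C \<eta>' \<epsilon>' where N: "induced M ((copower {..<n} U)\<lparr>carrier := C\<rparr>) \<eta>' \<epsilon>'"
    "retract A ((copower {..<n} U)\<lparr>carrier := C\<rparr>) (copower {..<n} U)"
    by (rule induced_retract[OF induced_copower[OF ind finite_lessThan] lM ret])
  have "(copower {..<n} U)\<lparr>carrier := C\<rparr> \<in> add_class A U"
    unfolding add_class_iff_retract[OF induced_modules(2)[OF ind]]
    using induced_modules(2)[OF N(1)] N(2) by blast
  with N(1) show ?thesis by (rule that)
qed

context
  fixes P :: "nat \<Rightarrow> ('r, 'p) module" and N :: "nat \<Rightarrow> ('a, 'n) module" and \<eta> \<epsilon>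
    and X :: "('r, 'x) module" and Y :: "('a, 'y) module" and \<eta>X \<epsilon>X
  assumes ind: "\<And>i. induced (P i) (N i) (\<eta> i) (\<epsilon> i)" and indX: "induced X Y \<eta>X \<epsilon>X"
begin

lemma induced_resolution:
  assumes res: "resolves R X P d e" and pr: "\<And>i. projective A (N i)"
  shows "resolves A Y N (\<lambda>i. induced_map (N (Suc i)) (\<epsilon> (Suc i)) (N i) (\<eta> i) (d i))
    (induced_map (N 0) (\<epsilon> 0) Y \<eta>X e)"
  unfolding resolves_def
  using resolves_maps[OF res] resolves_surj[OF res] resolves_exact0[OF res] resolves_exact[OF res]
  by (intro conjI allI pr induced_modules(2)[OF indX] induced_map_map[OF ind ind]
      induced_map_map[OF ind indX] induced_map_surj[OF ind indX] induced_map_exact[OF ind ind indX]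
      induced_map_exact[OF ind ind ind]) assumption+

text \<open>A cocycle over \<open>A\<close> is transposed to \<open>z \<circ> \<eta>\<close>, its
  coboundary equation is solved over \<open>R\<close>, and \<open>induced_lift\<close> returns the
  solution.\<close>

lemma induced_ext_vanishes:
  assumes res: "resolves R X P d e" and L: "left_module A L"
    and van: "ext_vanishes R P d (restrict_scalars \<iota> L)"
  shows "ext_vanishes A N (\<lambda>i. induced_map (N (Suc i)) (\<epsilon> (Suc i)) (N i) (\<eta> i) (d i)) L"
  unfolding ext_vanishes_def
proof (intro allI impI)
  note d = resolves_maps(1)[OF res]
  fix i z assume z: "module_map A (N (Suc i)) L z"
    and zd: "\<forall>x\<in>carrier (N (Suc (Suc i))).
      z (induced_map (N (Suc (Suc i))) (\<epsilon> (Suc (Suc i))) (N (Suc i)) (\<eta> (Suc i)) (d (Suc i)) x) = \<zero>\<^bsub>L\<^esub>"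
  have z\<eta>: "z (\<eta> (Suc i) (d (Suc i) x)) = \<zero>\<^bsub>restrict_scalars \<iota> L\<^esub>" if x: "x \<in> carrier (P (Suc (Suc i)))" for x
    using bspec[OF zd eta_closed[OF ind x]] induced_map_eta[OF ind ind d x] by simp
  obtain w where w: "module_map R (P i) (restrict_scalars \<iota> L) w"
    and eq: "\<forall>x\<in>carrier (P (Suc i)). z (\<eta> (Suc i) x) = w (d i x)"
    using ext_vanishesD[OF van induced_map_comp_eta[OF ind L z]] z\<eta> by meson
  show "\<exists>w. module_map A (N i) L w \<and>
      (\<forall>x\<in>carrier (N (Suc i)). z x = w (induced_map (N (Suc i)) (\<epsilon> (Suc i)) (N i) (\<eta> i) (d i) x))"
    by (intro exI conjI ballI, rule induced_lift_map[OF ind L w], rule induced_factor[OF ind ind d L z w])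
       (use eq in auto)
qed

lemma induced_coresolution:
  assumes cor: "coresolves R X P d h"
  shows "coresolves A Y N (\<lambda>i. induced_map (N i) (\<epsilon> i) (N (Suc i)) (\<eta> (Suc i)) (d i))
    (induced_map Y \<epsilon>X (N 0) (\<eta> 0) h)"
  unfolding coresolves_def
  by (intro conjI allI induced_modules(2)[OF indX] induced_modules(2)[OF ind] induced_map_map[OF ind ind]
      induced_map_map[OF indX ind] induced_map_inj[OF indX ind] induced_map_exact[OF indX ind ind]
      induced_map_exact[OF ind ind ind] coresolvesD[OF cor])

text \<open>Each of the three lifting problems is transposed along \<open>\<eta>\<close>, solved
  over \<open>R\<close> and returned by \<open>induced_lift\<close>.\<close>

lemma induced_hom_exact:
  assumes cor: "coresolves R X P d h" and L: "left_module A L"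
    and ex: "hom_exact R X P d h (restrict_scalars \<iota> L)"
  shows "hom_exact A Y N (\<lambda>i. induced_map (N i) (\<epsilon> i) (N (Suc i)) (\<eta> (Suc i)) (d i))
    (induced_map Y \<epsilon>X (N 0) (\<eta> 0) h) L"
proof -
  note cD = coresolvesD[OF cor]
  show ?thesis
    unfolding hom_exact_def
  proof (intro conjI allI impI)
    fix g assume g: "module_map A Y L g"
    obtain w where w: "module_map R (P 0) (restrict_scalars \<iota> L) w" "\<forall>x\<in>carrier X. g (\<eta>X x) = w (h x)"
      using hom_exactD(1)[OF ex induced_map_comp_eta[OF indX L g]] by (elim exE conjE)
    show "\<exists>w. module_map A (N 0) L w \<and> (\<forall>x\<in>carrier Y. g x = w (induced_map Y \<epsilon>X (N 0) (\<eta> 0) h x))"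
      by (intro exI conjI ballI, rule induced_lift_map[OF ind L w(1)],
          rule induced_factor[OF indX ind cD(3) L g w(1)]) (use w(2) in auto)
  next
    fix g assume g: "module_map A (N 0) L g"
      and z: "\<forall>x\<in>carrier Y. g (induced_map Y \<epsilon>X (N 0) (\<eta> 0) h x) = \<zero>\<^bsub>L\<^esub>"
    have g\<eta>: "g (\<eta> 0 (h x)) = \<zero>\<^bsub>restrict_scalars \<iota> L\<^esub>" if x: "x \<in> carrier X" for x
      using bspec[OF z eta_closed[OF indX x]] induced_map_eta[OF indX ind cD(3) x] by simp
    obtain w where w: "module_map R (P (Suc 0)) (restrict_scalars \<iota> L) w" "\<forall>x\<in>carrier (P 0). g (\<eta> 0 x) = w (d 0 x)"
      using hom_exactD(2)[OF ex induced_map_comp_eta[OF ind L g]] g\<eta> by meson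
    show "\<exists>w. module_map A (N (Suc 0)) L w \<and>
        (\<forall>x\<in>carrier (N 0). g x = w (induced_map (N 0) (\<epsilon> 0) (N (Suc 0)) (\<eta> (Suc 0)) (d 0) x))"
      by (intro exI conjI ballI, rule induced_lift_map[OF ind L w(1)],
          rule induced_factor[OF ind ind cD(4) L g w(1)]) (use w(2) in auto)
  next
    fix j g assume g: "module_map A (N (Suc j)) L g"
      and z: "\<forall>x\<in>carrier (N j). g (induced_map (N j) (\<epsilon> j) (N (Suc j)) (\<eta> (Suc j)) (d j) x) = \<zero>\<^bsub>L\<^esub>"
    have g\<eta>: "g (\<eta> (Suc j) (d j x)) = \<zero>\<^bsub>restrict_scalars \<iota> L\<^esub>" if x: "x \<in> carrier (P j)" for x
      using bspec[OF z eta_closed[OF ind x]] induced_map_eta[OF ind ind cD(4) x] by simp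
    obtain w where w: "module_map R (P (Suc (Suc j))) (restrict_scalars \<iota> L) w"
      "\<forall>x\<in>carrier (P (Suc j)). g (\<eta> (Suc j) x) = w (d (Suc j) x)"
      using hom_exactD(3)[OF ex induced_map_comp_eta[OF ind L g]] g\<eta> by meson
    show "\<exists>w. module_map A (N (Suc (Suc j))) L w \<and> (\<forall>x\<in>carrier (N (Suc j)).
        g x = w (induced_map (N (Suc j)) (\<epsilon> (Suc j)) (N (Suc (Suc j))) (\<eta> (Suc (Suc j))) (d (Suc j)) x))"
      by (intro exI conjI ballI, rule induced_lift_map[OF ind L w(1)],
          rule induced_factor[OF ind ind cD(4) L g w(1)]) (use w(2) in auto)
  qed
qed

end

end

section \<open>Induced Wakamatsu tilting modules\<close>

text \<open>The type \<open>'x\<close> is the universe over which the hypothesis on perpendicular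
  classes ranges. By \<open>large\<close> it has room for copies of \<open>T\<close> and of the
  cosyzygies, the modules at which the hypothesis is used.\<close>

theorem theorem2p2:
  fixes R :: "'r ring" and A :: "'a ring" and \<iota> :: "'r \<Rightarrow> 'a" and T :: "('r, 't) module"
  assumes frobenius: "frobenius_extension R A \<iota>"
    and tilting: "wakamatsu_tilting R T"
    and large: "\<exists>g :: (nat \<Rightarrow> 't) \<Rightarrow> 'x. inj g"
    and perp: "(left_perp R T :: ('r, 'x) module set)
                 \<subseteq> left_perp R (restrict_scalars \<iota> (extend_scalars R A \<iota> T))"
  shows "wakamatsu_tilting A (extend_scalars R A \<iota> T)"
proof -
  obtain E b y and n :: nat where "frobenius_system R A \<iota> E {..<n} b y"
    by (rule frobenius_extension_system[OF frobenius])
  then interpret frobenius_system R A \<iota> E "{..<n}" b y .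
  define U where "U = extend_scalars R A \<iota> T"
  let ?V = "restrict_scalars \<iota> U"
  obtain P :: "nat \<Rightarrow> ('r, nat \<Rightarrow> 'r) module" and d e and Ts :: "nat \<Rightarrow> ('r, nat \<Rightarrow> 't) module" and dT h
    where T: "left_module R T" and P: "projective_resolution R T P d e" "\<And>i. fin_gen R (P i)"
    and ext: "\<forall>i>0. trivial_group (Ext R i T T)" and cor: "add_coresolution R T Ts dT h"
    using tilting unfolding wakamatsu_tilting_def by blast
  have res: "resolves R T P d e" by (rule projective_resolution_resolves[OF T P(1)])
  obtain \<eta> \<epsilon> where ind: "induced T U \<eta> \<epsilon>" unfolding U_def by (rule induced_extend_scalars[OF T])
  have U: "left_module A U" and V: "left_module R ?V" using induced_modules[OF ind] by auto
  obtain g :: "(nat \<Rightarrow> 't) \<Rightarrow> 'x" where g: "inj g" using large by blast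
  \<comment> \<open>Constant sequences embed \<open>'t\<close> into
    \<open>nat \<Rightarrow> 't\<close>, so the universe has room for a copy of \<open>T\<close> as
    well.\<close>
  have g': "inj (\<lambda>t. g (\<lambda>_. t))" using g by (auto simp: inj_on_def fun_eq_iff)
  note perp' = left_perp_ext_vanishes[OF perp[folded U_def] T V]
  have vT: "ext_vanishes R P d T" using ext_trivial_iff[OF res T] ext by blast
  have vV: "ext_vanishes R P d ?V" by (rule perp'[OF g' res vT])

  \<comment> \<open>The induced module and its two maps are bundled into one tuple, so that a single
    choice fixes all three in each degree.\<close>
  have "\<forall>i. \<exists>x :: ('a, nat \<Rightarrow> 'a) module \<times> ((nat \<Rightarrow> 'r) \<Rightarrow> nat \<Rightarrow> 'a) \<times> ((nat \<Rightarrow> 'a) \<Rightarrow> nat \<Rightarrow> 'r).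
      induced (P i) (fst x) (fst (snd x)) (snd (snd x)) \<and> projective A (fst x) \<and> fin_gen A (fst x)"
  proof
    fix i
    obtain N :: "('a, nat \<Rightarrow> 'a) module" and \<eta> \<epsilon> where "induced (P i) N \<eta> \<epsilon>" "projective A N" "fin_gen A N"
      by (rule induced_fin_gen_projective[OF resolves_modules(2)[OF res] P(2)])
    then show "\<exists>x :: ('a, nat \<Rightarrow> 'a) module \<times> ((nat \<Rightarrow> 'r) \<Rightarrow> nat \<Rightarrow> 'a) \<times> ((nat \<Rightarrow> 'a) \<Rightarrow> nat \<Rightarrow> 'r).
      induced (P i) (fst x) (fst (snd x)) (snd (snd x)) \<and> projective A (fst x) \<and> fin_gen A (fst x)"
      by (intro exI[of _ "(N, \<eta>, \<epsilon>)"]) simp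
  qed
  from choice[OF this] obtain x :: "nat \<Rightarrow> ('a, nat \<Rightarrow> 'a) module \<times> ((nat \<Rightarrow> 'r) \<Rightarrow> nat \<Rightarrow> 'a) \<times> ((nat \<Rightarrow> 'a) \<Rightarrow> nat \<Rightarrow> 'r)"
    where x: "\<forall>i. induced (P i) (fst (x i)) (fst (snd (x i))) (snd (snd (x i))) \<and> projective A (fst (x i)) \<and> fin_gen A (fst (x i))"
    by (elim exE)
  then have indP: "\<And>i. induced (P i) (fst (x i)) (fst (snd (x i))) (snd (snd (x i)))"
    and pN: "\<And>i. projective A (fst (x i))" and fN: "\<forall>i. fin_gen A (fst (x i))" by simp_all
  note resU = induced_resolution[OF indP ind res pN]
  have 1: "\<exists>(P :: nat \<Rightarrow> ('a, nat \<Rightarrow> 'a) module) d e. projective_resolution A U P d e \<and> (\<forall>i. fin_gen A (P i))"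
    using resolves_restrict[OF resU] fN by (intro exI conjI)
  have 2: "\<forall>i>0. trivial_group (Ext A i U U)"
    using ext_trivial_iff[OF resU U] induced_ext_vanishes[OF indP ind res U vV] by blast

  note cD = add_coresolutionD[OF T cor]
  have lTs: "left_module R (Ts j)" for j using coresolvesD(2)[OF cD(2)] .
  \<comment> \<open>The induction on cosyzygies starts at \<open>R\<close>, which is
    projective.\<close>
  obtain Q :: "nat \<Rightarrow> ('r, 'r) module" and dQ eQ where Q: "resolves R (regular_module R) Q dQ eQ"
    and vQ: "\<And>M :: ('r, 't) module. left_module R M \<Longrightarrow> ext_vanishes R Q dQ M"
    by (rule projective_ext_vanishes[OF regular_projective[OF rings(1)]]) (rule that)
  \<comment> \<open>\<open>some_resolution\<close> is a function of the module, so it yields a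
    family of resolutions indexed by \<open>j\<close> at once.\<close>
  have choose: "\<exists>(P :: nat \<Rightarrow> nat \<Rightarrow> ('r, ('r, nat \<Rightarrow> 't) res_carrier) module) d e. \<forall>j. resolves R (X j) (P j) (d j) (e j)" if X: "\<And>j. left_module R (X j)"
    for X :: "nat \<Rightarrow> ('r, nat \<Rightarrow> 't) module"
  proof -
    have "\<forall>j. resolves R (X j) (fst (some_resolution R (X j))) (fst (snd (some_resolution R (X j))))
        (snd (snd (some_resolution R (X j))))"
      by (intro allI projective_resolution_resolves[OF X some_resolution[OF X]]) simp
    then show ?thesis by (intro exI)
  qed
  obtain PT :: "nat \<Rightarrow> nat \<Rightarrow> ('r, ('r, nat \<Rightarrow> 't) res_carrier) module" and dPT ePT where "\<forall>j. resolves R (Ts j) (PT j) (dPT j) (ePT j)"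
    using choose[of Ts, OF lTs] by (elim exE)
  then have PT: "\<And>j. resolves R (Ts j) (PT j) (dPT j) (ePT j)" ..
  have lC: "left_module R (cosyzygy Ts dT j)" for j by (rule cosyzygy_left_module[OF cD(2)])
  obtain PC :: "nat \<Rightarrow> nat \<Rightarrow> ('r, ('r, nat \<Rightarrow> 't) res_carrier) module" and dPC ePC where "\<forall>j. resolves R (cosyzygy Ts dT j) (PC j) (dPC j) (ePC j)"
    using choose[of "cosyzygy Ts dT", OF lC] by (elim exE)
  then have PC: "\<And>j. resolves R (cosyzygy Ts dT j) (PC j) (dPC j) (ePC j)" ..
  have vPT: "ext_vanishes R (PT j) (dPT j) T" for j
    by (rule add_class_ext_vanishes[OF cD(1) res PT T vT])
  have "ext_vanishes R (PC j) (dPC j) T" for j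
    by (rule cosyzygy_ext_vanishes[OF cD(2) T cD(3) Q vQ[OF T] PT vPT PC])
  \<comment> \<open>The cosyzygies have carriers in \<open>nat \<Rightarrow> 't\<close>, so the
    injection \<open>g\<close> itself applies.\<close>
  then have vPC: "ext_vanishes R (PC j) (dPC j) ?V" for j by (rule perp'[OF g PC])
  have exV: "hom_exact R (regular_module R) Ts dT h ?V"
    by (rule hom_exactI_cosyzygy[OF cD(2) V PC vPC])

  have "\<forall>j. \<exists>w :: ('a, nat \<Rightarrow> ('a \<times> 't \<Rightarrow>\<^sub>0 int) set) module \<times> _.
      induced (Ts j) (fst w) (fst (snd w)) (snd (snd w)) \<and> fst w \<in> add_class A U"
  proof
    fix j
    obtain N :: "('a, nat \<Rightarrow> ('a \<times> 't \<Rightarrow>\<^sub>0 int) set) module" and \<eta> \<epsilon>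
      where "induced (Ts j) N \<eta> \<epsilon>" "N \<in> add_class A U"
      by (rule induced_add_class[OF ind cD(1)])
    then show "\<exists>w :: ('a, nat \<Rightarrow> ('a \<times> 't \<Rightarrow>\<^sub>0 int) set) module \<times> _.
        induced (Ts j) (fst w) (fst (snd w)) (snd (snd w)) \<and> fst w \<in> add_class A U"
      by (intro exI[of _ "(N, \<eta>, \<epsilon>)"]) simp
  qed
  from choice[OF this] obtain w :: "nat \<Rightarrow> ('a, nat \<Rightarrow> ('a \<times> 't \<Rightarrow>\<^sub>0 int) set) module \<times> _"
    where "\<forall>j. induced (Ts j) (fst (w j)) (fst (snd (w j))) (snd (snd (w j))) \<and> fst (w j) \<in> add_class A U"
    by (elim exE)
  then have indW: "\<And>j. induced (Ts j) (fst (w j)) (fst (snd (w j))) (snd (snd (w j)))"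
    and addW: "\<And>j. fst (w j) \<in> add_class A U" by simp_all
  \<comment> \<open>The module being coresolved is \<open>A\<close>, which
    \<open>induced_regular\<close> presents as induced from \<open>R\<close>.\<close>
  have 3: "\<exists>(Ts :: nat \<Rightarrow> ('a, nat \<Rightarrow> ('a \<times> 't \<Rightarrow>\<^sub>0 int) set) module) d h. add_coresolution A U Ts d h"
    using add_coresolutionI[OF U addW induced_coresolution[OF indW induced_regular cD(2)]
        induced_hom_exact[OF indW induced_regular cD(2) U exV]] by (intro exI)
  show ?thesis unfolding wakamatsu_tilting_def U_def[symmetric] using U 1 2 3 by (intro conjI)
qed

end
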